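(* Let $T$ be a complete totally transcendental theory eliminating imaginaries, $A$ a small set of parameters, $M$ a prime model over $A$, and $B$ a normal set, $A\subseteq B\subseteq M$. Let $\{B_i\}_{i\in I}$ be a family of normal sets $A\subseteq B_i\subseteq B$ which forms a directed system under inclusion and satisfies $\bigcup_{i\in I}B_i=B$. Then $\varprojlim \mathrm{Aut}(B_i/A)\cong\mathrm{Aut}(B/A)$. Moreover, if $G$ is an $A$-definable group (and the sets $B_i$, hence $B$, are $\mathrm{dcl}$-closed), then $$\varinjlim H^1_{\mathrm{def}}(B_i/A,G(B_i))\cong H^1_{\mathrm{def}}(B/A,G(B))$$ as pointed sets.
   Context: $A$ lies in a monster model $\bar M$ of $T$ and $M\prec\bar M$; $\mathrm{dcl}$ is computed in $\bar M$. A set $A\subseteq B\subseteq M$ is normal (in $M$ over $A$) if for all $b\in B$, $b'\in M$ with $\mathrm{tp}(b/A)=\mathrm{tp}(b'/A)$ one has $b'\in B$. $\mathrm{Aut}(B/A)$ is the group of elementary permutations of $B$ fixing $A$ pointwise; for $B_i\subseteq B_j$ the transition map $\mathrm{Aut}(B_j/A)\to\mathrm{Aut}(B_i/A)$ is restriction. $G(B)$ is the set of points of $G$ with all coordinates in $B$. For $B$ normal and $\mathrm{dcl}$-closed, a definable cocycle is a map $\varphi:\mathrm{Aut}(B/A)\to G(B)$ with $\varphi(\sigma\tau)=\varphi(\sigma)\sigma(\varphi(\tau))$ for which there are a finite tuple $b$ from $B$ and an $A$-definable function $h$ with $\varphi(\sigma)=h(b,\sigma(b))$ for all $\sigma$.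 Cocycles $\varphi,\psi$ are cohomologous if for some $g\in G(B)$, $\varphi(\sigma)=g^{-1}\psi(\sigma)\sigma(g)$ for all $\sigma$. $H^1_{\mathrm{def}}(B/A,G(B))$ is the set of cohomology classes of definable cocycles, pointed by the trivial class; equivalently, the pointed set of $A$-definable isomorphism classes of $A$-definable right principal homogeneous spaces for $G$ with a $B$-point. For normal $B\subseteq C$ the transition map $H^1_{\mathrm{def}}(B/A,G(B))\to H^1_{\mathrm{def}}(C/A,G(C))$ is induced by restriction $\mathrm{Aut}(C/A)\to\mathrm{Aut}(B/A)$ and inclusion $G(B)\subseteq G(C)$. Isomorphism of pointed sets means basepoint-preserving bijection. *)

theory Defs
  imports "HOL-Algebra.Bij" "HOL-Algebra.Product_Groups" "HOL-Library.Disjoint_Sets"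
begin

unbundle cardinal_syntax

section \<open>First-order logic\<close>

text \<open>A language lists its symbols together with their arities, so that languages without function
  symbols (or without relation symbols) are covered although the types of names are nonempty.\<close>

record ('f, 'r) language =
  Funs :: "('f \<times> nat) set"
  Rels :: "('r \<times> nat) set"

datatype 'f tm = Var nat | Fun 'f "'f tm list"

datatype ('f, 'r) fm =
    Bot
  | Eq "'f tm" "'f tm"
  | Rel 'r "'f tm list"
  | Imp "('f, 'r) fm" "('f, 'r) fm"
  | All nat "('f, 'r) fm"

abbreviation Neg :: "('f, 'r) fm \<Rightarrow> ('f, 'r) fm" where
  "Neg \<phi> \<equiv> Imp \<phi> Bot"

primrec wf_tm :: "('f, 'r) language \<Rightarrow> 'f tm \<Rightarrow> bool" where
  "wf_tm L (Var i) \<longleftrightarrow> True"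
| "wf_tm L (Fun f ts) \<longleftrightarrow> (f, length ts) \<in> Funs L \<and> list_all id (map (wf_tm L) ts)"

primrec wf_fm :: "('f, 'r) language \<Rightarrow> ('f, 'r) fm \<Rightarrow> bool" where
  "wf_fm L Bot \<longleftrightarrow> True"
| "wf_fm L (Eq s t) \<longleftrightarrow> wf_tm L s \<and> wf_tm L t"
| "wf_fm L (Rel r ts) \<longleftrightarrow> (r, length ts) \<in> Rels L \<and> list_all (wf_tm L) ts"
| "wf_fm L (Imp \<phi> \<psi>) \<longleftrightarrow> wf_fm L \<phi> \<and> wf_fm L \<psi>"
| "wf_fm L (All i \<phi>) \<longleftrightarrow> wf_fm L \<phi>"

primrec fv_tm :: "'f tm \<Rightarrow> nat set" where
  "fv_tm (Var i) = {i}"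
| "fv_tm (Fun f ts) = \<Union> (set (map fv_tm ts))"

primrec fv_fm :: "('f, 'r) fm \<Rightarrow> nat set" where
  "fv_fm Bot = {}"
| "fv_fm (Eq s t) = fv_tm s \<union> fv_tm t"
| "fv_fm (Rel r ts) = (\<Union>t\<in>set ts. fv_tm t)"
| "fv_fm (Imp \<phi> \<psi>) = fv_fm \<phi> \<union> fv_fm \<psi>"
| "fv_fm (All i \<phi>) = fv_fm \<phi> - {i}"

definition formulas :: "('f, 'r) language \<Rightarrow> nat \<Rightarrow> ('f, 'r) fm set" where
  "formulas L n = {\<phi>. wf_fm L \<phi> \<and> fv_fm \<phi> \<subseteq> {..<n}}"

record ('f, 'r, 'm) struct =
  univ :: "'m set"
  fun_of :: "'f \<Rightarrow> 'm list \<Rightarrow> 'm"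
  rel_of :: "'r \<Rightarrow> 'm list \<Rightarrow> bool"

definition is_structure :: "('f, 'r) language \<Rightarrow> ('f, 'r, 'm) struct \<Rightarrow> bool" where
  "is_structure L S \<longleftrightarrow> univ S \<noteq> {} \<and>
     (\<forall>f xs. (f, length xs) \<in> Funs L \<longrightarrow> set xs \<subseteq> univ S \<longrightarrow> fun_of S f xs \<in> univ S)"

primrec tm_val :: "('f, 'r, 'm) struct \<Rightarrow> (nat \<Rightarrow> 'm) \<Rightarrow> 'f tm \<Rightarrow> 'm" where
  "tm_val S v (Var i) = v i"
| "tm_val S v (Fun f ts) = fun_of S f (map (tm_val S v) ts)"

primrec sat :: "('f, 'r, 'm) struct \<Rightarrow> (nat \<Rightarrow> 'm) \<Rightarrow> ('f, 'r) fm \<Rightarrow> bool" where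
  "sat S v Bot \<longleftrightarrow> False"
| "sat S v (Eq s t) \<longleftrightarrow> tm_val S v s = tm_val S v t"
| "sat S v (Rel r ts) \<longleftrightarrow> rel_of S r (map (tm_val S v) ts)"
| "sat S v (Imp \<phi> \<psi>) \<longleftrightarrow> (sat S v \<phi> \<longrightarrow> sat S v \<psi>)"
| "sat S v (All i \<phi>) \<longleftrightarrow> (\<forall>a\<in>univ S. sat S (v(i := a)) \<phi>)"

text \<open>Satisfaction by a tuple: variable \<open>i\<close> takes the value \<open>xs ! i\<close>. It is only used for formulas in
  \<^term>\<open>formulas L (length xs)\<close>.\<close>

definition holds :: "('f, 'r, 'm) struct \<Rightarrow> 'm list \<Rightarrow> ('f, 'r) fm \<Rightarrow> bool" where
  "holds S xs \<phi> \<longleftrightarrow> sat S (\<lambda>i. xs ! i) \<phi>"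

definition tuples :: "'m set \<Rightarrow> nat \<Rightarrow> 'm list set" where
  "tuples X n = {xs. length xs = n \<and> set xs \<subseteq> X}"


section \<open>Theories, types and definable sets\<close>

definition model_of :: "('f, 'r) language \<Rightarrow> ('f, 'r) fm set \<Rightarrow> ('f, 'r, 'm) struct \<Rightarrow> bool" where
  "model_of L T S \<longleftrightarrow> is_structure L S \<and> (\<forall>\<phi>\<in>T. holds S [] \<phi>)"

text \<open>Consequence. The structures range over those whose elements lie in the type of formulas. That
  type is infinite and at least as large as the language, so by the downward Loewenheim-Skolem
  theorem this is the same as quantifying over all structures.\<close>

definition entails :: "('f, 'r) language \<Rightarrow> ('f, 'r) fm set \<Rightarrow> ('f, 'r) fm \<Rightarrow> bool" where
  "entails L T \<phi> \<longleftrightarrow> (\<forall>S :: ('f, 'r, ('f, 'r) fm) struct. model_of L T S \<longrightarrow> holds S [] \<phi>)"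

text \<open>Exactly one of \<open>\<phi>\<close> and its negation follows from \<open>T\<close>; in particular \<open>T\<close> is consistent.\<close>

definition complete_theory :: "('f, 'r) language \<Rightarrow> ('f, 'r) fm set \<Rightarrow> bool" where
  "complete_theory L T \<longleftrightarrow> T \<subseteq> formulas L 0 \<and>
     (\<forall>\<phi>\<in>formulas L 0. entails L T \<phi> \<noteq> entails L T (Neg \<phi>))"

text \<open>A formula over \<open>A\<close> in \<open>n\<close> variables is a formula together with a tuple of parameters from \<open>A\<close>,
  which is substituted for the variables from \<open>n\<close> on.\<close>

definition formulas_over ::
  "('f, 'r) language \<Rightarrow> 'm set \<Rightarrow> nat \<Rightarrow> (('f, 'r) fm \<times> 'm list) set" where
  "formulas_over L A n = {(\<phi>, as). set as \<subseteq> A \<and> \<phi> \<in> formulas L (n + length as)}"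

definition tp :: "('f, 'r) language \<Rightarrow> ('f, 'r, 'm) struct \<Rightarrow> 'm set \<Rightarrow> 'm list
    \<Rightarrow> (('f, 'r) fm \<times> 'm list) set" where
  "tp L S A xs = {(\<phi>, as) \<in> formulas_over L A (length xs). holds S (xs @ as) \<phi>}"

definition definable_over ::
  "('f, 'r) language \<Rightarrow> ('f, 'r, 'm) struct \<Rightarrow> 'm set \<Rightarrow> nat \<Rightarrow> 'm list set \<Rightarrow> bool" where
  "definable_over L S A n X \<longleftrightarrow>
     (\<exists>(\<phi>, as) \<in> formulas_over L A n. X = {xs \<in> tuples (univ S) n. holds S (xs @ as) \<phi>})"

definition definable_function :: "('f, 'r) language \<Rightarrow> ('f, 'r, 'm) struct \<Rightarrow> 'm set
    \<Rightarrow> nat \<Rightarrow> nat \<Rightarrow> 'm list set \<Rightarrow> ('m list \<Rightarrow> 'm list) \<Rightarrow> bool" where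
  "definable_function L S A k n D h \<longleftrightarrow>
     D \<subseteq> tuples (univ S) k \<and> h \<in> D \<rightarrow> tuples (univ S) n \<and>
     definable_over L S A (k + n) {xs @ h xs | xs. xs \<in> D}"

definition dcl :: "('f, 'r) language \<Rightarrow> ('f, 'r, 'm) struct \<Rightarrow> 'm set \<Rightarrow> 'm set" where
  "dcl L S X = {c. definable_over L S X 1 {[c]}}"

definition elementary_map :: "('f, 'r) language \<Rightarrow> ('f, 'r, 'm) struct \<Rightarrow> 'm set
    \<Rightarrow> ('f, 'r, 'k) struct \<Rightarrow> ('m \<Rightarrow> 'k) \<Rightarrow> bool" where
  "elementary_map L S X S' f \<longleftrightarrow> f ` X \<subseteq> univ S' \<and>
     (\<forall>xs \<phi>. set xs \<subseteq> X \<longrightarrow> \<phi> \<in> formulas L (length xs) \<longrightarrow>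
        (holds S xs \<phi> \<longleftrightarrow> holds S' (map f xs) \<phi>))"

definition elementary_substructure ::
  "('f, 'r) language \<Rightarrow> ('f, 'r, 'm) struct \<Rightarrow> 'm set \<Rightarrow> bool" where
  "elementary_substructure L S M \<longleftrightarrow> M \<subseteq> univ S \<and> is_structure L (S\<lparr>univ := M\<rparr>) \<and>
     elementary_map L (S\<lparr>univ := M\<rparr>) M S id"


section \<open>Monster models and prime models\<close>

definition saturated ::
  "('f, 'r) language \<Rightarrow> 'k rel \<Rightarrow> ('f, 'r, 'm) struct \<Rightarrow> bool" where
  "saturated L \<kappa> S \<longleftrightarrow>
     (\<forall>A n p. A \<subseteq> univ S \<longrightarrow> |A| <o \<kappa> \<longrightarrow> p \<subseteq> formulas_over L A n \<longrightarrow>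
        (\<forall>q\<subseteq>p. finite q \<longrightarrow> (\<exists>xs\<in>tuples (univ S) n. \<forall>(\<phi>, as)\<in>q. holds S (xs @ as) \<phi>)) \<longrightarrow>
        (\<exists>xs\<in>tuples (univ S) n. \<forall>(\<phi>, as)\<in>p. holds S (xs @ as) \<phi>))"

text \<open>An elementary permutation of the universe is the same thing as an automorphism.\<close>

definition strongly_homogeneous ::
  "('f, 'r) language \<Rightarrow> 'k rel \<Rightarrow> ('f, 'r, 'm) struct \<Rightarrow> bool" where
  "strongly_homogeneous L \<kappa> S \<longleftrightarrow>
     (\<forall>A f. A \<subseteq> univ S \<longrightarrow> |A| <o \<kappa> \<longrightarrow> elementary_map L S A S f \<longrightarrow>
        (\<exists>g. bij_betw g (univ S) (univ S) \<and> elementary_map L S (univ S) S g \<and>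
             (\<forall>a\<in>A. g a = f a)))"

text \<open>The monster is \<open>\<kappa>\<close>-saturated and strongly \<open>\<kappa>\<close>-homogeneous, with \<open>\<kappa>\<close> greater than the number of
  formulas (so \<open>\<kappa>\<close> is uncountable). Small means of cardinality below \<open>\<kappa>\<close>.\<close>

definition monster_model ::
  "('f, 'r) language \<Rightarrow> ('f, 'r) fm set \<Rightarrow> 'k rel \<Rightarrow> ('f, 'r, 'm) struct \<Rightarrow> bool" where
  "monster_model L T \<kappa> S \<longleftrightarrow> model_of L T S \<and> Card_order \<kappa> \<and> |{\<phi>. wf_fm L \<phi>}| <o \<kappa> \<and>
     saturated L \<kappa> S \<and> strongly_homogeneous L \<kappa> S"

text \<open>\<open>M\<close> is prime over \<open>A\<close>: every elementary map from \<open>A\<close> into a model of \<open>T\<close> extends to an elementary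
  embedding of \<open>M\<close>. Models with elements in the type of the monster \<open>S\<close> suffice: by
  Loewenheim-Skolem and saturation, the image of a small \<open>A\<close> in any model of \<open>T\<close> lies in an
  elementary submodel isomorphic to an elementary submodel of \<open>S\<close>.\<close>

definition prime_over :: "('f, 'r) language \<Rightarrow> ('f, 'r) fm set \<Rightarrow> ('f, 'r, 'm) struct
    \<Rightarrow> 'm set \<Rightarrow> 'm set \<Rightarrow> bool" where
  "prime_over L T S A M \<longleftrightarrow> elementary_substructure L S M \<and> A \<subseteq> M \<and>
     (\<forall>(N :: ('f, 'r, 'm) struct) f. model_of L T N \<longrightarrow> elementary_map L S A N f \<longrightarrow>
        (\<exists>g. elementary_map L (S\<lparr>univ := M\<rparr>) M N g \<and> (\<forall>a\<in>A. g a = f a)))"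


section \<open>Properties of a complete theory, read off in its monster model\<close>

text \<open>\<open>has_Morley_rank L S n X\<close> says that the definable set \<open>X\<close> of \<open>n\<close>-tuples has Morley rank
  less than \<open>\<infinity>\<close>. Recall that the rank of \<open>X\<close> is at least \<open>0\<close> iff \<open>X\<close> is nonempty, and at least
  \<open>\<alpha> + 1\<close> iff \<open>X\<close> contains infinitely many pairwise disjoint definable sets of rank at least \<open>\<alpha>\<close>,
  with the obvious clause at limits. The sets of rank below \<open>\<alpha>\<close>, for growing \<open>\<alpha>\<close>, are therefore the
  stages of the following inductive definition.\<close>

inductive has_Morley_rank :: "('f, 'r) language \<Rightarrow> ('f, 'r, 'm) struct \<Rightarrow> nat \<Rightarrow> 'm list set \<Rightarrow> bool"
  for L S n where
  empty: "has_Morley_rank L S n {}"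
| step: "definable_over L S (univ S) n X \<Longrightarrow>
    (\<And>Y :: nat \<Rightarrow> 'm list set.
       (\<forall>i. definable_over L S (univ S) n (Y i) \<and> Y i \<subseteq> X) \<and> disjoint_family Y \<Longrightarrow>
       (\<exists>i. has_Morley_rank L S n (Y i))) \<Longrightarrow>
    has_Morley_rank L S n X"

definition totally_transcendental ::
  "('f, 'r) language \<Rightarrow> ('f, 'r, 'm) struct \<Rightarrow> bool" where
  "totally_transcendental L S \<longleftrightarrow>
     (\<forall>n X. definable_over L S (univ S) n X \<longrightarrow> has_Morley_rank L S n X)"

text \<open>Every class of a \<open>0\<close>-definable equivalence relation on \<open>n\<close>-tuples is defined by a formula
  \<open>\<phi>(x, c)\<close> for exactly one real tuple \<open>c\<close>, i.e. each imaginary is interdefinable with a real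
  tuple.\<close>

definition eliminates_imaginaries ::
  "('f, 'r) language \<Rightarrow> ('f, 'r, 'm) struct \<Rightarrow> bool" where
  "eliminates_imaginaries L S \<longleftrightarrow>
     (\<forall>n E. equiv (tuples (univ S) n) E \<longrightarrow>
        definable_over L S {} (n + n) {xs @ ys | xs ys. (xs, ys) \<in> E} \<longrightarrow>
        (\<forall>X \<in> tuples (univ S) n // E. \<exists>k. \<exists>\<phi>\<in>formulas L (n + k).
           \<exists>!c. c \<in> tuples (univ S) k \<and> X = {xs \<in> tuples (univ S) n. holds S (xs @ c) \<phi>}))"


section \<open>Normal sets, automorphism groups, definable cohomology\<close>

definition normal_set :: "('f, 'r) language \<Rightarrow> ('f, 'r, 'm) struct
    \<Rightarrow> 'm set \<Rightarrow> 'm set \<Rightarrow> 'm set \<Rightarrow> bool" where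
  "normal_set L S A M B \<longleftrightarrow> A \<subseteq> B \<and> B \<subseteq> M \<and>
     (\<forall>b\<in>B. \<forall>b'\<in>M. tp L S A [b] = tp L S A [b'] \<longrightarrow> b' \<in> B)"

definition dcl_closed :: "('f, 'r) language \<Rightarrow> ('f, 'r, 'm) struct \<Rightarrow> 'm set \<Rightarrow> bool" where
  "dcl_closed L S B \<longleftrightarrow> dcl L S B = B"

definition AutGroup :: "('f, 'r) language \<Rightarrow> ('f, 'r, 'm) struct
    \<Rightarrow> 'm set \<Rightarrow> 'm set \<Rightarrow> ('m \<Rightarrow> 'm) monoid" where
  "AutGroup L S A B = (BijGroup B)
     \<lparr>carrier := {\<sigma> \<in> Bij B. elementary_map L S B S \<sigma> \<and> (\<forall>a\<in>A. \<sigma> a = a)}\<rparr>"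

text \<open>A definable group consists of \<open>n\<close>-tuples from the monster.\<close>

definition definable_group :: "('f, 'r) language \<Rightarrow> ('f, 'r, 'm) struct
    \<Rightarrow> 'm set \<Rightarrow> nat \<Rightarrow> 'm list monoid \<Rightarrow> bool" where
  "definable_group L S A n G \<longleftrightarrow> group G \<and> definable_over L S A n (carrier G) \<and>
     definable_over L S A (3 * n)
       {x @ y @ (x \<otimes>\<^bsub>G\<^esub> y) | x y. x \<in> carrier G \<and> y \<in> carrier G}"

definition points :: "'m list monoid \<Rightarrow> 'm set \<Rightarrow> 'm list set" where
  "points G B = {g \<in> carrier G. set g \<subseteq> B}"

definition definable_cocycles :: "('f, 'r) language \<Rightarrow> ('f, 'r, 'm) struct
    \<Rightarrow> 'm set \<Rightarrow> nat \<Rightarrow> 'm list monoid \<Rightarrow> 'm set \<Rightarrow> (('m \<Rightarrow> 'm) \<Rightarrow> 'm list) set" where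
  "definable_cocycles L S A n G B =
     {\<phi> \<in> carrier (AutGroup L S A B) \<rightarrow>\<^sub>E points G B.
        (\<forall>\<sigma> \<in> carrier (AutGroup L S A B). \<forall>\<tau> \<in> carrier (AutGroup L S A B).
           \<phi> (\<sigma> \<otimes>\<^bsub>AutGroup L S A B\<^esub> \<tau>) = \<phi> \<sigma> \<otimes>\<^bsub>G\<^esub> map \<sigma> (\<phi> \<tau>)) \<and>
        (\<exists>b D h. set b \<subseteq> B \<and> definable_function L S A (2 * length b) n D h \<and>
           (\<forall>\<sigma> \<in> carrier (AutGroup L S A B). b @ map \<sigma> b \<in> D \<and> \<phi> \<sigma> = h (b @ map \<sigma> b)))}"

definition cohomologous :: "('f, 'r) language \<Rightarrow> ('f, 'r, 'm) struct \<Rightarrow> 'm set \<Rightarrow> nat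
    \<Rightarrow> 'm list monoid \<Rightarrow> 'm set
    \<Rightarrow> ((('m \<Rightarrow> 'm) \<Rightarrow> 'm list) \<times> (('m \<Rightarrow> 'm) \<Rightarrow> 'm list)) set" where
  "cohomologous L S A n G B =
     {(\<phi>, \<psi>). \<phi> \<in> definable_cocycles L S A n G B \<and> \<psi> \<in> definable_cocycles L S A n G B \<and>
        (\<exists>g\<in>points G B. \<forall>\<sigma> \<in> carrier (AutGroup L S A B).
           \<phi> \<sigma> = inv\<^bsub>G\<^esub> g \<otimes>\<^bsub>G\<^esub> \<psi> \<sigma> \<otimes>\<^bsub>G\<^esub> map \<sigma> g)}"

definition H1_def :: "('f, 'r) language \<Rightarrow> ('f, 'r, 'm) struct \<Rightarrow> 'm set \<Rightarrow> nat
    \<Rightarrow> 'm list monoid \<Rightarrow> 'm set \<Rightarrow> (('m \<Rightarrow> 'm) \<Rightarrow> 'm list) set set" where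
  "H1_def L S A n G B = definable_cocycles L S A n G B // cohomologous L S A n G B"

definition H1_base :: "('f, 'r) language \<Rightarrow> ('f, 'r, 'm) struct \<Rightarrow> 'm set \<Rightarrow> nat
    \<Rightarrow> 'm list monoid \<Rightarrow> 'm set \<Rightarrow> (('m \<Rightarrow> 'm) \<Rightarrow> 'm list) set" where
  "H1_base L S A n G B =
     cohomologous L S A n G B `` {\<lambda>\<sigma>\<in>carrier (AutGroup L S A B). \<one>\<^bsub>G\<^esub>}"

text \<open>For normal \<open>B \<subseteq> C\<close>: the class of a cocycle \<open>\<phi>\<close> on \<open>Aut(B/A)\<close> goes to the class of
  \<open>\<sigma> \<mapsto> \<phi>(\<sigma>|B)\<close> on \<open>Aut(C/A)\<close>.\<close>

definition H1_trans :: "('f, 'r) language \<Rightarrow> ('f, 'r, 'm) struct \<Rightarrow> 'm set \<Rightarrow> nat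
    \<Rightarrow> 'm list monoid \<Rightarrow> 'm set \<Rightarrow> 'm set
    \<Rightarrow> (('m \<Rightarrow> 'm) \<Rightarrow> 'm list) set \<Rightarrow> (('m \<Rightarrow> 'm) \<Rightarrow> 'm list) set" where
  "H1_trans L S A n G B C c = cohomologous L S A n G C ``
     ((\<lambda>\<phi>. \<lambda>\<sigma>\<in>carrier (AutGroup L S A C). \<phi> (restrict \<sigma> B)) ` c)"


section \<open>Limits\<close>

definition directed_on :: "'i set \<Rightarrow> ('i \<Rightarrow> 'i \<Rightarrow> bool) \<Rightarrow> bool" where
  "directed_on I leq \<longleftrightarrow> I \<noteq> {} \<and> (\<forall>i\<in>I. \<forall>j\<in>I. \<exists>k\<in>I. leq i k \<and> leq j k)"

definition incl_order :: "('i \<Rightarrow> 'm set) \<Rightarrow> 'i \<Rightarrow> 'i \<Rightarrow> bool" where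
  "incl_order Bs i j \<longleftrightarrow> Bs i \<subseteq> Bs j"

text \<open>Here \<open>t i j\<close>, for \<open>leq i j\<close>, is the transition map from the \<open>j\<close>-th to the \<open>i\<close>-th group.\<close>

definition inverse_limit :: "'i set \<Rightarrow> ('i \<Rightarrow> 'i \<Rightarrow> bool) \<Rightarrow> ('i \<Rightarrow> 'a monoid)
    \<Rightarrow> ('i \<Rightarrow> 'i \<Rightarrow> 'a \<Rightarrow> 'a) \<Rightarrow> ('i \<Rightarrow> 'a) monoid" where
  "inverse_limit I leq H t = (product_group I H)
     \<lparr>carrier := {x \<in> carrier (product_group I H).
                   \<forall>i\<in>I. \<forall>j\<in>I. leq i j \<longrightarrow> t i j (x j) = x i}\<rparr>"

text \<open>Here \<open>t i j\<close>, for \<open>leq i j\<close>, is the transition map from the \<open>i\<close>-th to the \<open>j\<close>-th set.\<close>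

definition direct_limit_rel :: "'i set \<Rightarrow> ('i \<Rightarrow> 'i \<Rightarrow> bool) \<Rightarrow> ('i \<Rightarrow> 'a set)
    \<Rightarrow> ('i \<Rightarrow> 'i \<Rightarrow> 'a \<Rightarrow> 'a) \<Rightarrow> (('i \<times> 'a) \<times> ('i \<times> 'a)) set" where
  "direct_limit_rel I leq X t =
     {((i, x), (j, y)). (i, x) \<in> Sigma I X \<and> (j, y) \<in> Sigma I X \<and>
        (\<exists>k\<in>I. leq i k \<and> leq j k \<and> t i k x = t j k y)}"

definition direct_limit :: "'i set \<Rightarrow> ('i \<Rightarrow> 'i \<Rightarrow> bool) \<Rightarrow> ('i \<Rightarrow> 'a set)
    \<Rightarrow> ('i \<Rightarrow> 'i \<Rightarrow> 'a \<Rightarrow> 'a) \<Rightarrow> ('i \<times> 'a) set set" where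
  "direct_limit I leq X t = Sigma I X // direct_limit_rel I leq X t"

text \<open>All the \<open>(i, pt i)\<close> lie in one class.\<close>

definition direct_limit_base :: "'i set \<Rightarrow> ('i \<Rightarrow> 'i \<Rightarrow> bool) \<Rightarrow> ('i \<Rightarrow> 'a set)
    \<Rightarrow> ('i \<Rightarrow> 'i \<Rightarrow> 'a \<Rightarrow> 'a) \<Rightarrow> ('i \<Rightarrow> 'a) \<Rightarrow> ('i \<times> 'a) set" where
  "direct_limit_base I leq X t pt = direct_limit_rel I leq X t `` {(i, pt i) | i. i \<in> I}"

definition Aut_limit :: "('f, 'r) language \<Rightarrow> ('f, 'r, 'm) struct \<Rightarrow> 'm set
    \<Rightarrow> 'i set \<Rightarrow> ('i \<Rightarrow> 'm set) \<Rightarrow> ('i \<Rightarrow> 'm \<Rightarrow> 'm) monoid" where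
  "Aut_limit L S A I Bs = inverse_limit I (incl_order Bs) (\<lambda>i. AutGroup L S A (Bs i))
     (\<lambda>i j \<sigma>. restrict \<sigma> (Bs i))"

end

theory Submission
  imports Defs "HOL-Library.Countable_Set"
begin

text \<open>The restriction maps between the groups \<open>Aut(B\<^sub>i/A)\<close> are well defined because the sets are normal,
  and compatible families glue along the directed union. For the second part, a definable cocycle on
  \<open>B\<close> is \<open>\<sigma> \<mapsto> h(b, \<sigma> b)\<close> with \<open>b\<close> from some \<open>B\<^sub>i\<close>, and a cohomology on \<open>B\<close> is given by some
  \<open>g \<in> G(B\<^sub>i)\<close>. To descend the cocycle identity and the cohomology relation to \<open>Aut(B\<^sub>i/A)\<close>, one needs
  that each \<open>\<sigma> \<in> Aut(B\<^sub>i/A)\<close> agrees on a given finite set with an element of \<open>Aut(B/A)\<close>, which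
  follows from finite homogeneity of the prime model \<open>M\<close> over \<open>A\<close>.

  Homogeneity of \<open>M\<close> is the substance of the proof. Isolated types are dense, so \<open>M\<close> contains
  a constructible model \<open>N\<close> over \<open>A\<close>, and \<open>M\<close> embeds into \<open>N\<close> over \<open>A\<close>, with image \<open>M'\<close>. Attach to
  each element of \<open>N\<close> a finite support of its isolating formula and a finite set over which its type
  over \<open>M'\<close> and its predecessors does not split. If \<open>K \<subseteq> N\<close> is closed under these
  two assignments, then every type over \<open>A \<union> (K \<inter> M')\<close> realised in \<open>M'\<close> is isolated: over \<open>A\<close>
  and finitely many further points of \<open>M'\<close> it is isolated by some \<open>\<theta>\<close>, and nonsplitting makes all
  solutions of \<open>\<theta>\<close> in \<open>M'\<close> agree over \<open>K\<close>. As closures of points are countable, a back-and-forth argument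
  as in Ressayre's theorem builds automorphisms of \<open>M'\<close>, hence of \<open>M\<close>.\<close>

section \<open>Formulas with named variables\<close>

text \<open>Isolation over \<open>A\<close> and finite sets lets partial maps grow by finitely many
  points only: once the domain has become infinite, the type of the next point over it may fail to
  be isolated. Limit stages are thus the obstacle, and closed sets are made to survive them, since
  over a closed set and finitely many more points isolation holds again. Two assignments are needed
  because isolating formulas live over points of \<open>N\<close>, while the maps are built on
  \<open>M'\<close>, which is not known to be constructible; nonsplitting controls the parameters
  outside \<open>M'\<close>. Total transcendence enters twice through one fact, the absence of
  binary trees of definable sets: it makes isolated types dense, and it makes types nonsplitting
  over a finite set. This finiteness keeps closures countable, so that \<omega> many finite
  extensions close domain and range simultaneously. On the cohomological side, restriction maps are
  used only through the density of their images for pointwise convergence. Definable cocycles are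
  locally constant, and \<open>dcl\<close>-closedness keeps their values in the smaller set.\<close>

primrec ren_tm :: "'f tm \<Rightarrow> (nat \<Rightarrow> nat) \<Rightarrow> 'f tm" where
  "ren_tm (Var i) f = Var (f i)"
| "ren_tm (Fun g ts) f = Fun g (map (\<lambda>t. ren_tm t f) ts)"

text \<open>Renaming must not capture: under a quantifier the bound variable becomes a number above
  all images of the remaining free variables, whatever \<open>f\<close> is; \<open>insert 0\<close>
  covers the case that there are none. Non-injective \<open>f\<close> are allowed, so renaming can
  also identify variables.\<close>

primrec ren :: "('f, 'r) fm \<Rightarrow> (nat \<Rightarrow> nat) \<Rightarrow> ('f, 'r) fm" where
  "ren Bot f = Bot"
| "ren (Eq s t) f = Eq (ren_tm s f) (ren_tm t f)"
| "ren (Rel r ts) f = Rel r (map (\<lambda>t. ren_tm t f) ts)"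
| "ren (Imp \<phi> \<psi>) f = Imp (ren \<phi> f) (ren \<psi> f)"
| "ren (All i \<phi>) f =
    (let k = Suc (Max (insert 0 (f ` (fv_fm \<phi> - {i})))) in All k (ren \<phi> (f(i := k))))"

lemma finite_fv_tm [simp]: "finite (fv_tm t)"
  by (induction t) auto

lemma finite_fv_fm [simp]: "finite (fv_fm \<phi>)"
  by (induction \<phi>) auto

lemma tm_val_cong: "(\<And>i. i \<in> fv_tm t \<Longrightarrow> v i = w i) \<Longrightarrow> tm_val S v t = tm_val S w t"
proof (induction t)
  case (Fun f ts)
  have "map (tm_val S v) ts = map (tm_val S w) ts"
    using Fun by auto
  then show ?case by (simp del: map_eq_conv)
qed simp

lemma sat_cong: "(\<And>i. i \<in> fv_fm \<phi> \<Longrightarrow> v i = w i) \<Longrightarrow> sat S v \<phi> = sat S w \<phi>"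
proof (induction \<phi> arbitrary: v w)
  case (Eq s t)
  then show ?case by (simp add: tm_val_cong[of s v w] tm_val_cong[of t v w])
next
  case (Rel r ts)
  have "map (tm_val S v) ts = map (tm_val S w) ts"
    using Rel by (auto intro!: tm_val_cong)
  then show ?case by (simp del: map_eq_conv)
next
  case (Imp \<phi> \<psi>)
  have "sat S v \<phi> = sat S w \<phi>" using Imp.prems by (intro Imp.IH(1)) simp
  moreover have "sat S v \<psi> = sat S w \<psi>" using Imp.prems by (intro Imp.IH(2)) simp
  ultimately show ?case by simp
next
  case (All i \<phi>)
  have "sat S (v(i := a)) \<phi> = sat S (w(i := a)) \<phi>" for a
    using All.prems by (intro All.IH) simp
  then show ?case by simp
qed simp

lemma tm_val_ren: "tm_val S v (ren_tm t f) = tm_val S (\<lambda>i. v (f i)) t"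
proof (induction t)
  case (Fun g ts)
  have "map (\<lambda>t. tm_val S v (ren_tm t f)) ts = map (tm_val S (\<lambda>i. v (f i))) ts"
    using Fun by auto
  then show ?case by (simp add: o_def del: map_eq_conv)
qed simp

lemma sat_ren: "sat S v (ren \<phi> f) = sat S (\<lambda>i. v (f i)) \<phi>"
proof (induction \<phi> arbitrary: v f)
  case (Rel r ts)
  have "map (\<lambda>t. tm_val S v (ren_tm t f)) ts = map (tm_val S (\<lambda>i. v (f i))) ts"
    by (simp add: tm_val_ren)
  then show ?case by (simp add: o_def del: map_eq_conv)
next
  case (All i \<phi>)
  define k where "k = Suc (Max (insert 0 (f ` (fv_fm \<phi> - {i}))))"
  have fresh: "f j \<noteq> k" if "j \<in> fv_fm \<phi> - {i}" for j
  proof -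
    have "f j \<le> Max (insert 0 (f ` (fv_fm \<phi> - {i})))"
      using that by (intro Max_ge) auto
    then show ?thesis by (simp add: k_def)
  qed
  have "sat S (v(k := a)) (ren \<phi> (f(i := k))) = sat S ((\<lambda>i. v (f i))(i := a)) \<phi>" for a
    unfolding All.IH using fresh by (intro sat_cong) auto
  then show ?case by (simp add: k_def[symmetric])
qed (simp_all add: tm_val_ren)

lemma fv_ren_tm: "fv_tm (ren_tm t f) = f ` fv_tm t"
  by (induction t) auto

lemma fv_ren: "fv_fm (ren \<phi> f) = f ` fv_fm \<phi>"
proof (induction \<phi> arbitrary: f)
  case (All i \<phi>)
  define k where "k = Suc (Max (insert 0 (f ` (fv_fm \<phi> - {i}))))"
  have "f j \<noteq> k" if "j \<in> fv_fm \<phi> - {i}" for j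
  proof -
    have "f j \<le> Max (insert 0 (f ` (fv_fm \<phi> - {i})))"
      using that by (intro Max_ge) auto
    then show ?thesis by (simp add: k_def)
  qed
  then have "(f(i := k)) ` fv_fm \<phi> - {k} = f ` (fv_fm \<phi> - {i})"
    by (auto simp: image_iff)
  then show ?case by (simp add: k_def[symmetric] All.IH)
qed (auto simp: fv_ren_tm)

lemma wf_ren_tm: "wf_tm L (ren_tm t f) = wf_tm L t"
  by (induction t) (auto simp: list_all_iff)

lemma wf_ren: "wf_fm L (ren \<phi> f) = wf_fm L \<phi>"
  by (induction \<phi> arbitrary: f) (auto simp: wf_ren_tm list_all_iff Let_def)

locale fo_structure =
  fixes L :: "('f, 'r) language" and S :: "('f, 'r, 'm) struct"
begin

text \<open>The free variables of a formula carry names from \<open>E\<close>. When the names are elements of the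
  structure, formulas with parameters, partial types and elementary maps only differ in the
  valuation of the names.\<close>

definition Fm :: "'v set \<Rightarrow> (('v \<Rightarrow> 'm) \<Rightarrow> bool) \<Rightarrow> bool" where
  "Fm E \<Phi> \<longleftrightarrow> (\<exists>\<phi> \<rho>. wf_fm L \<phi> \<and> \<rho> ` fv_fm \<phi> \<subseteq> E \<and> \<Phi> = (\<lambda>g. sat S (g \<circ> \<rho>) \<phi>))"

lemma Fm_mono: "Fm E \<Phi> \<Longrightarrow> E \<subseteq> E' \<Longrightarrow> Fm E' \<Phi>"
  unfolding Fm_def by blast

lemma Fm_finite: "Fm E \<Phi> \<Longrightarrow> \<exists>F\<subseteq>E. finite F \<and> Fm F \<Phi>"
  unfolding Fm_def by (metis finite_fv_fm finite_imageI order_refl)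

lemma Fm_cong:
  assumes "Fm E \<Phi>" "\<And>x. x \<in> E \<Longrightarrow> g x = h x"
  shows "\<Phi> g = \<Phi> h"
proof -
  obtain \<phi> \<rho> where "\<rho> ` fv_fm \<phi> \<subseteq> E" "\<Phi> = (\<lambda>g. sat S (g \<circ> \<rho>) \<phi>)"
    using assms(1) unfolding Fm_def by blast
  then show ?thesis using assms(2) by (auto intro!: sat_cong)
qed

lemma Fm_subst: "Fm E \<Phi> \<Longrightarrow> h ` E \<subseteq> E' \<Longrightarrow> Fm E' (\<lambda>g. \<Phi> (\<lambda>x. g (h x)))"
  unfolding Fm_def
proof (elim exE conjE)
  fix \<phi> \<rho> assume "wf_fm L \<phi>" "\<rho> ` fv_fm \<phi> \<subseteq> E" "\<Phi> = (\<lambda>g. sat S (g \<circ> \<rho>) \<phi>)" "h ` E \<subseteq> E'"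
  then show "\<exists>\<phi> \<rho>. wf_fm L \<phi> \<and> \<rho> ` fv_fm \<phi> \<subseteq> E' \<and>
      (\<lambda>g. \<Phi> (\<lambda>x. g (h x))) = (\<lambda>g. sat S (g \<circ> \<rho>) \<phi>)"
    by (intro exI[of _ \<phi>] exI[of _ "h \<circ> \<rho>"]) (auto simp: o_def)
qed

lemma Fm_False: "Fm E (\<lambda>_. False)"
  unfolding Fm_def by (intro exI[of _ Bot]) auto

lemma Fm_imp:
  assumes "Fm E \<Phi>" "Fm E \<Psi>"
  shows "Fm E (\<lambda>g. \<Phi> g \<longrightarrow> \<Psi> g)"
proof -
  obtain \<phi> \<rho> where 1: "wf_fm L \<phi>" "\<rho> ` fv_fm \<phi> \<subseteq> E" "\<Phi> = (\<lambda>g. sat S (g \<circ> \<rho>) \<phi>)"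
    using assms(1) unfolding Fm_def by blast
  obtain \<psi> \<rho>' where 2: "wf_fm L \<psi>" "\<rho>' ` fv_fm \<psi> \<subseteq> E" "\<Psi> = (\<lambda>g. sat S (g \<circ> \<rho>') \<psi>)"
    using assms(2) unfolding Fm_def by blast
  \<comment> \<open>The two formulas come with unrelated valuations of the same variables, so they
    are moved to the even and the odd variables.\<close>
  define \<rho>'' where "\<rho>'' i = (if even i then \<rho> (i div 2) else \<rho>' (i div 2))" for i :: nat
  define \<chi> where "\<chi> = Imp (ren \<phi> (\<lambda>i. 2 * i)) (ren \<psi> (\<lambda>i. 2 * i + 1))"
  have "wf_fm L \<chi>" "\<rho>'' ` fv_fm \<chi> \<subseteq> E" "(\<lambda>g. \<Phi> g \<longrightarrow> \<Psi> g) = (\<lambda>g. sat S (g \<circ> \<rho>'') \<chi>)"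
    using 1 2 by (auto simp: \<chi>_def wf_ren fv_ren \<rho>''_def sat_ren o_def)
  then show ?thesis unfolding Fm_def by blast
qed

lemma Fm_not: "Fm E \<Phi> \<Longrightarrow> Fm E (\<lambda>g. \<not> \<Phi> g)"
  using Fm_imp[OF _ Fm_False] by simp

lemma Fm_conj: "Fm E \<Phi> \<Longrightarrow> Fm E \<Psi> \<Longrightarrow> Fm E (\<lambda>g. \<Phi> g \<and> \<Psi> g)"
  using Fm_not[OF Fm_imp[OF _ Fm_not]] by simp

lemma Fm_eq: "x \<in> E \<Longrightarrow> y \<in> E \<Longrightarrow> Fm E (\<lambda>g. g x = g y)"
  unfolding Fm_def
  by (intro exI[of _ "Eq (Var 0) (Var 1)"] exI[of _ "\<lambda>i. if i = 0 then x else y"]) auto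

lemma Fm_all:
  fixes E :: "'v set"
  assumes "Fm (insert x E) \<Phi>"
  shows "Fm E (\<lambda>g. \<forall>y\<in>univ S. \<Phi> (g(x := y)))"
proof -
  obtain \<phi> \<rho> where 1: "wf_fm L \<phi>" "\<rho> ` fv_fm \<phi> \<subseteq> insert x E" "\<Phi> = (\<lambda>g. sat S (g \<circ> \<rho>) \<phi>)"
    using assms unfolding Fm_def by blast
  \<comment> \<open>Several variables may carry the name \<open>x\<close>; all are merged into
    variable 0, which is then quantified, and the others move up by one. Hence \<open>i - 1\<close>
    in the new naming.\<close>
  define f where "f i = (if \<rho> i = x then 0 else Suc i)" for i
  define \<psi> where "\<psi> = All 0 (ren \<phi> f)"
  have "wf_fm L \<psi>" using 1 by (simp add: \<psi>_def wf_ren)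
  moreover have "(\<lambda>i. \<rho> (i - 1)) ` fv_fm \<psi> \<subseteq> E"
    using 1 by (auto simp: \<psi>_def fv_ren f_def split: if_splits)
  moreover have "(\<lambda>i. ((g \<circ> (\<lambda>i. \<rho> (i - 1)))(0 := y)) (f i)) = g(x := y) \<circ> \<rho>"
    for g :: "'v \<Rightarrow> 'm" and y
    by (auto simp: f_def)
  then have "(\<lambda>g. \<forall>y\<in>univ S. \<Phi> (g(x := y))) = (\<lambda>g. sat S (g \<circ> (\<lambda>i. \<rho> (i - 1))) \<psi>)"
    by (simp only: \<psi>_def sat_ren 1(3) sat.simps)
  ultimately show ?thesis unfolding Fm_def by blast
qed

lemma Fm_ex: "Fm (insert x E) \<Phi> \<Longrightarrow> Fm E (\<lambda>g. \<exists>y\<in>univ S. \<Phi> (g(x := y)))"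
  using Fm_not[OF Fm_all[OF Fm_not, of x E \<Phi>]] by simp

text \<open>\<open>None\<close> is a variable name that cannot clash with a parameter, even when the
  value of the variable happens to be an element of \<open>E\<close>.\<close>

lemma Fm_all_option:
  fixes E :: "'v set"
  assumes "Fm (insert None (Some ` E)) \<Psi>"
  shows "Fm E (\<lambda>g. \<forall>y\<in>univ S. \<Psi> (case_option y g))"
proof -
  \<comment> \<open>The value of \<open>the\<close> at \<open>None\<close> is arbitrary, but it is
    overwritten by \<open>y\<close>.\<close>
  have "Fm E (\<lambda>g. \<forall>y\<in>univ S. \<Psi> ((\<lambda>o'. g (the o'))(None := y)))"
    by (rule Fm_subst[OF Fm_all[OF assms], of the]) auto
  moreover have "(\<lambda>o'. g (the o'))(None := y) = case_option y g" for g :: "'v \<Rightarrow> 'm" and y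
    by (auto split: option.splits)
  ultimately show ?thesis by simp
qed

lemma Fm_ex_option:
  "Fm (insert None (Some ` E)) \<Psi> \<Longrightarrow> Fm E (\<lambda>g. \<exists>y\<in>univ S. \<Psi> (case_option y g))"
  using Fm_not[OF Fm_all_option[OF Fm_not, of E \<Psi>]] by simp

lemma Fm_to_option:
  assumes "Fm (insert w E) \<Phi>"
  shows "Fm (insert None (Some ` E)) (\<lambda>v. \<Phi> (\<lambda>z. v (if z = w then None else Some z)))"
  by (rule Fm_subst[OF assms]) auto

lemma Fm_from_option:
  fixes E :: "'v set"
  assumes "Fm (insert None (Some ` E)) \<Psi>"
  shows "Fm (insert w E) (\<lambda>g. \<Psi> (case_option (g w) g))"
proof -
  have "Fm (insert w E) (\<lambda>g. \<Psi> (\<lambda>o'. g (case_option w (\<lambda>z. z) o')))"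
    by (rule Fm_subst[OF assms]) auto
  moreover have "(\<lambda>o'. g (case_option w (\<lambda>z. z) o')) = case_option (g w) g" for g :: "'v \<Rightarrow> 'm"
    by (auto split: option.splits)
  ultimately show ?thesis by simp
qed

lemma Fm_ex_finite:
  assumes "finite V" "Fm (V \<union> E) \<Phi>"
  shows "Fm E (\<lambda>g. \<exists>h. h ` V \<subseteq> univ S \<and> \<Phi> (\<lambda>v. if v \<in> V then h v else g v))"
  using assms
proof (induction V arbitrary: \<Phi> rule: finite_induct)
  case (insert x V)
  have eq: "(\<exists>y\<in>univ S. \<exists>h. h ` V \<subseteq> univ S \<and> \<Phi> ((\<lambda>v. if v \<in> V then h v else g v)(x := y)))
     = (\<exists>h. h ` insert x V \<subseteq> univ S \<and> \<Phi> (\<lambda>v. if v \<in> insert x V then h v else g v))" for g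
  proof
    assume "\<exists>y\<in>univ S. \<exists>h. h ` V \<subseteq> univ S \<and> \<Phi> ((\<lambda>v. if v \<in> V then h v else g v)(x := y))"
    then obtain y h where h: "y \<in> univ S" "h ` V \<subseteq> univ S"
      "\<Phi> ((\<lambda>v. if v \<in> V then h v else g v)(x := y))" by blast
    have "(\<lambda>v. if v \<in> V then h v else g v)(x := y)
        = (\<lambda>v. if v \<in> insert x V then (h(x := y)) v else g v)" by auto
    with h have "(h(x := y)) ` insert x V \<subseteq> univ S \<and>
        \<Phi> (\<lambda>v. if v \<in> insert x V then (h(x := y)) v else g v)"
      by auto
    then show "\<exists>h. h ` insert x V \<subseteq> univ S \<and> \<Phi> (\<lambda>v. if v \<in> insert x V then h v else g v)"
      by blast
  next
    assume "\<exists>h. h ` insert x V \<subseteq> univ S \<and> \<Phi> (\<lambda>v. if v \<in> insert x V then h v else g v)"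
    then obtain h where h: "h ` insert x V \<subseteq> univ S"
      "\<Phi> (\<lambda>v. if v \<in> insert x V then h v else g v)" by blast
    have "(\<lambda>v. if v \<in> insert x V then h v else g v)
        = (\<lambda>v. if v \<in> V then h v else g v)(x := h x)" by auto
    with h show "\<exists>y\<in>univ S. \<exists>h. h ` V \<subseteq> univ S \<and>
        \<Phi> ((\<lambda>v. if v \<in> V then h v else g v)(x := y))"
      by (intro bexI[of _ "h x"] exI[of _ h]) auto
  qed
  have eq': "(\<exists>h. h ` V \<subseteq> univ S \<and> (\<exists>y\<in>univ S. \<Phi> ((\<lambda>v. if v \<in> V then h v else g v)(x := y))))
     = (\<exists>y\<in>univ S. \<exists>h. h ` V \<subseteq> univ S \<and> \<Phi> ((\<lambda>v. if v \<in> V then h v else g v)(x := y)))" for g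
    by blast
  have "Fm (V \<union> E) (\<lambda>g. \<exists>y\<in>univ S. \<Phi> (g(x := y)))"
    using insert.prems by (intro Fm_ex) simp
  from insert.IH[OF this] show ?case
    unfolding eq' eq .
qed simp

lemma Fm_holds:
  assumes "\<phi> \<in> formulas L (length us)"
  shows "Fm (set us) (\<lambda>g. holds S (map g us) \<phi>)"
  unfolding Fm_def
proof (intro exI conjI)
  show "wf_fm L \<phi>" "(!) us ` fv_fm \<phi> \<subseteq> set us"
    using assms by (auto simp: formulas_def)
  show "(\<lambda>g. holds S (map g us) \<phi>) = (\<lambda>g. sat S (g \<circ> (!) us) \<phi>)"
    using assms by (auto simp: formulas_def holds_def intro!: ext sat_cong)
qed

text \<open>The way back from names to the indexed tuples of the statement: names outside
  \<open>xs\<close> are collected into the parameter tuple \<open>us\<close>, and each variable is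
  renamed to a position where its name occurs.\<close>

lemma Fm_imp_holds:
  fixes xs :: "'v list"
  assumes "Fm (set xs \<union> E) \<Phi>"
  shows "\<exists>us \<phi>. set us \<subseteq> E \<and> \<phi> \<in> formulas L (length xs + length us) \<and>
           \<Phi> = (\<lambda>g. holds S (map g (xs @ us)) \<phi>)"
proof -
  obtain \<phi> \<rho> where 1: "wf_fm L \<phi>" "\<rho> ` fv_fm \<phi> \<subseteq> set xs \<union> E" "\<Phi> = (\<lambda>g. sat S (g \<circ> \<rho>) \<phi>)"
    using assms unfolding Fm_def by blast
  define us where "us = map \<rho> (sorted_list_of_set {i \<in> fv_fm \<phi>. \<rho> i \<notin> set xs})"
  have us: "set us = \<rho> ` {i \<in> fv_fm \<phi>. \<rho> i \<notin> set xs}"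
    by (simp add: us_def)
  define f where "f i = (SOME j. j < length (xs @ us) \<and> (xs @ us) ! j = \<rho> i)" for i
  have f: "f i < length (xs @ us) \<and> (xs @ us) ! f i = \<rho> i" if "i \<in> fv_fm \<phi>" for i
  proof -
    have "\<rho> i \<in> set (xs @ us)" using that us by auto
    then have "\<exists>j. j < length (xs @ us) \<and> (xs @ us) ! j = \<rho> i" by (simp only: in_set_conv_nth)
    then show ?thesis unfolding f_def by (rule someI_ex)
  qed
  have "f ` fv_fm \<phi> \<subseteq> {..<length xs + length us}"
    using f by (auto simp del: nth_append)
  then have "ren \<phi> f \<in> formulas L (length xs + length us)"
    using 1(1) by (simp add: formulas_def wf_ren fv_ren)
  moreover have "\<Phi> g = holds S (map g (xs @ us)) (ren \<phi> f)" for g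
    unfolding 1(3) holds_def sat_ren
  proof (rule sat_cong)
    fix i assume "i \<in> fv_fm \<phi>"
    from f[OF this] have "map g (xs @ us) ! f i = g (\<rho> i)"
      by (simp only: nth_map)
    then show "(g \<circ> \<rho>) i = map g (xs @ us) ! f i" by simp
  qed
  moreover have "set us \<subseteq> E" using us 1(2) by auto
  ultimately show ?thesis by (intro exI[of _ us] exI[of _ "ren \<phi> f"]) (simp add: fun_eq_iff)
qed

section \<open>Elementary maps and definable sets\<close>

abbreviation U :: "'m set" where "U \<equiv> univ S"

text \<open>One direction is enough because formulas over \<open>E\<close> are closed under
  negation. The valuation \<open>id\<close> lets each element name itself.\<close>

definition elem :: "'m set \<Rightarrow> ('m \<Rightarrow> 'm) \<Rightarrow> bool" where
  "elem E g \<longleftrightarrow> g ` E \<subseteq> U \<and> (\<forall>\<Phi>. Fm E \<Phi> \<longrightarrow> \<Phi> id \<longrightarrow> \<Phi> g)"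

text \<open>Definable subsets of the universe: \<open>None\<close> names the variable and \<open>Some b\<close> the parameter \<open>b\<close>.\<close>

definition dset :: "'m set \<Rightarrow> 'm set set" where
  "dset E = {Y. \<exists>\<Psi>. Fm (insert None (Some ` E)) \<Psi> \<and> Y = {y \<in> U. \<Psi> (case_option y id)}}"

text \<open>\<open>Y\<close> plays the part of an isolating formula: the type of \<open>x\<close>
  over \<open>E\<close> is isolated exactly if there is a least \<open>E\<close>-definable set
  around \<open>x\<close>.\<close>

definition isolated :: "'m set \<Rightarrow> 'm \<Rightarrow> bool" where
  "isolated E x \<longleftrightarrow> (\<exists>Y\<in>dset E. x \<in> Y \<and> (\<forall>Z\<in>dset E. x \<in> Z \<longrightarrow> Y \<subseteq> Z))"

text \<open>The Tarski-Vaught criterion, which describes elementary submodels through definable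
  subsets of \<open>U\<close> only.\<close>

definition tv_closed :: "'m set \<Rightarrow> bool" where
  "tv_closed M \<longleftrightarrow> M \<subseteq> U \<and> (\<forall>Y\<in>dset M. Y \<noteq> {} \<longrightarrow> Y \<inter> M \<noteq> {})"

lemma tv_closed_subset: "tv_closed M \<Longrightarrow> M \<subseteq> U"
  by (simp add: tv_closed_def)

lemma tv_closedD:
  assumes "tv_closed M" "Y \<in> dset M" "y \<in> Y"
  shows "\<exists>z\<in>M. z \<in> Y"
proof -
  have "Y \<inter> M \<noteq> {}" using assms unfolding tv_closed_def by auto
  then show ?thesis by auto
qed

lemma elem_iff:
  assumes "elem E g" "Fm E \<Phi>"
  shows "\<Phi> g \<longleftrightarrow> \<Phi> id"
proof -
  have *: "Fm E \<Psi> \<longrightarrow> \<Psi> id \<longrightarrow> \<Psi> g" for \<Psi>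
    using assms(1) unfolding elem_def by (elim conjE) (erule spec)
  show ?thesis using *[of \<Phi>] *[of "\<lambda>g. \<not> \<Phi> g"] Fm_not[OF assms(2)] assms(2) by auto
qed

lemma elem_image: "elem E g \<Longrightarrow> x \<in> E \<Longrightarrow> g x \<in> U"
  by (simp add: elem_def image_subset_iff)

lemma elem_mono:
  assumes "elem E g" "F \<subseteq> E"
  shows "elem F g"
  unfolding elem_def
proof (intro conjI allI impI)
  show "g ` F \<subseteq> U" using elem_image[OF assms(1)] assms(2) by auto
  fix \<Phi> assume "Fm F \<Phi>" "\<Phi> id"
  with elem_iff[OF assms(1) Fm_mono[OF _ assms(2)], of \<Phi>] show "\<Phi> g" by simp
qed

lemma elem_cong:
  assumes "elem E g" "\<And>x. x \<in> E \<Longrightarrow> g x = h x"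
  shows "elem E h"
  unfolding elem_def
proof (intro conjI allI impI)
  show "h ` E \<subseteq> U" using elem_image[OF assms(1)] assms(2) by auto
  fix \<Phi> assume "Fm E \<Phi>" "\<Phi> id"
  have "\<Phi> g" using elem_iff[OF assms(1) \<open>Fm E \<Phi>\<close>] \<open>\<Phi> id\<close> by simp
  moreover have "\<Phi> g = \<Phi> h" by (rule Fm_cong[OF \<open>Fm E \<Phi>\<close> assms(2)])
  ultimately show "\<Phi> h" by simp
qed

lemma elem_id: "E \<subseteq> U \<Longrightarrow> elem E id"
  unfolding elem_def by simp

lemma elem_finite:
  assumes "\<And>F. finite F \<Longrightarrow> F \<subseteq> E \<Longrightarrow> elem F g"
  shows "elem E g"
  unfolding elem_def
proof (intro conjI allI impI subsetI)
  fix y assume "y \<in> g ` E"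
  then obtain x where "x \<in> E" "y = g x" by blast
  then have "elem {x} g" by (intro assms) auto
  then show "y \<in> U" using elem_image[of "{x}" g x] \<open>y = g x\<close> by simp
next
  fix \<Phi> assume "Fm E \<Phi>" "\<Phi> id"
  from Fm_finite[OF \<open>Fm E \<Phi>\<close>] obtain F where "F \<subseteq> E" "finite F" "Fm F \<Phi>" by blast
  have "elem F g" using \<open>finite F\<close> \<open>F \<subseteq> E\<close> by (rule assms)
  from elem_iff[OF this \<open>Fm F \<Phi>\<close>] \<open>\<Phi> id\<close> show "\<Phi> g" by simp
qed

lemma elem_sat:
  assumes "elem E k" "Fm V \<Phi>" "v ` V \<subseteq> E"
  shows "\<Phi> (\<lambda>x. k (v x)) \<longleftrightarrow> \<Phi> v"
  using elem_iff[OF assms(1) Fm_subst[OF assms(2,3)]] by simp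

lemma elem_comp:
  assumes "elem E g" "elem (g ` E) h"
  shows "elem E (\<lambda>x. h (g x))"
  unfolding elem_def
proof (intro conjI allI impI)
  show "(\<lambda>x. h (g x)) ` E \<subseteq> U" using assms(2) elem_image by auto
  fix \<Phi> assume "Fm E \<Phi>" "\<Phi> id"
  with elem_iff[OF assms(1), of \<Phi>] have "\<Phi> g" by simp
  with elem_sat[OF assms(2) \<open>Fm E \<Phi>\<close>] show "\<Phi> (\<lambda>x. h (g x))" by simp
qed

lemma elem_inj: "elem E g \<Longrightarrow> inj_on g E"
proof (rule inj_onI)
  fix x y assume "elem E g" "x \<in> E" "y \<in> E" "g x = g y"
  with elem_iff[OF _ Fm_eq, of E g x y] show "x = y" by simp
qed

lemma elem_inv:
  assumes "elem E g" "E \<subseteq> U"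
  shows "elem (g ` E) (inv_into E g)"
  unfolding elem_def
proof (intro conjI allI impI)
  have inv: "inv_into E g (g x) = x" if "x \<in> E" for x
    using elem_inj[OF assms(1)] that by simp
  then show "inv_into E g ` g ` E \<subseteq> U" using assms(2) by auto
  fix \<Phi> assume \<Phi>: "Fm (g ` E) \<Phi>" "\<Phi> id"
  let ?i = "inv_into E g"
  have "Fm E (\<lambda>k. \<Phi> (\<lambda>x. k (?i x)))"
    by (rule Fm_subst[OF \<Phi>(1)]) (use inv in auto)
  from elem_iff[OF assms(1) this] have "\<Phi> (\<lambda>x. g (?i x)) = \<Phi> ?i"
    by simp
  moreover have "\<Phi> (\<lambda>x. g (?i x)) = \<Phi> id"
    by (rule Fm_cong[OF \<Phi>(1)]) (use inv in auto)
  ultimately show "\<Phi> ?i" using \<Phi>(2) by simp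
qed

section \<open>Definable subsets of the universe and isolated types\<close>

lemma dsetI:
  fixes E :: "'v set"
  assumes "Fm (insert None (Some ` E)) \<Psi>"
  shows "{y \<in> U. \<Psi> (case_option y g)} \<in> dset (g ` E)"
proof -
  have "Fm (insert None (Some ` g ` E)) (\<lambda>v. \<Psi> (\<lambda>o'. v (map_option g o')))"
    by (rule Fm_subst[OF assms]) auto
  moreover have "(\<lambda>o'. case_option y id (map_option g o')) = case_option y g" for y
    by (auto split: option.splits)
  ultimately show ?thesis unfolding dset_def by auto
qed

lemma dset_name:
  assumes "Fm (insert x E) \<Phi>"
  shows "{y \<in> U. \<Phi> (g(x := y))} \<in> dset (g ` E)"
proof -
  have "(\<lambda>z. case_option y g (if z = x then None else Some z)) = g(x := y)" for y
    by auto
  then show ?thesis using dsetI[OF Fm_to_option[OF assms], of g] by simp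
qed

lemma dsetE:
  assumes "Y \<in> dset E"
  obtains \<Psi> where "Fm (insert None (Some ` E)) \<Psi>" "Y = {y \<in> U. \<Psi> (case_option y id)}"
  using assms unfolding dset_def by blast

lemma dset_mono: "Y \<in> dset E \<Longrightarrow> E \<subseteq> E' \<Longrightarrow> Y \<in> dset E'"
  unfolding dset_def using Fm_mono[of "insert None (Some ` E)" _ "insert None (Some ` E')"]
  by blast

lemma dset_subset: "Y \<in> dset E \<Longrightarrow> Y \<subseteq> U"
  unfolding dset_def by blast

lemma dset_finite:
  assumes "Y \<in> dset E"
  shows "\<exists>F\<subseteq>E. finite F \<and> Y \<in> dset F"
proof -
  from assms obtain \<Psi> where \<Psi>: "Fm (insert None (Some ` E)) \<Psi>" "Y = {y \<in> U. \<Psi> (case_option y id)}"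
    by (rule dsetE)
  obtain F where F: "F \<subseteq> insert None (Some ` E)" "finite F" "Fm F \<Psi>"
    using Fm_finite[OF \<Psi>(1)] by blast
  have "finite (Some -` F)" using F(2) by (simp add: finite_vimageI)
  moreover have "F \<subseteq> insert None (Some ` (Some -` F))" "Some -` F \<subseteq> E"
    using F(1) by auto
  ultimately show ?thesis using Fm_mono[OF F(3)] \<Psi>(2) unfolding dset_def by blast
qed

lemma dset_Int: "Y \<in> dset E \<Longrightarrow> Z \<in> dset E \<Longrightarrow> Y \<inter> Z \<in> dset E"
proof (elim dsetE)
  fix \<Psi> \<Psi>' assume "Fm (insert None (Some ` E)) \<Psi>" "Fm (insert None (Some ` E)) \<Psi>'"
    "Y = {y \<in> U. \<Psi> (case_option y id)}" "Z = {y \<in> U. \<Psi>' (case_option y id)}"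
  then show "Y \<inter> Z \<in> dset E" unfolding dset_def using Fm_conj by blast
qed

lemma dset_Diff: "Y \<in> dset E \<Longrightarrow> Z \<in> dset E \<Longrightarrow> Y - Z \<in> dset E"
proof (elim dsetE)
  fix \<Psi> \<Psi>' assume "Fm (insert None (Some ` E)) \<Psi>" "Fm (insert None (Some ` E)) \<Psi>'"
    "Y = {y \<in> U. \<Psi> (case_option y id)}" "Z = {y \<in> U. \<Psi>' (case_option y id)}"
  moreover from this have "Fm (insert None (Some ` E)) (\<lambda>v. \<Psi> v \<and> \<not> \<Psi>' v)"
    using Fm_conj Fm_not by blast
  ultimately show "Y - Z \<in> dset E" unfolding dset_def by blast
qed

lemma dset_univ: "U \<in> dset E"
  unfolding dset_def using Fm_not[OF Fm_False] by fastforce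

lemma dset_singleton: "x \<in> E \<Longrightarrow> x \<in> U \<Longrightarrow> {x} \<in> dset E"
  unfolding dset_def
  by (rule CollectI, rule exI[of _ "\<lambda>v. v None = v (Some x)"]) (auto intro: Fm_eq)

lemma isolated_mem: "x \<in> E \<Longrightarrow> x \<in> U \<Longrightarrow> isolated E x"
  unfolding isolated_def by (intro bexI[of _ "{x}"]) (auto intro: dset_singleton)

lemma dset_elem_iff:
  assumes "elem (insert x E) g" "Fm (insert None (Some ` E)) \<Psi>"
  shows "\<Psi> (case_option (g x) g) \<longleftrightarrow> \<Psi> (case_option x id)"
  using elem_iff[OF assms(1) Fm_from_option[OF assms(2)]] by simp

lemma dset_elem_mem:
  assumes "elem (insert x E) g" "Y \<in> dset E" "x \<in> Y" "\<And>z. z \<in> E \<Longrightarrow> g z = z"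
  shows "g x \<in> Y"
proof -
  obtain \<Psi> where \<Psi>: "Fm (insert None (Some ` E)) \<Psi>" "Y = {y \<in> U. \<Psi> (case_option y id)}"
    using assms(2) by (rule dsetE)
  have "\<Psi> (case_option (g x) g)"
    using dset_elem_iff[OF assms(1) \<Psi>(1)] assms(3) \<Psi>(2) by simp
  moreover have "\<Psi> (case_option (g x) g) = \<Psi> (case_option (g x) id)"
    by (rule Fm_cong[OF \<Psi>(1)]) (use assms(4) in auto)
  ultimately show ?thesis using \<Psi>(2) elem_image[OF assms(1), of x] by simp
qed

text \<open>One step of extending a partial map. If \<Psi> isolates the type of \<open>w\<close>
  over \<open>E\<close>, then each property \<Phi> of \<open>w\<close> follows from \<Psi>, and this
  implication is a formula over \<open>E\<close> without \<open>w\<close>, which \<open>g\<close>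
  preserves. So every solution of the image of \<Psi> under \<open>g\<close> is an admissible value
  at \<open>w\<close>.\<close>

lemma elem_extend:
  assumes g: "elem E g" and \<Psi>: "Fm (insert None (Some ` E)) \<Psi>"
    and w: "w \<in> U" "\<Psi> (case_option w id)" "w \<notin> E"
    and atom: "\<And>Z. Z \<in> dset E \<Longrightarrow> w \<in> Z \<Longrightarrow> {y \<in> U. \<Psi> (case_option y id)} \<subseteq> Z"
    and y: "y \<in> U" "\<Psi> (case_option y g)"
  shows "elem (insert w E) (g(w := y))"
  unfolding elem_def
proof (intro conjI allI impI)
  show "(g(w := y)) ` insert w E \<subseteq> U" using g y(1) elem_image by auto
  fix \<Phi> assume \<Phi>: "Fm (insert w E) \<Phi>" "\<Phi> id"
  let ?X = "\<lambda>v. \<Phi> (\<lambda>z. v (if z = w then None else Some z))"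
  have eq: "(\<lambda>z. case_option u g (if z = w then None else Some z)) = g(w := u)" for g :: "'m \<Rightarrow> 'm" and u
    by auto
  have "Fm E (\<lambda>g. \<forall>u\<in>U. \<Psi> (case_option u g) \<longrightarrow> \<Phi> (g(w := u)))"
    using Fm_all_option[OF Fm_imp[OF \<Psi> Fm_to_option[OF \<Phi>(1)]]] by (simp only: eq)
  note * = elem_iff[OF g this]
  have "{u \<in> U. \<Phi> (id(w := u))} \<in> dset E"
    using dset_name[OF \<Phi>(1), of id] by simp
  moreover have "id(w := w) = (id :: 'm \<Rightarrow> 'm)" by auto
  then have "w \<in> {u \<in> U. \<Phi> (id(w := u))}" using w \<Phi>(2) by simp
  ultimately have "{u \<in> U. \<Psi> (case_option u id)} \<subseteq> {u \<in> U. \<Phi> (id(w := u))}"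
    by (rule atom)
  then have "\<forall>u\<in>U. \<Psi> (case_option u id) \<longrightarrow> \<Phi> (id(w := u))" by blast
  then have "\<forall>u\<in>U. \<Psi> (case_option u g) \<longrightarrow> \<Phi> (g(w := u))" using * by blast
  then show "\<Phi> (g(w := y))" using y by blast
qed

lemma elem_extend_id:
  assumes "E \<subseteq> U" "Y \<in> dset E" "w \<in> Y" "w \<notin> E"
    and "\<And>Z. Z \<in> dset E \<Longrightarrow> w \<in> Z \<Longrightarrow> Y \<subseteq> Z" "y \<in> Y"
  shows "elem (insert w E) (id(w := y))"
proof -
  obtain \<Psi> where \<Psi>: "Fm (insert None (Some ` E)) \<Psi>" "Y = {y \<in> U. \<Psi> (case_option y id)}"
    using assms(2) by (rule dsetE)
  show ?thesis
    by (rule elem_extend[OF elem_id \<Psi>(1)]) (use assms \<Psi>(2) in auto)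
qed

text \<open>An inclusion of definable sets is a formula over \<open>E\<close>, so minimality of the
  isolating set is preserved by \<open>g\<close>. Sets over the image of \<open>E\<close> are
  brought back by the inverse of \<open>g\<close>.\<close>

lemma isolated_transfer:
  assumes g: "elem (insert x E) g" and E: "E \<subseteq> U" and "isolated E x"
  shows "isolated (g ` E) (g x)"
proof -
  have gE: "elem E g" using g elem_mono by blast
  obtain Y where Y: "Y \<in> dset E" "x \<in> Y" "\<And>Z. Z \<in> dset E \<Longrightarrow> x \<in> Z \<Longrightarrow> Y \<subseteq> Z"
    using assms(3) unfolding isolated_def by blast
  obtain \<Psi> where \<Psi>: "Fm (insert None (Some ` E)) \<Psi>" "Y = {y \<in> U. \<Psi> (case_option y id)}"
    using Y(1) by (rule dsetE)
  define Y' where "Y' = {y \<in> U. \<Psi> (case_option y g)}"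
  have "Y' \<in> dset (g ` E)" unfolding Y'_def by (rule dsetI[OF \<Psi>(1)])
  moreover have "g x \<in> Y'"
    using dset_elem_iff[OF g \<Psi>(1)] Y(2) \<Psi>(2) elem_image[OF g] by (simp add: Y'_def)
  moreover have "Y' \<subseteq> Z'" if Z': "Z' \<in> dset (g ` E)" "g x \<in> Z'" for Z'
  proof -
    obtain \<Xi> where \<Xi>: "Fm (insert None (Some ` g ` E)) \<Xi>" "Z' = {y \<in> U. \<Xi> (case_option y id)}"
      using Z'(1) by (rule dsetE)
    let ?i = "inv_into E g"
    have inv: "?i (g z) = z" if "z \<in> E" for z
      using elem_inj[OF gE] that by simp
    define \<Xi>' where "\<Xi>' = (\<lambda>v. \<Xi> (\<lambda>o'. v (map_option ?i o')))"
    have F: "Fm (insert None (Some ` E)) \<Xi>'"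
      unfolding \<Xi>'_def by (rule Fm_subst[OF \<Xi>(1)]) (use inv in auto)
    have eq: "\<Xi>' (case_option u g) = \<Xi> (case_option u id)" for u
      unfolding \<Xi>'_def by (rule Fm_cong[OF \<Xi>(1)]) (use inv in auto)
    have "\<Xi>' (case_option (g x) g)" using Z'(2) \<Xi>(2) eq by simp
    then have "\<Xi>' (case_option x id)" using dset_elem_iff[OF g F] by simp
    moreover have "{y \<in> U. \<Xi>' (case_option y id)} \<in> dset E"
      using F unfolding dset_def by blast
    moreover have "x \<in> U" using Y(1,2) dset_subset by blast
    ultimately have "Y \<subseteq> {y \<in> U. \<Xi>' (case_option y id)}" using Y(3) by blast
    then have "\<forall>u\<in>U. \<Psi> (case_option u id) \<longrightarrow> \<Xi>' (case_option u id)" using \<Psi>(2) by blast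
    then have "\<forall>u\<in>U. \<Psi> (case_option u g) \<longrightarrow> \<Xi>' (case_option u g)"
      using elem_iff[OF gE Fm_all_option[OF Fm_imp[OF \<Psi>(1) F]]] by simp
    then show "Y' \<subseteq> Z'" unfolding Y'_def \<Xi>(2) eq by blast
  qed
  ultimately show ?thesis unfolding isolated_def by blast
qed

section \<open>Comparison with the definitions of the statement\<close>

lemma elementary_map_iff_elem: "elementary_map L S E S g \<longleftrightarrow> elem E g"
proof
  assume g: "elementary_map L S E S g"
  show "elem E g" unfolding elem_def
  proof (intro conjI allI impI)
    show "g ` E \<subseteq> U" using g unfolding elementary_map_def by blast
    fix \<Phi> assume \<Phi>: "Fm E \<Phi>" "\<Phi> id"
    then have "Fm (set [] \<union> E) \<Phi>" by simp
    from Fm_imp_holds[OF this] obtain us \<phi> where us: "set us \<subseteq> E" "\<phi> \<in> formulas L (length us)"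
      "\<Phi> = (\<lambda>g. holds S (map g us) \<phi>)" by (elim exE conjE) simp
    have "holds S us \<phi>" using \<Phi>(2) us(3) by simp
    then have "holds S (map g us) \<phi>" using g us(1,2) unfolding elementary_map_def by blast
    then show "\<Phi> g" using us(3) by simp
  qed
next
  assume g: "elem E g"
  show "elementary_map L S E S g" unfolding elementary_map_def
  proof (intro conjI allI impI)
    show "g ` E \<subseteq> U" using elem_image[OF g] by auto
    fix xs \<phi> assume "set xs \<subseteq> E" "\<phi> \<in> formulas L (length xs)"
    then have "Fm E (\<lambda>g. holds S (map g xs) \<phi>)" using Fm_holds Fm_mono by blast
    from elem_iff[OF g this] show "holds S xs \<phi> = holds S (map g xs) \<phi>" by simp
  qed
qed

lemma dset_formulaE:
  assumes "Y \<in> dset E"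
  obtains as \<phi> where "set as \<subseteq> E" "\<phi> \<in> formulas L (Suc (length as))"
    "Y = {y \<in> U. holds S (y # as) \<phi>}"
proof -
  obtain \<Psi> where \<Psi>: "Fm (insert None (Some ` E)) \<Psi>" "Y = {y \<in> U. \<Psi> (case_option y id)}"
    using assms by (rule dsetE)
  then have "Fm (set [None] \<union> Some ` E) \<Psi>" by simp
  from Fm_imp_holds[OF this] obtain us \<phi> where us: "set us \<subseteq> Some ` E"
    "\<phi> \<in> formulas L (Suc (length us))" "\<Psi> = (\<lambda>g. holds S (map g (None # us)) \<phi>)"
    by (elim exE conjE) simp
  have eq: "map (case_option y id) (None # us) = y # map the us" for y
    using us(1) by auto
  have "set (map the us) \<subseteq> E" using us(1) by auto
  moreover have "\<phi> \<in> formulas L (Suc (length (map the us)))" using us(2) by simp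
  moreover have "Y = {y \<in> U. holds S (y # map the us) \<phi>}"
    unfolding \<Psi>(2) us(3) eq ..
  ultimately show thesis by (rule that)
qed

lemma dset_imp_definable:
  assumes "Y \<in> dset E"
  shows "definable_over L S E 1 ((\<lambda>y. [y]) ` Y)"
proof -
  obtain as \<phi> where as: "set as \<subseteq> E" "\<phi> \<in> formulas L (Suc (length as))"
    "Y = {y \<in> U. holds S (y # as) \<phi>}"
    using assms by (rule dset_formulaE)
  have "(\<phi>, as) \<in> formulas_over L E 1"
    using as(1,2) by (auto simp: formulas_over_def)
  moreover have "(\<lambda>y. [y]) ` Y = {xs \<in> tuples U 1. holds S (xs @ as) \<phi>}"
    unfolding as(3) by (auto simp: tuples_def length_Suc_conv)
  ultimately show ?thesis unfolding definable_over_def by blast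
qed

lemma tv_closed_if_elementary:
  assumes "elementary_substructure L S M"
  shows "tv_closed M"
  unfolding tv_closed_def
proof (intro conjI ballI impI)
  show "M \<subseteq> U" using assms unfolding elementary_substructure_def by blast
  fix Y assume Y: "Y \<in> dset M" "Y \<noteq> {}"
  obtain as \<phi> where as: "set as \<subseteq> M" and \<phi>: "\<phi> \<in> formulas L (Suc (length as))"
    and mem: "Y = {y \<in> U. holds S (y # as) \<phi>}"
    using Y(1) by (rule dset_formulaE)
  define n where "n = length as"
  \<comment> \<open>In \<phi> the solution is variable 0 and the parameters start at 1, whereas in
    \<psi> the parameters start at 0; the solution moves to variable \<open>n\<close>, the first one
    after the parameters.\<close>
  define f where "f i = (if i = 0 then n else i - 1)" for i
  define \<psi> where "\<psi> = Neg (All n (Neg (ren \<phi> f)))"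
  note \<phi> = \<phi>[folded n_def]
  have \<psi>: "\<psi> \<in> formulas L (length as)"
    using \<phi> by (fastforce simp: \<psi>_def formulas_def wf_ren fv_ren f_def n_def[symmetric])
  have ren: "sat R (((!) as)(n := y)) (ren \<phi> f) = holds R (y # as) \<phi>" for R :: "('f,'r,'m) struct" and y
    unfolding sat_ren holds_def
    by (rule sat_cong) (use \<phi> in \<open>auto simp: formulas_def f_def nth_Cons split: nat.splits\<close>)
  have sat: "holds R as \<psi> \<longleftrightarrow> (\<exists>y\<in>univ R. holds R (y # as) \<phi>)" for R :: "('f,'r,'m) struct"
    by (simp add: holds_def[of _ as] \<psi>_def ren)
  have elem: "holds (S\<lparr>univ := M\<rparr>) xs \<chi> = holds S xs \<chi>"
    if "set xs \<subseteq> M" "\<chi> \<in> formulas L (length xs)" for xs \<chi>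
    using assms that unfolding elementary_substructure_def elementary_map_def by simp
  have "holds S as \<psi>" using Y(2) mem sat by blast
  then have "holds (S\<lparr>univ := M\<rparr>) as \<psi>" using elem as \<psi> by blast
  then obtain y where "y \<in> M" "holds (S\<lparr>univ := M\<rparr>) (y # as) \<phi>" using sat by auto
  moreover from this have "holds S (y # as) \<phi>"
    using elem[of "y # as" \<phi>] as \<phi> by (simp add: n_def)
  ultimately show "Y \<inter> M \<noteq> {}" using mem \<open>M \<subseteq> U\<close> by blast
qed

lemma tm_val_update_univ: "tm_val (S\<lparr>univ := M\<rparr>) v t = tm_val S v t"
proof (induction t)
  case (Fun f ts)
  then have "map (tm_val (S\<lparr>univ := M\<rparr>) v) ts = map (tm_val S v) ts" by auto
  then show ?case by (simp del: map_eq_conv)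
qed simp

lemma tv_closed_sat:
  assumes M: "tv_closed M" and "wf_fm L \<phi>" "v ` fv_fm \<phi> \<subseteq> M"
  shows "sat (S\<lparr>univ := M\<rparr>) v \<phi> = sat S v \<phi>"
  using assms(2,3)
proof (induction \<phi> arbitrary: v)
  {
    case (Eq s t) then show ?case by (simp add: tm_val_update_univ)
  next
    case (Rel r ts)
    have "map (tm_val (S\<lparr>univ := M\<rparr>) v) ts = map (tm_val S v) ts" by (simp add: tm_val_update_univ)
    then show ?case by (simp del: map_eq_conv)
  next
    case (Imp \<phi> \<psi>)
    have "sat (S\<lparr>univ := M\<rparr>) v \<phi> = sat S v \<phi>" by (rule Imp.IH(1)) (use Imp.prems in auto)
    moreover have "sat (S\<lparr>univ := M\<rparr>) v \<psi> = sat S v \<psi>" by (rule Imp.IH(2)) (use Imp.prems in auto)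
    ultimately show ?case by simp
  next
    case (All i \<phi>)
    have "Fm (insert i (fv_fm \<phi> - {i})) (\<lambda>g. sat S g \<phi>)"
      unfolding Fm_def using All.prems(1) by (intro exI[of _ \<phi>] exI[of _ id]) auto
    from dset_name[OF Fm_not[OF this], of v]
    have D: "{y \<in> U. \<not> sat S (v(i := y)) \<phi>} \<in> dset M"
      by (rule dset_mono) (use All.prems in auto)
    have "sat (S\<lparr>univ := M\<rparr>) (v(i := a)) \<phi> = sat S (v(i := a)) \<phi>" if "a \<in> M" for a
      by (rule All.IH) (use All.prems that in auto)
    then have "sat (S\<lparr>univ := M\<rparr>) v (All i \<phi>) \<longleftrightarrow> (\<forall>a\<in>M. sat S (v(i := a)) \<phi>)"
      by simp
    also have "\<dots> \<longleftrightarrow> (\<forall>a\<in>U. sat S (v(i := a)) \<phi>)"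
    proof
      assume *: "\<forall>a\<in>M. sat S (v(i := a)) \<phi>"
      show "\<forall>a\<in>U. sat S (v(i := a)) \<phi>"
      proof (rule ccontr)
        assume "\<not> (\<forall>a\<in>U. sat S (v(i := a)) \<phi>)"
        then obtain a where "a \<in> {y \<in> U. \<not> sat S (v(i := y)) \<phi>}" by auto
        from tv_closedD[OF M D this] * show False by auto
      qed
    qed (use tv_closed_subset[OF M] in auto)
    finally show ?case by simp
  }
qed simp_all

lemma tv_closed_structure:
  assumes M: "tv_closed M" and S: "is_structure L S"
  shows "is_structure L (S\<lparr>univ := M\<rparr>)"
  unfolding is_structure_def
proof (intro conjI allI impI)
  show "univ (S\<lparr>univ := M\<rparr>) \<noteq> {}"
    using tv_closedD[OF M dset_univ] S by (auto simp: is_structure_def)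
  fix f xs assume f: "(f, length xs) \<in> Funs L" "set xs \<subseteq> univ (S\<lparr>univ := M\<rparr>)"
  let ?n = "length xs"
  \<comment> \<open>The value of the function is the only solution of this formula with parameters
    in \<open>M\<close>, so the Tarski-Vaught criterion puts it into \<open>M\<close>.\<close>
  let ?\<phi> = "Eq (Var ?n) (Fun f (map Var [0..<?n])) :: ('f, 'r) fm"
  have "Fm (insert ?n {..<?n}) (\<lambda>g. sat S g ?\<phi>)"
    unfolding Fm_def using f(1)
    by (intro exI[of _ ?\<phi>] exI[of _ id]) (auto simp: list_all_iff)
  from dset_name[OF this, of "(!) xs"]
  have "{y \<in> U. sat S (((!) xs)(?n := y)) ?\<phi>} \<in> dset M"
    by (rule dset_mono) (use f(2) in auto)
  moreover have "map (tm_val S (((!) xs)(?n := y))) (map Var [0..<?n]) = xs" for y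
    by (rule nth_equalityI) auto
  then have sat: "sat S (((!) xs)(?n := y)) ?\<phi> \<longleftrightarrow> y = fun_of S f xs" for y
    by (simp only: sat.simps tm_val.simps fun_upd_same)
  have "fun_of S f xs \<in> U"
    using f tv_closed_subset[OF M] S by (auto simp: is_structure_def)
  with sat have "{y \<in> U. sat S (((!) xs)(?n := y)) ?\<phi>} = {fun_of S f xs}" by auto
  ultimately have "{fun_of S f xs} \<in> dset M" by simp
  then show "fun_of (S\<lparr>univ := M\<rparr>) f xs \<in> univ (S\<lparr>univ := M\<rparr>)"
    using tv_closedD[OF M] by auto
qed

lemma tv_closed_elementary_map:
  assumes "tv_closed M" "tv_closed N" "E \<subseteq> M"
  shows "elementary_map L (S\<lparr>univ := M\<rparr>) E (S\<lparr>univ := N\<rparr>) f \<longleftrightarrow> f ` E \<subseteq> N \<and> elem E f"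
proof -
  have holds: "holds (S\<lparr>univ := M\<rparr>) xs \<phi> = holds S xs \<phi>"
    if "tv_closed M" "set xs \<subseteq> M" "\<phi> \<in> formulas L (length xs)" for M xs \<phi>
    unfolding holds_def
  proof (rule tv_closed_sat)
    have "(!) xs ` fv_fm \<phi> \<subseteq> set xs" using that(3) by (auto simp: formulas_def)
    then show "(!) xs ` fv_fm \<phi> \<subseteq> M" using that(2) by blast
  qed (use that in \<open>auto simp: formulas_def\<close>)
  have "N \<subseteq> U" using assms(2) by (rule tv_closed_subset)
  have "elementary_map L (S\<lparr>univ := M\<rparr>) E (S\<lparr>univ := N\<rparr>) f
      \<longleftrightarrow> f ` E \<subseteq> N \<and> elementary_map L S E S f"
  proof (cases "f ` E \<subseteq> N")
    case True
    have "holds (S\<lparr>univ := N\<rparr>) (map f xs) \<phi> = holds S (map f xs) \<phi>"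
      "holds (S\<lparr>univ := M\<rparr>) xs \<phi> = holds S xs \<phi>"
      if "set xs \<subseteq> E" "\<phi> \<in> formulas L (length xs)" for xs \<phi>
      by (rule holds; use assms True that in auto)+
    then show ?thesis using True \<open>N \<subseteq> U\<close> unfolding elementary_map_def by auto
  qed (simp add: elementary_map_def)
  then show ?thesis by (simp add: elementary_map_iff_elem)
qed

section \<open>Totally transcendental structures\<close>

definition automorphism :: "('m \<Rightarrow> 'm) \<Rightarrow> bool" where
  "automorphism k \<longleftrightarrow> bij_betw k U U \<and> elem U k"

lemma automorphism_id: "automorphism id"
  by (simp add: automorphism_def elem_id)

lemma automorphism_comp:
  assumes "automorphism g" "automorphism h"
  shows "automorphism (\<lambda>x. h (g x))"
proof -
  have "g ` U = U" using assms(1) by (simp add: automorphism_def bij_betw_def)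
  then have "elem U (\<lambda>x. h (g x))"
    using assms elem_comp[of U g h] by (simp add: automorphism_def)
  moreover have "bij_betw (\<lambda>x. h (g x)) U U"
    using bij_betw_trans[of g U U h U] assms by (simp add: automorphism_def o_def)
  ultimately show ?thesis by (simp add: automorphism_def)
qed

lemma automorphism_sat:
  assumes "automorphism k" "Fm V \<Phi>" "v ` V \<subseteq> U"
  shows "\<Phi> (\<lambda>x. k (v x)) \<longleftrightarrow> \<Phi> v"
  by (rule elem_sat[of U]) (use assms in \<open>auto simp: automorphism_def\<close>)

lemma automorphism_image:
  assumes k: "automorphism k" and "E \<subseteq> U" and \<Psi>: "Fm (insert None (Some ` E)) \<Psi>"
  shows "k ` {y \<in> U. \<Psi> (case_option y id)} = {y \<in> U. \<Psi> (case_option y k)}"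
proof -
  have *: "\<Psi> (case_option (k u) k) \<longleftrightarrow> \<Psi> (case_option u id)" if "u \<in> U" for u
  proof -
    have "(\<lambda>o'. k (case_option u id o')) = case_option (k u) k"
      by (auto split: option.splits)
    moreover have "case_option u id ` insert None (Some ` E) \<subseteq> U"
      using that \<open>E \<subseteq> U\<close> by auto
    ultimately show ?thesis using automorphism_sat[OF k \<Psi>, of "case_option u id"] by simp
  qed
  have "k ` U = U" using k unfolding automorphism_def bij_betw_def by simp
  show ?thesis
  proof (intro equalityI subsetI)
    fix y assume "y \<in> k ` {y \<in> U. \<Psi> (case_option y id)}"
    then obtain u where "u \<in> U" "\<Psi> (case_option u id)" "y = k u" by auto
    with *[of u] \<open>k ` U = U\<close> show "y \<in> {y \<in> U. \<Psi> (case_option y k)}" by auto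
  next
    fix y assume y: "y \<in> {y \<in> U. \<Psi> (case_option y k)}"
    then obtain u where "u \<in> U" "y = k u" using \<open>k ` U = U\<close> by blast
    with *[of u] y show "y \<in> k ` {y \<in> U. \<Psi> (case_option y id)}" by auto
  qed
qed

lemma automorphism_dset:
  assumes k: "automorphism k" and "E \<subseteq> U" "Y \<in> dset E"
  shows "k ` Y \<in> dset (k ` E)"
proof -
  obtain \<Psi> where \<Psi>: "Fm (insert None (Some ` E)) \<Psi>" "Y = {y \<in> U. \<Psi> (case_option y id)}"
    using assms(3) by (rule dsetE)
  show ?thesis
    unfolding \<Psi>(2) automorphism_image[OF k \<open>E \<subseteq> U\<close> \<Psi>(1)] by (rule dsetI[OF \<Psi>(1)])
qed

lemma automorphism_fixes_dset:
  assumes k: "automorphism k" and "E \<subseteq> U" "Y \<in> dset E" "\<And>x. x \<in> E \<Longrightarrow> k x = x"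
  shows "k ` Y = Y"
proof -
  obtain \<Psi> where \<Psi>: "Fm (insert None (Some ` E)) \<Psi>" "Y = {y \<in> U. \<Psi> (case_option y id)}"
    using assms(3) by (rule dsetE)
  have "\<Psi> (case_option y k) = \<Psi> (case_option y id)" for y
    by (rule Fm_cong[OF \<Psi>(1)]) (use assms(4) in auto)
  then show ?thesis
    unfolding \<Psi>(2) automorphism_image[OF k \<open>E \<subseteq> U\<close> \<Psi>(1)] by simp
qed

text \<open>Induction on \<open>has_Morley_rank\<close>. Along one branch of the tree the siblings
  of the nodes are infinitely many disjoint definable subsets of the root, and each of them is again
  the root of a tree in \<open>\<F>\<close>; so no member of the family can be the first to receive
  a rank.\<close>

lemma no_binary_tree:
  assumes tt: "totally_transcendental L S"
    and sub: "\<F> \<subseteq> dset U" and ne: "{} \<notin> \<F>"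
    and split: "\<And>Y. Y \<in> \<F> \<Longrightarrow> \<exists>Y1\<in>\<F>. \<exists>Y2\<in>\<F>. Y1 \<subseteq> Y \<and> Y2 \<subseteq> Y \<and> Y1 \<inter> Y2 = {}"
  shows "\<F> = {}"
proof -
  let ?s = "\<lambda>Y. (\<lambda>y. [y]) ` Y :: 'm list set"
  have main: "\<forall>Y\<in>\<F>. X \<noteq> ?s Y" if "has_Morley_rank L S 1 X" for X
    using that
  proof (induction rule: has_Morley_rank.induct)
    case empty
    then show ?case using ne by auto
  next
    case (step X)
    show ?case
    proof (rule ballI, rule notI)
      fix Y assume Y: "Y \<in> \<F>" "X = ?s Y"
      obtain l r where lr: "\<And>Y. Y \<in> \<F> \<Longrightarrow>
          l Y \<in> \<F> \<and> r Y \<in> \<F> \<and> l Y \<subseteq> Y \<and> r Y \<subseteq> Y \<and> l Y \<inter> r Y = {}"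
        using split by metis
      \<comment> \<open>\<open>P\<close> is the branch that always takes the left half, and
        \<open>Z\<close> below collects the right halves left behind.\<close>
      define P where "P n = (l ^^ n) Y" for n
      have P: "P n \<in> \<F>" for n
        by (induction n) (use Y lr in \<open>auto simp: P_def\<close>)
      have P_Suc: "P (Suc n) \<subseteq> P n" "P (Suc n) = l (P n)" for n
        using lr[OF P[of n]] by (simp_all add: P_def)
      have anti: "P n \<subseteq> P m" if "m \<le> n" for m n
        using lift_Suc_antimono_le[of P, OF P_Suc(1) that] .
      define Z where "Z n = r (P n)" for n
      have Z: "Z n \<in> \<F>" "Z n \<subseteq> P n" "P (Suc n) \<inter> Z n = {}" for n
        using lr[OF P[of n]] by (auto simp: Z_def P_Suc(2))
      have disj: "Z m \<inter> Z n = {}" if "m < n" for m n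
        using Z(2)[of n] Z(3)[of m] anti[of "Suc m" n] that by auto
      have "disjoint_family (\<lambda>n. ?s (Z n))"
        unfolding disjoint_family_on_def
      proof (intro ballI impI)
        fix m n :: nat assume "m \<noteq> n"
        then have "Z m \<inter> Z n = {}" using disj[of m n] disj[of n m] by (cases "m < n") auto
        then show "?s (Z m) \<inter> ?s (Z n) = {}" by auto
      qed
      moreover have "definable_over L S U 1 (?s (Z n)) \<and> ?s (Z n) \<subseteq> X" for n
      proof
        show "definable_over L S U 1 (?s (Z n))"
          using sub Z(1) by (intro dset_imp_definable) auto
        have "Z n \<subseteq> Y" using Z(2)[of n] anti[of 0 n] by (auto simp: P_def)
        then show "?s (Z n) \<subseteq> X" using Y(2) by auto
      qed
      ultimately obtain n where "\<forall>Y\<in>\<F>. ?s (Z n) \<noteq> ?s Y"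
        using step.IH[of "\<lambda>n. ?s (Z n)"] by blast
      then show False using Z(1) by blast
    qed
  qed
  have "has_Morley_rank L S 1 (?s Y)" if "Y \<in> \<F>" for Y
    using tt dset_imp_definable[of Y U] sub that unfolding totally_transcendental_def by blast
  then show ?thesis using main by blast
qed

text \<open>Density of isolated types: if no nonempty definable subset of \<open>Y\<close> were an
  atom, each could be cut in two by some \<open>W\<close>, and the repeated halving would form a
  binary tree.\<close>

lemma atom_exists:
  assumes tt: "totally_transcendental L S" and "E \<subseteq> U" "Y \<in> dset E" "Y \<noteq> {}"
  shows "\<exists>Z\<in>dset E. Z \<subseteq> Y \<and> Z \<noteq> {} \<and> (\<forall>W\<in>dset E. W \<inter> Z \<noteq> {} \<longrightarrow> Z \<subseteq> W)"
proof (rule ccontr)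
  assume contra: "\<not> ?thesis"
  let ?F = "{Z \<in> dset E. Z \<subseteq> Y \<and> Z \<noteq> {}}"
  have "?F = {}"
  proof (rule no_binary_tree[OF tt])
    show "?F \<subseteq> dset U" using dset_mono[OF _ \<open>E \<subseteq> U\<close>] by auto
    fix Z assume Z: "Z \<in> ?F"
    then have "Z \<in> dset E" "Z \<subseteq> Y" "Z \<noteq> {}" by auto
    then have "\<not> (\<forall>W\<in>dset E. W \<inter> Z \<noteq> {} \<longrightarrow> Z \<subseteq> W)" using contra by auto
    then obtain W where W: "W \<in> dset E" "W \<inter> Z \<noteq> {}" "\<not> Z \<subseteq> W" by auto
    then have "Z \<inter> W \<in> ?F" "Z - W \<in> ?F" using Z dset_Int dset_Diff by auto
    then show "\<exists>Y1\<in>?F. \<exists>Y2\<in>?F. Y1 \<subseteq> Z \<and> Y2 \<subseteq> Z \<and> Y1 \<inter> Y2 = {}"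
      by (intro bexI[of _ "Z \<inter> W"] bexI[of _ "Z - W"]) auto
  qed simp
  then show False using assms(3,4) by blast
qed

text \<open>The type of \<open>c\<close> over \<open>E\<close> does not split over \<open>r\<close>: tuples of the same type over \<open>r\<close> are
  given as \<open>x\<close> and \<open>g x\<close> for an elementary map \<open>g\<close> that fixes \<open>r\<close>.\<close>

definition nonsplit :: "'m set \<Rightarrow> 'm set \<Rightarrow> 'm \<Rightarrow> bool" where
  "nonsplit E r c \<longleftrightarrow> (\<forall>F g. finite F \<and> r \<subseteq> F \<and> F \<subseteq> E \<and> g ` F \<subseteq> E \<and> elem F g \<and>
     (\<forall>x\<in>r. g x = x) \<longrightarrow> elem (insert c F) (g(c := c)))"

definition homogeneous :: bool where
  "homogeneous \<longleftrightarrow> (\<forall>F g. finite F \<and> F \<subseteq> U \<and> elem F g \<longrightarrow>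
     (\<exists>h. automorphism h \<and> (\<forall>x\<in>F. h x = g x)))"

lemma homogeneousD:
  assumes homogeneous "finite F" "F \<subseteq> U" "elem F g"
  shows "\<exists>h. automorphism h \<and> (\<forall>x\<in>F. h x = g x)"
  using assms(1)[unfolded homogeneous_def, rule_format, of F g] assms(2-4) by simp

lemma nonsplitD:
  assumes "nonsplit E r c" "finite F" "r \<subseteq> F" "F \<subseteq> E" "g ` F \<subseteq> E" "elem F g" "\<And>x. x \<in> r \<Longrightarrow> g x = x"
  shows "elem (insert c F) (g(c := c))"
  using assms(1)[unfolded nonsplit_def, rule_format, of F g] assms(2-) by simp

lemma nonsplit_singleton:
  assumes "c \<in> E"
  shows "nonsplit E {c} c"
  unfolding nonsplit_def
proof (intro allI impI, elim conjE)
  fix F g assume "{c} \<subseteq> F" "elem F g" "\<forall>x\<in>{c}. g x = x"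
  moreover from this have "insert c F = F" "g(c := c) = g" by auto
  ultimately show "elem (insert c F) (g(c := c))" by simp
qed

text \<open>Splitting of \<open>Y\<close> over every finite set would let us cut a conjugate of a set \<open>W \<ni> c\<close> off \<open>Y\<close>
  without losing \<open>c\<close>, so that the conjugates of the sets containing \<open>c\<close> contain a binary tree.\<close>

lemma nonsplit_exists:
  assumes tt: "totally_transcendental L S" and hom: homogeneous
    and "E \<subseteq> U" "c \<in> U"
  shows "\<exists>r\<subseteq>E. finite r \<and> nonsplit E r c"
proof (cases "c \<in> E")
  case True
  then show ?thesis using nonsplit_singleton by (intro exI[of _ "{c}"]) simp
next
  case False
  show ?thesis
  proof (rule ccontr)
    assume contra: "\<not> ?thesis"
    \<comment> \<open>Conjugates are included since the second half of a node is only obtained after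
      applying an automorphism; each member still contains a conjugate of \<open>c\<close>.\<close>
    let ?F = "{h ` Z | h Z. automorphism h \<and> Z \<in> dset E \<and> c \<in> Z}"
    have "?F = {}"
    proof (rule no_binary_tree[OF tt])
      show "?F \<subseteq> dset U"
      proof
        fix Y assume "Y \<in> ?F"
        then obtain h Z where hZ: "Y = h ` Z" "automorphism h" "Z \<in> dset E" by auto
        then have "h ` Z \<in> dset (h ` E)" using automorphism_dset \<open>E \<subseteq> U\<close> by blast
        moreover have "h ` E \<subseteq> U"
          using hZ(2) \<open>E \<subseteq> U\<close> by (auto simp: automorphism_def bij_betw_def)
        ultimately show "Y \<in> dset U" using hZ(1) dset_mono by blast
      qed
      show "{} \<notin> ?F" by auto
      fix Y assume "Y \<in> ?F"
      then obtain h Z where hZ: "Y = h ` Z" "automorphism h" "Z \<in> dset E" "c \<in> Z" by auto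
      \<comment> \<open>The finite support of \<open>Z\<close> is tried as \<open>r\<close>: an
        automorphism that fixes it maps \<open>Z\<close> to itself.\<close>
      obtain r where r: "r \<subseteq> E" "finite r" "Z \<in> dset r" using dset_finite[OF hZ(3)] by blast
      then have "\<not> nonsplit E r c" using contra by blast
      then obtain F g where F: "finite F" "r \<subseteq> F" "F \<subseteq> E" "g ` F \<subseteq> E" "elem F g"
        "\<forall>x\<in>r. g x = x" and not: "\<not> elem (insert c F) (g(c := c))"
        unfolding nonsplit_def by auto
      have "(g(c := c)) ` insert c F \<subseteq> U" using F(4) assms(3,4) by auto
      with not have "\<not> (\<forall>\<Phi>. Fm (insert c F) \<Phi> \<longrightarrow> \<Phi> id \<longrightarrow> \<Phi> (g(c := c)))"
        by (simp add: elem_def)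
      then obtain \<Phi> where \<Phi>: "Fm (insert c F) \<Phi>" "\<Phi> id" "\<not> \<Phi> (g(c := c))"
        by (simp only: not_all not_imp) (elim exE conjE)
      obtain k where k: "automorphism k" "\<forall>x\<in>F. k x = g x"
        using homogeneousD[OF hom F(1) order_trans[OF F(3) assms(3)] F(5)] by blast
      define W where "W = {y \<in> U. \<Phi> (id(c := y))}"
      define W' where "W' = {y \<in> U. \<Phi> (g(c := y))}"
      have W: "W \<in> dset E"
        using dset_mono[OF dset_name[OF \<Phi>(1), of id]] F(3) by (simp add: W_def)
      have W': "W' \<in> dset E"
        using dset_mono[OF dset_name[OF \<Phi>(1), of g]] F(4) by (simp add: W'_def)
      have "id(c := c) = (id :: 'm \<Rightarrow> 'm)" by auto
      then have cW: "c \<in> W" "c \<notin> W'" using \<Phi>(2,3) assms(4) by (auto simp: W_def W'_def)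
      have kW: "k ` W \<subseteq> W'"
      proof
        fix y assume "y \<in> k ` W"
        then obtain u where u: "u \<in> U" "\<Phi> (id(c := u))" "y = k u" by (auto simp: W_def)
        have "(id(c := u)) ` insert c F \<subseteq> U" using u(1) F(3) assms(3) by auto
        from automorphism_sat[OF k(1) \<Phi>(1) this] u(2) have "\<Phi> (\<lambda>x. k ((id(c := u)) x))"
          by simp
        moreover have "\<Phi> (\<lambda>x. k ((id(c := u)) x)) = \<Phi> (g(c := k u))"
          by (rule Fm_cong[OF \<Phi>(1)]) (use k(2) False F(3) in auto)
        moreover have "k u \<in> U" using k(1) u(1) by (auto simp: automorphism_def bij_betw_def)
        ultimately show "y \<in> W'" using u(3) by (simp add: W'_def)
      qed
      have "k ` Z = Z"
        by (rule automorphism_fixes_dset[OF k(1) _ r(3)]) (use r(1) F k(2) assms(3) in auto)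
      \<comment> \<open>Both halves lie in \<open>Y\<close>, as \<open>k\<close> preserves
        \<open>Z\<close>. They are disjoint because, before \<open>h\<close> is applied, the first
        avoids \<open>W'\<close> and the second lies in \<open>W'\<close>; they contain
        \<open>h c\<close> and \<open>h (k c)\<close> respectively.\<close>
      define Z1 where "Z1 = h ` (Z - W')"
      define Z2 where "Z2 = (\<lambda>x. h (k x)) ` (Z \<inter> W)"
      have "Z1 \<in> ?F" unfolding Z1_def
        using hZ W' cW by (auto intro!: exI[of _ h] exI[of _ "Z - W'"] dset_Diff)
      moreover have "Z2 \<in> ?F" unfolding Z2_def
        using hZ W cW automorphism_comp[OF k(1) hZ(2)]
        by (intro CollectI exI[of _ "\<lambda>x. h (k x)"] exI[of _ "Z \<inter> W"]) (simp add: dset_Int)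
      moreover have "Z1 \<subseteq> Y" "Z2 \<subseteq> Y"
        using \<open>k ` Z = Z\<close> by (auto simp: Z1_def Z2_def hZ(1))
      moreover have "Z1 \<inter> Z2 = {}"
      proof -
        have "inj_on h U" using hZ(2) by (simp add: automorphism_def bij_betw_def)
        moreover have "Z - W' \<subseteq> U" "k ` (Z \<inter> W) \<subseteq> U"
          using dset_subset[OF hZ(3)] \<open>k ` Z = Z\<close> by auto
        ultimately have "h ` (Z - W') \<inter> h ` k ` (Z \<inter> W) = h ` ((Z - W') \<inter> k ` (Z \<inter> W))"
          by (simp add: inj_on_image_Int)
        moreover have "(Z - W') \<inter> k ` (Z \<inter> W) = {}" using kW by auto
        ultimately show ?thesis by (simp add: Z1_def Z2_def image_image)
      qed
      ultimately show "\<exists>Y1\<in>?F. \<exists>Y2\<in>?F. Y1 \<subseteq> Y \<and> Y2 \<subseteq> Y \<and> Y1 \<inter> Y2 = {}"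
        by (intro bexI[of _ Z1] bexI[of _ Z2]) simp_all
    qed
    moreover have "id ` U \<in> ?F"
      using automorphism_id dset_univ assms(4) by (intro CollectI exI[of _ id] exI[of _ U]) simp
    ultimately have "id ` U \<in> {}" by (simp only:)
    then show False by simp
  qed
qed

end

text \<open>With \<open>Q X x\<close> read as isolation of \<open>x\<close> over
  \<open>A \<union> X\<close>, this is a maximal construction inside \<open>M\<close>. Points are
  picked by transfinite recursion as long as a candidate exists, so when the process halts no point
  of \<open>M\<close> outside \<open>N\<close> satisfies \<open>Q N\<close>; the order of picking
  gives \<open>R\<close>.\<close>

lemma greedy_enumeration:
  fixes M :: "'a set" and Q :: "'a set \<Rightarrow> 'a \<Rightarrow> bool"
  shows "\<exists>N\<subseteq>M. \<exists>R. wf R \<and> trans R \<and> total_on N R \<and>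
           (\<forall>x\<in>N. Q {y \<in> N. (y, x) \<in> R} x) \<and> (\<forall>x\<in>M. Q N x \<longrightarrow> x \<in> N)"
proof -
  \<comment> \<open>The stages are indexed by sets of points. By Cantor's theorem there are more of
    them than points, so picking a new point at every stage is impossible.\<close>
  obtain W :: "'a set rel" where W: "well_order_on UNIV W"
    using well_order_on by blast
  define r where "r = W - Id"
  have wf: "wf r" using W by (simp add: well_order_on_def r_def)
  have lin: "trans W" "antisym W" "total W"
    using W by (simp_all add: well_order_on_def linear_order_on_def partial_order_on_def
        preorder_on_def)
  have tr: "trans r" using lin unfolding r_def by (simp add: trans_diff_Id)
  have tot: "total r" using lin(3) by (simp add: r_def)
  define cand where "cand X = {x \<in> M - X. Q X x}" for X
  define F where "F f k = (let X = {x. \<exists>j. (j, k) \<in> r \<and> f j = Some x} in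
      if cand X = {} then None else Some (SOME x. x \<in> cand X))"
    for f :: "'a set \<Rightarrow> 'a option" and k
  define c where "c = wfrec r F"
  define X where "X k = {x. \<exists>j. (j, k) \<in> r \<and> c j = Some x}" for k
  have c: "c k = (if cand (X k) = {} then None else Some (SOME x. x \<in> cand (X k)))" for k
  proof -
    have "c k = F (cut c r k) k" unfolding c_def by (rule wfrec[OF wf])
    moreover have "{x. \<exists>j. (j, k) \<in> r \<and> cut c r k j = Some x} = X k"
      by (auto simp: X_def cut_apply)
    ultimately show ?thesis by (simp add: F_def Let_def)
  qed
  have c_cand: "x \<in> cand (X k)" if "c k = Some x" for k x
    using that someI_ex[of "\<lambda>x. x \<in> cand (X k)"] by (auto simp: c split: if_splits)
  have c_inj: "j = k" if "c j = Some x" "c k = Some x" for j k x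
  proof (rule ccontr)
    assume "j \<noteq> k"
    then consider "(j, k) \<in> r" | "(k, j) \<in> r" using tot by (auto simp: total_on_def)
    then show False
    proof cases
      case 1
      then have "x \<in> X k" using that by (auto simp: X_def)
      then show False using c_cand[OF that(2)] by (simp add: cand_def)
    next
      case 2
      then have "x \<in> X j" using that by (auto simp: X_def)
      then show False using c_cand[OF that(1)] by (simp add: cand_def)
    qed
  qed
  have "\<exists>k. c k = None"
  proof (rule ccontr)
    assume "\<nexists>k. c k = None"
    then have "c k = Some (the (c k))" for k by simp
    then have "inj (\<lambda>k. the (c k))" by (metis c_inj injI)
    then have "surj (inv_into UNIV (\<lambda>k. the (c k)))" by (rule inj_imp_surj_inv)
    then show False using Cantors_theorem[of UNIV] by auto
  qed
  then obtain k0 where "c k0 = None" by blast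
  then have end_cand: "cand (X k0) = {}" by (auto simp: c split: if_splits)
  define N where "N = X k0"
  define idx where "idx x = (THE j. c j = Some x)" for x
  have idx: "idx x = j" if "c j = Some x" for x j
    unfolding idx_def using that c_inj by (intro the_equality) auto
  define R where "R = inv_image r idx"
  have N: "\<exists>j. (j, k0) \<in> r \<and> c j = Some x \<and> idx x = j" if "x \<in> N" for x
    using that idx by (auto simp: N_def X_def)
  have "total_on N R"
    unfolding total_on_def
  proof (intro ballI impI)
    fix x y assume xy: "x \<in> N" "y \<in> N" "x \<noteq> y"
    obtain j where "c j = Some x" "idx x = j" using N[OF xy(1)] by blast
    moreover obtain k where "c k = Some y" "idx y = k" using N[OF xy(2)] by blast
    ultimately have "idx x \<noteq> idx y" using xy(3) by auto
    then show "(x, y) \<in> R \<or> (y, x) \<in> R"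
      using tot by (auto simp: R_def total_on_def)
  qed
  moreover have "Q {y \<in> N. (y, x) \<in> R} x" if x: "x \<in> N" for x
  proof -
    obtain j where j: "(j, k0) \<in> r" "c j = Some x" "idx x = j" using N[OF x] by blast
    have "{y \<in> N. (y, x) \<in> R} = X j"
    proof
      show "{y \<in> N. (y, x) \<in> R} \<subseteq> X j"
        using N j by (fastforce simp: R_def X_def)
      show "X j \<subseteq> {y \<in> N. (y, x) \<in> R}"
        using j idx transD[OF tr _ j(1)] by (auto simp: R_def X_def N_def)
    qed
    then show ?thesis using c_cand[OF j(2)] by (simp add: cand_def)
  qed
  moreover have "N \<subseteq> M" using c_cand by (auto simp: N_def X_def cand_def)
  moreover have "\<forall>x\<in>M. Q N x \<longrightarrow> x \<in> N" using end_cand by (auto simp: N_def cand_def)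
  moreover have "wf R" "trans R"
    unfolding R_def using wf tr by (simp_all add: wf_inv_image trans_inv_image)
  ultimately show ?thesis by blast
qed

section \<open>Constructible sets\<close>

context fo_structure
begin

lemma isolatedE:
  assumes "isolated E x"
  obtains Y where "Y \<in> dset E" "x \<in> Y" "\<And>Z. Z \<in> dset E \<Longrightarrow> x \<in> Z \<Longrightarrow> Y \<subseteq> Z"
  using assms unfolding isolated_def by auto

text \<open>The point \<open>x\<close> itself is used as the name of the free variable. For two
  points \<open>a\<close> and \<open>b\<close> this allows formulas in both, with either one
  quantified or kept as a parameter.\<close>

lemma isolated_imp_named:
  assumes "isolated E x" "x \<notin> E"
  shows "\<exists>\<Theta>. Fm (insert x E) \<Theta> \<and> \<Theta> id \<and>
    (\<forall>X y. Fm (insert x E) X \<longrightarrow> X id \<longrightarrow> y \<in> U \<longrightarrow> \<Theta> (id(x := y)) \<longrightarrow> X (id(x := y)))"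
proof -
  obtain Y where Y: "Y \<in> dset E" "x \<in> Y" "\<And>Z. Z \<in> dset E \<Longrightarrow> x \<in> Z \<Longrightarrow> Y \<subseteq> Z"
    using assms(1) by (rule isolatedE) (rule that)
  obtain \<Psi> where \<Psi>: "Fm (insert None (Some ` E)) \<Psi>" "Y = {y \<in> U. \<Psi> (case_option y id)}"
    using Y(1) by (rule dsetE)
  let ?T = "\<lambda>g. \<Psi> (case_option (g x) g)"
  have eq: "?T (id(x := y)) = \<Psi> (case_option y id)" for y
    by (rule Fm_cong[OF \<Psi>(1)]) (use assms(2) in auto)
  have "?T id" using Y(2) \<Psi>(2) by simp
  moreover have "X (id(x := y))"
    if X: "Fm (insert x E) X" "X id" and y: "y \<in> U" "?T (id(x := y))" for X y
  proof -
    have "id(x := x) = (id :: 'm \<Rightarrow> 'm)" by auto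
    then have "x \<in> {u \<in> U. X (id(x := u))}" using X(2) Y(2) \<Psi>(2) by simp
    moreover have "{u \<in> U. X (id(x := u))} \<in> dset E" using dset_name[OF X(1), of id] by simp
    ultimately have "Y \<subseteq> {u \<in> U. X (id(x := u))}" using Y(3) by simp
    moreover have "y \<in> Y" using y eq[of y] \<Psi>(2) by simp
    ultimately show ?thesis by auto
  qed
  ultimately show ?thesis using Fm_from_option[OF \<Psi>(1), of x]
    by (intro exI[of _ ?T] conjI allI impI)
qed

lemma isolated_if_named:
  assumes "Fm (insert x E) \<Theta>" "\<Theta> id" "x \<notin> E" "x \<in> U"
    and atom: "\<And>X y. Fm (insert x E) X \<Longrightarrow> X id \<Longrightarrow> y \<in> U \<Longrightarrow> \<Theta> (id(x := y)) \<Longrightarrow> X (id(x := y))"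
  shows "isolated E x"
  unfolding isolated_def
proof (intro bexI conjI ballI impI)
  show "{y \<in> U. \<Theta> (id(x := y))} \<in> dset E" using dset_name[OF assms(1), of id] by simp
  have "id(x := x) = (id :: 'm \<Rightarrow> 'm)" by auto
  then show "x \<in> {y \<in> U. \<Theta> (id(x := y))}" using assms by simp
  fix Z assume Z: "Z \<in> dset E" "x \<in> Z"
  obtain \<Psi> where \<Psi>: "Fm (insert None (Some ` E)) \<Psi>" "Z = {y \<in> U. \<Psi> (case_option y id)}"
    using Z(1) by (rule dsetE)
  have eq: "\<Psi> (case_option ((id(x := y)) x) (id(x := y))) = \<Psi> (case_option y id)" for y
    by (rule Fm_cong[OF \<Psi>(1)]) (use assms(3) in auto)
  show "{y \<in> U. \<Theta> (id(x := y))} \<subseteq> Z"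
  proof
    fix y assume "y \<in> {y \<in> U. \<Theta> (id(x := y))}"
    then have y: "y \<in> U" "\<Theta> (id(x := y))" by simp_all
    have "\<Psi> (case_option (id x) id)" using Z(2) \<Psi>(2) by simp
    from atom[OF Fm_from_option[OF \<Psi>(1)] this y] show "y \<in> Z"
      using eq[of y] y(1) \<Psi>(2) by simp
  qed
qed

text \<open>If \<Theta> isolates \<open>a\<close> over \<open>E\<close> and \<Psi> isolates
  \<open>b\<close> over \<open>E\<close> and \<open>a\<close>, then their conjunction isolates the
  pair. Quantifying \<open>a\<close> away isolates \<open>b\<close> over \<open>E\<close>; keeping
  \<open>b\<close> as a parameter isolates \<open>a\<close>.\<close>

lemma isolated_exchange:
  assumes ab: "a \<in> U" "b \<in> U" and E: "E \<subseteq> U" and "isolated E a" "isolated (insert a E) b"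
  shows "isolated E b \<and> isolated (insert b E) a"
proof -
  consider "a \<in> E" | "b \<in> insert a E" | "a \<notin> E" "b \<notin> insert a E" by blast
  then show ?thesis
  proof cases
    case 1
    then show ?thesis using assms isolated_mem[of a "insert b E"] by (simp add: insert_absorb)
  next
    case 2
    then show ?thesis using assms isolated_mem[of b E] isolated_mem[of a "insert b E"]
      by (auto simp: insert_absorb)
  next
    case 3
    from isolated_imp_named[OF assms(4) 3(1)] obtain \<Theta> where \<Theta>: "Fm (insert a E) \<Theta>" "\<Theta> id"
      and \<Theta>_atom: "\<forall>X y. Fm (insert a E) X \<longrightarrow> X id \<longrightarrow> y \<in> U \<longrightarrow> \<Theta> (id(a := y)) \<longrightarrow> X (id(a := y))"
      by (elim exE conjE) (rule that)
    from isolated_imp_named[OF assms(5) 3(2)] obtain \<Psi> where \<Psi>: "Fm (insert b (insert a E)) \<Psi>" "\<Psi> id"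
      and \<Psi>_atom: "\<forall>X y. Fm (insert b (insert a E)) X \<longrightarrow> X id \<longrightarrow> y \<in> U \<longrightarrow> \<Psi> (id(b := y)) \<longrightarrow> X (id(b := y))"
      by (elim exE conjE) (rule that)
    have pair: "X (id(a := y, b := z))"
      if X: "Fm (insert b (insert a E)) X" "X id" and yz: "y \<in> U" "z \<in> U"
        and *: "\<Theta> (id(a := y))" "\<Psi> (id(a := y, b := z))" for X y z
    proof -
      let ?W = "\<lambda>g. \<forall>z\<in>U. \<Psi> (g(b := z)) \<longrightarrow> X (g(b := z))"
      have "Fm (insert a E) ?W" by (rule Fm_all[OF Fm_imp[OF \<Psi>(1) X(1)]])
      moreover have "?W id"
      proof (intro ballI impI)
        fix z assume "z \<in> U" "\<Psi> (id(b := z))"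
        from \<Psi>_atom[rule_format, OF X this] show "X (id(b := z))" .
      qed
      ultimately have "?W (id(a := y))" using yz(1) *(1) by (rule \<Theta>_atom[rule_format])
      then show ?thesis using yz(2) *(2) by simp
    qed
    have id_upd: "id(x := x) = (id :: 'm \<Rightarrow> 'm)" for x by auto
    have swap: "insert a (insert b E) = insert b (insert a E)" by auto
    have \<Theta>2: "Fm (insert b (insert a E)) \<Theta>" by (rule Fm_mono[OF \<Theta>(1)]) auto
    have "isolated E b"
    proof (rule isolated_if_named)
      have "Fm (insert a (insert b E)) (\<lambda>g. \<Theta> g \<and> \<Psi> g)"
        unfolding swap by (rule Fm_conj[OF \<Theta>2 \<Psi>(1)])
      then show "Fm (insert b E) (\<lambda>g. \<exists>y\<in>U. \<Theta> (g(a := y)) \<and> \<Psi> (g(a := y)))" by (rule Fm_ex)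
      show "\<exists>y\<in>U. \<Theta> (id(a := y)) \<and> \<Psi> (id(a := y))"
        by (rule bexI[of _ a]) (use \<Theta>(2) \<Psi>(2) ab in \<open>simp_all add: id_upd\<close>)
      show "b \<notin> E" "b \<in> U" using 3 ab by simp_all
      fix X z assume X: "Fm (insert b E) X" "X id" and z: "z \<in> U"
        "\<exists>y\<in>U. \<Theta> ((id(b := z))(a := y)) \<and> \<Psi> ((id(b := z))(a := y))"
      then obtain y where y: "y \<in> U" "\<Theta> (id(b := z, a := y))" "\<Psi> (id(b := z, a := y))" by auto
      have "a \<noteq> b" using 3 by auto
      then have tw: "id(b := z, a := y) = id(a := y, b := z)" by auto
      have "\<Theta> (id(b := z, a := y)) = \<Theta> (id(a := y))"
        by (rule Fm_cong[OF \<Theta>(1)]) (use 3 in auto)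
      with y(2) have "\<Theta> (id(a := y))" by simp
      moreover have "Fm (insert b (insert a E)) X" by (rule Fm_mono[OF X(1)]) auto
      ultimately have "X (id(a := y, b := z))" using pair[of X y z] X(2) y(1,3) z(1) tw by simp
      moreover have "X (id(a := y, b := z)) = X (id(b := z))"
        by (rule Fm_cong[OF X(1)]) (use 3 in auto)
      ultimately show "X (id(b := z))" by simp
    qed
    moreover have "isolated (insert b E) a"
    proof (rule isolated_if_named)
      show "Fm (insert a (insert b E)) (\<lambda>g. \<Theta> g \<and> \<Psi> g)"
        unfolding swap by (rule Fm_conj[OF \<Theta>2 \<Psi>(1)])
      show "\<Theta> id \<and> \<Psi> id" using \<Theta>(2) \<Psi>(2) by simp
      show "a \<notin> insert b E" "a \<in> U" using 3 ab by auto
      fix X y assume X: "Fm (insert a (insert b E)) X" "X id" and y: "y \<in> U"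
        "\<Theta> (id(a := y)) \<and> \<Psi> (id(a := y))"
      have "a \<noteq> b" using 3 by auto
      then have "id(a := y, b := b) = id(a := y)" by auto
      then show "X (id(a := y))"
        using pair[of X y b] X y ab(2) unfolding swap by simp
    qed
    ultimately show ?thesis by blast
  qed
qed

text \<open>All finite tuples from \<open>P\<close> have isolated types over \<open>E\<close>, stated one element at a time.\<close>

definition fully_isolated :: "'m set \<Rightarrow> 'm set \<Rightarrow> bool" where
  "fully_isolated E P \<longleftrightarrow> (\<forall>Q\<subseteq>P. \<forall>x\<in>P. isolated (E \<union> Q) x)"

text \<open>By exchange the points of \<open>P\<close> can be removed from the parameters of
  \<open>b\<close> one at a time, so \<open>b\<close> is isolated over \<open>E\<close> and any part
  of \<open>P\<close>; a further exchange puts \<open>b\<close> among the parameters of the other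
  points.\<close>

lemma fully_isolated_insert:
  assumes P: "fully_isolated E P" "finite P" and U: "E \<subseteq> U" "P \<subseteq> U" "b \<in> U" and b: "isolated (E \<union> P) b"
  shows "fully_isolated E (insert b P)"
proof -
  have down: "isolated (E \<union> (P - D)) b" if "finite D" "D \<subseteq> P" for D
    using that
  proof (induction D rule: finite_induct)
    case empty
    then show ?case using b by simp
  next
    case (insert a D)
    have eq: "E \<union> (P - D) = insert a (E \<union> (P - insert a D))" using insert by auto
    have "isolated (E \<union> (P - insert a D)) a"
      using P(1) insert.prems unfolding fully_isolated_def by auto
    moreover have "isolated (insert a (E \<union> (P - insert a D))) b"
      using insert eq by simp
    ultimately show ?case
      using isolated_exchange[of a b "E \<union> (P - insert a D)"] insert.prems U by auto
  qed
  have b_over: "isolated (E \<union> Q) b" if "Q \<subseteq> P" for Q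
  proof -
    have "P - (P - Q) = Q" using that by auto
    then show ?thesis using down[of "P - Q"] P(2) by simp
  qed
  have "isolated (E \<union> Q) x" if Q: "Q \<subseteq> insert b P" and x: "x \<in> insert b P" for Q x
  proof (cases "b \<in> Q")
    case False
    then show ?thesis using Q x P(1) b_over[of Q] unfolding fully_isolated_def by auto
  next
    case True
    define Q' where "Q' = Q - {b}"
    have Q': "Q' \<subseteq> P" "E \<union> Q = insert b (E \<union> Q')" using Q True by (auto simp: Q'_def)
    show ?thesis
    proof (cases "x = b")
      case True
      then show ?thesis using isolated_mem[of b "E \<union> Q"] \<open>b \<in> Q\<close> U(3) by simp
    next
      case False
      then have xP: "x \<in> P" using x by simp
      then have "isolated (E \<union> Q') x" using P(1) Q'(1) unfolding fully_isolated_def by auto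
      moreover have "isolated (insert x (E \<union> Q')) b"
        using b_over[of "insert x Q'"] xP Q'(1) by simp
      ultimately show ?thesis
        using isolated_exchange[of x b "E \<union> Q'"] xP Q' U by auto
    qed
  qed
  then show ?thesis unfolding fully_isolated_def by blast
qed

end

section \<open>Closure systems, constructions and their supports\<close>

lemma finite_total_max:
  assumes "finite F" "F \<noteq> {}" "F \<subseteq> N" "total_on N R" "trans R"
  shows "\<exists>v\<in>F. \<forall>u\<in>F. u = v \<or> (u, v) \<in> R"
  using assms(1,2,3)
proof (induction F rule: finite_ne_induct)
  case (insert x F)
  then obtain v where v: "v \<in> F" "\<forall>u\<in>F. u = v \<or> (u, v) \<in> R" by auto
  have "x = v \<or> (x, v) \<in> R \<or> (v, x) \<in> R"
    using assms(4) insert.prems v(1) unfolding total_on_def by auto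
  then show ?case
  proof (elim disjE)
    assume "(v, x) \<in> R"
    then have "\<forall>u\<in>F. (u, x) \<in> R" using v(2) transD[OF assms(5), of _ v x] by auto
    then show ?thesis by (intro bexI[of _ x]) auto
  qed (use v in \<open>auto intro!: bexI[of _ v]\<close>)
qed auto

text \<open>What the back-and-forth has to know of \<open>M\<close>: closures of points are
  countable, and over a closed set with finitely many extra points all types realised in
  \<open>M\<close> are isolated. In this form the property can be proved for an isomorphic copy of
  \<open>M\<close> and pulled back.\<close>

locale closure_system = fo_structure L S
  for L :: "('f, 'r) language" and S :: "('f, 'r, 'm) struct" +
  fixes M A :: "'m set" and cl :: "'m \<Rightarrow> 'm set"
  assumes tv_M: "tv_closed M" and A_M: "A \<subseteq> M"
    and cl_countable: "\<And>x. x \<in> M \<Longrightarrow> countable (cl x)"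
    and cl_self: "\<And>x. x \<in> M \<Longrightarrow> x \<in> cl x"
    and cl_M: "\<And>x. x \<in> M \<Longrightarrow> cl x \<subseteq> M"
    and cl_trans: "\<And>x y. x \<in> M \<Longrightarrow> y \<in> cl x \<Longrightarrow> cl y \<subseteq> cl x"
    and cl_A: "\<And>x. x \<in> A \<Longrightarrow> cl x \<subseteq> A"
    and cl_iso: "\<And>D F x. A \<subseteq> D \<Longrightarrow> D \<subseteq> M \<Longrightarrow> (\<And>y. y \<in> D \<Longrightarrow> cl y \<subseteq> D) \<Longrightarrow> finite F \<Longrightarrow> F \<subseteq> M
           \<Longrightarrow> x \<in> M \<Longrightarrow> isolated (D \<union> F) x"

text \<open>A construction \<open>N\<close> of a model over \<open>A\<close>, with the supports \<open>s x\<close> of the isolating formulas,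
  together with an elementary submodel \<open>M'\<close> and sets \<open>r x\<close> over which the types of the elements
  of the construction do not split.\<close>

locale construction = fo_structure L S
  for L :: "('f, 'r) language" and S :: "('f, 'r, 'm) struct" +
  fixes A N M' :: "'m set" and R :: "'m rel" and s r :: "'m \<Rightarrow> 'm set"
  assumes A_M': "A \<subseteq> M'" and M'_N: "M' \<subseteq> N" and N_U: "N \<subseteq> U"
    and wf_R: "wf R" and trans_R: "trans R" and total_R: "total_on N R"
    and tv_M': "tv_closed M'"
    and s_A: "\<And>x. x \<in> A \<Longrightarrow> s x = {x}"
    and s_finite: "\<And>x. x \<in> N \<Longrightarrow> finite (s x)"
    and s_sub: "\<And>x. x \<in> N \<Longrightarrow> s x \<subseteq> A \<union> {y \<in> N. (y, x) \<in> R}"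
    and s_atom: "\<And>x. x \<in> N \<Longrightarrow> \<exists>Y\<in>dset (s x). x \<in> Y \<and>
                   (\<forall>Z\<in>dset (A \<union> {y \<in> N. (y, x) \<in> R}). x \<in> Z \<longrightarrow> Y \<subseteq> Z)"
    and r_A: "\<And>x. x \<in> A \<Longrightarrow> r x = {x}"
    and r_finite: "\<And>x. x \<in> N \<Longrightarrow> finite (r x)"
    and r_sub: "\<And>x. x \<in> N \<Longrightarrow> r x \<subseteq> M' \<union> {y \<in> N. (y, x) \<in> R}"
    and r_nonsplit: "\<And>x. x \<in> N \<Longrightarrow> nonsplit (M' \<union> {y \<in> N. (y, x) \<in> R}) (r x) x"
begin

definition pred :: "'m \<Rightarrow> 'm set" where
  "pred x = {y \<in> N. (y, x) \<in> R}"

definition supp_closed :: "'m set \<Rightarrow> bool" where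
  "supp_closed K \<longleftrightarrow> A \<subseteq> K \<and> K \<subseteq> N \<and> (\<forall>x\<in>K. s x \<subseteq> K)"

lemma A_N: "A \<subseteq> N"
  using A_M' M'_N by blast

lemma supp_closed_A: "supp_closed A"
  using A_N s_A by (simp add: supp_closed_def)

text \<open>Elementarity is a matter of finite parts, and a finite part of
  \<open>A \<union> K\<close> lies in \<open>A\<close> or in \<open>A\<close> together with one
  point \<open>v\<close> of \<open>K\<close> and predecessors of \<open>v\<close> in
  \<open>K\<close>. This deals with limit stages.\<close>

lemma elem_union:
  assumes "K \<subseteq> N" "elem A g" "\<And>v. v \<in> K \<Longrightarrow> elem (insert v (A \<union> (K \<inter> pred v))) g"
  shows "elem (A \<union> K) g"
proof (rule elem_finite)
  fix F assume F: "finite F" "F \<subseteq> A \<union> K"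
  show "elem F g"
  proof (cases "F \<inter> K = {}")
    case True
    then have "F \<subseteq> A" using F(2) by blast
    then show ?thesis by (rule elem_mono[OF assms(2)])
  next
    case False
    then obtain v where v: "v \<in> F \<inter> K" "\<forall>u\<in>F \<inter> K. u = v \<or> (u, v) \<in> R"
      using finite_total_max[of "F \<inter> K" N R] F(1) assms(1) total_R trans_R by blast
    have "F \<subseteq> insert v (A \<union> (K \<inter> pred v))"
      using F(2) v(2) assms(1) by (auto simp: pred_def)
    moreover have "elem (insert v (A \<union> (K \<inter> pred v))) g" using v(1) by (intro assms(3)) simp
    ultimately show ?thesis using elem_mono by simp
  qed
qed

lemma elem_transfinite:
  assumes "K \<subseteq> N" "elem A g"
    and step: "\<And>w. w \<in> K \<Longrightarrow> w \<notin> A \<Longrightarrow> elem (A \<union> (K \<inter> pred w)) g \<Longrightarrow>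
                 elem (insert w (A \<union> (K \<inter> pred w))) g"
  shows "elem (A \<union> K) g"
proof -
  have "w \<in> K \<longrightarrow> elem (insert w (A \<union> (K \<inter> pred w))) g" for w
    using wf_R
  proof (induction w rule: wf_induct_rule)
    case (less w)
    show ?case
    proof
      assume w: "w \<in> K"
      have *: "elem (A \<union> (K \<inter> pred w)) g"
      proof (rule elem_union)
        fix v assume v: "v \<in> K \<inter> pred w"
        then have "elem (insert v (A \<union> (K \<inter> pred v))) g" using less.IH[of v] by (simp add: pred_def)
        then show "elem (insert v (A \<union> (K \<inter> pred w \<inter> pred v))) g" by (rule elem_mono) auto
      qed (use assms in auto)
      show "elem (insert w (A \<union> (K \<inter> pred w))) g"
      proof (cases "w \<in> A")
        case True
        then have "insert w (A \<union> (K \<inter> pred w)) = A \<union> (K \<inter> pred w)" by auto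
        with * show ?thesis by simp
      qed (use step w * in blast)
    qed
  qed
  then show ?thesis using elem_union[OF assms(1,2)] by blast
qed

lemma not_pred_self: "x \<notin> pred x"
  using wf_R by (simp add: pred_def)

text \<open>Let \<open>Y\<close> isolate \<open>x\<close> with parameters \<open>s x\<close>, and
  let \<open>y \<in> Y\<close>. The map that fixes \<open>K\<close> and sends \<open>x\<close> to
  \<open>y\<close> is rebuilt along the construction: each \<open>w\<close> of \<open>K\<close> is
  isolated over its predecessors by a formula over \<open>s w\<close>, hence over fixed points, so
  \<open>w\<close> may stay fixed even when it comes after \<open>x\<close>. Thus all points of
  \<open>Y\<close> have the same type over \<open>K\<close>.\<close>

lemma supp_closed_iso:
  assumes K: "supp_closed K" and x: "x \<in> N" "s x \<subseteq> K"
  shows "isolated K x"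
proof (cases "x \<in> K")
  case True
  then show ?thesis using isolated_mem x(1) N_U by blast
next
  case False
  have AK: "A \<subseteq> K" "K \<subseteq> N" and K_s: "\<And>w. w \<in> K \<Longrightarrow> s w \<subseteq> K"
    using K by (auto simp: supp_closed_def)
  obtain Y where Y: "Y \<in> dset (s x)" "x \<in> Y" "\<And>Z. Z \<in> dset (A \<union> pred x) \<Longrightarrow> x \<in> Z \<Longrightarrow> Y \<subseteq> Z"
    using s_atom[OF x(1)] unfolding pred_def by auto
  have main: "elem (insert x K) (id(x := y))" if y: "y \<in> Y" for y
  proof -
    let ?g = "id(x := y)" and ?K = "insert x K"
    have "elem (A \<union> ?K) ?g"
    proof (rule elem_transfinite)
      show "?K \<subseteq> N" using AK x(1) by auto
      have "elem A id" using elem_id A_N N_U by blast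
      then show "elem A ?g" by (rule elem_cong) (use False AK in auto)
      fix w assume w: "w \<in> ?K" "w \<notin> A" and g: "elem (A \<union> (?K \<inter> pred w)) ?g"
      let ?E = "A \<union> (?K \<inter> pred w)"
      have wN: "w \<in> N" using w(1) AK x(1) by auto
      obtain V where V: "V \<in> dset (s w)" "w \<in> V" "\<And>Z. Z \<in> dset (A \<union> pred w) \<Longrightarrow> w \<in> Z \<Longrightarrow> V \<subseteq> Z"
        and wV: "?g w \<in> V"
      proof (cases "w = x")
        case True
        then show ?thesis using that[of Y] Y y by simp
      next
        case False
        obtain V where "V \<in> dset (s w)" "w \<in> V" "\<And>Z. Z \<in> dset (A \<union> pred w) \<Longrightarrow> w \<in> Z \<Longrightarrow> V \<subseteq> Z"
          using s_atom[OF wN] unfolding pred_def by auto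
        then show ?thesis using that[of V] False by simp
      qed
      have sw: "s w \<subseteq> K" using w(1) K_s x(2) by auto
      then have sE: "s w \<subseteq> ?E" using s_sub[OF wN] by (auto simp: pred_def)
      obtain \<Psi> where \<Psi>: "Fm (insert None (Some ` s w)) \<Psi>" "V = {y \<in> U. \<Psi> (case_option y id)}"
        using V(1) by (rule dsetE)
      have eq: "\<Psi> (case_option u ?g) = \<Psi> (case_option u id)" for u
        by (rule Fm_cong[OF \<Psi>(1)]) (use sw False in auto)
      have "elem (insert w ?E) (?g(w := ?g w))"
      proof (rule elem_extend[OF g])
        show "Fm (insert None (Some ` ?E)) \<Psi>" by (rule Fm_mono[OF \<Psi>(1)]) (use sE in auto)
        show "w \<in> U" "\<Psi> (case_option w id)" using V(2) \<Psi>(2) by auto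
        show "w \<notin> ?E" using w(2) not_pred_self by auto
        show "?g w \<in> U" using wV \<Psi>(2) by simp
        show "\<Psi> (case_option (?g w) ?g)" using wV eq[of "?g w"] \<Psi>(2) by simp
        fix Z assume "Z \<in> dset ?E" "w \<in> Z"
        moreover have "?E \<subseteq> A \<union> pred w" by auto
        ultimately show "{y \<in> U. \<Psi> (case_option y id)} \<subseteq> Z" using V(3)[of Z] dset_mono \<Psi>(2) by blast
      qed
      then show "elem (insert w ?E) ?g" by (simp only: fun_upd_triv)
    qed
    then show ?thesis by (rule elem_mono) auto
  qed
  show ?thesis unfolding isolated_def
  proof (intro bexI conjI ballI impI)
    show "Y \<in> dset K" by (rule dset_mono[OF Y(1) x(2)])
    show "x \<in> Y" by fact
    fix Z assume Z: "Z \<in> dset K" "x \<in> Z"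
    show "Y \<subseteq> Z"
    proof
      fix y assume "y \<in> Y"
      then have "(id(x := y)) x \<in> Z"
        by (rule dset_elem_mem[OF main Z]) (use False in auto)
      then show "y \<in> Z" by simp
    qed
  qed
qed

text \<open>Before \<open>x\<close>, the finitely many points of its support are adjoined with their
  own supports, by recursion along the construction; well-foundedness keeps the result
  finite.\<close>

lemma fully_isolated_extend:
  assumes K: "K \<subseteq> N"
  shows "x \<in> N \<Longrightarrow> supp_closed (K \<union> P) \<Longrightarrow> finite P \<Longrightarrow> fully_isolated K P \<Longrightarrow>
    \<exists>P'. insert x P \<subseteq> P' \<and> finite P' \<and> supp_closed (K \<union> P') \<and> fully_isolated K P'"
  using wf_R
proof (induction x arbitrary: P rule: wf_induct_rule)
  case (less x)
  have "\<exists>P'. D \<union> P \<subseteq> P' \<and> finite P' \<and> supp_closed (K \<union> P') \<and> fully_isolated K P'"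
    if "finite D" "D \<subseteq> pred x" for D
    using that
  proof (induction D rule: finite_induct)
    case empty
    then show ?case using less.prems by (intro exI[of _ P]) simp
  next
    case (insert d D)
    then obtain P' where P': "D \<union> P \<subseteq> P'" "finite P'" "supp_closed (K \<union> P')" "fully_isolated K P'"
      by auto
    have "(d, x) \<in> R" "d \<in> N" using insert.prems by (auto simp: pred_def)
    from less.IH[OF this P'(3,2,4)] obtain P'' where "insert d P' \<subseteq> P''" "finite P''"
      "supp_closed (K \<union> P'')" "fully_isolated K P''" by auto
    then show ?case using P'(1) by (intro exI[of _ P'']) auto
  qed
  from this[of "s x \<inter> pred x"] obtain P' where P': "(s x \<inter> pred x) \<union> P \<subseteq> P'" "finite P'"
    "supp_closed (K \<union> P')" "fully_isolated K P'"
    using s_finite[OF less.prems(1)] by auto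
  have sx: "s x \<subseteq> K \<union> P'"
    using s_sub[OF less.prems(1)] P'(1,3) by (auto simp: supp_closed_def pred_def)
  have "K \<union> P' \<subseteq> U" using P'(3) N_U by (auto simp: supp_closed_def)
  then have "fully_isolated K (insert x P')"
    using supp_closed_iso[OF P'(3) less.prems(1) sx] P'(2,4) less.prems(1) N_U
    by (intro fully_isolated_insert) auto
  moreover have "supp_closed (K \<union> insert x P')"
    using P'(3) sx less.prems(1) by (auto simp: supp_closed_def)
  ultimately show ?case using P'(1,2) by (intro exI[of _ "insert x P'"]) auto
qed

text \<open>\<open>F\<close> and \<open>x\<close> are enclosed in a finite set \<open>P\<close> all
  of whose tuples are isolated over \<open>K\<close>; full isolation then allows the parameters to
  be cut down to \<open>F\<close>.\<close>

lemma supp_closed_iso_finite: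
  assumes K: "supp_closed K" and F: "finite F" "F \<subseteq> N" and x: "x \<in> N"
  shows "isolated (K \<union> F) x"
proof -
  have KN: "K \<subseteq> N" using K by (simp add: supp_closed_def)
  have "\<exists>P. D \<subseteq> P \<and> finite P \<and> supp_closed (K \<union> P) \<and> fully_isolated K P"
    if "finite D" "D \<subseteq> N" for D
    using that
  proof (induction D rule: finite_induct)
    case empty
    then show ?case using K by (intro exI[of _ "{}"]) (simp add: fully_isolated_def)
  next
    case (insert d D)
    then obtain P where P: "D \<subseteq> P" "finite P" "supp_closed (K \<union> P)" "fully_isolated K P" by auto
    from fully_isolated_extend[OF KN _ P(3,2,4), of d] obtain P' where "insert d P \<subseteq> P'" "finite P'"
      "supp_closed (K \<union> P')" "fully_isolated K P'" using insert.prems by auto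
    then show ?case using P(1) by (intro exI[of _ P']) auto
  qed
  from this[of "insert x F"] obtain P where "insert x F \<subseteq> P" "fully_isolated K P"
    using F x by auto
  then show ?thesis unfolding fully_isolated_def by auto
qed

definition closed_set :: "'m set \<Rightarrow> bool" where
  "closed_set K \<longleftrightarrow> A \<subseteq> K \<and> K \<subseteq> N \<and> (\<forall>x\<in>K. s x \<union> r x \<subseteq> K)"

lemma closed_imp_supp_closed: "closed_set K \<Longrightarrow> supp_closed K"
  by (auto simp: closed_set_def supp_closed_def)

text \<open>The analogue of \<open>nonsplit\<close> over \<open>M'\<close> for the tuples enumerating \<open>c\<close>. It is obtained
  from the single types by transitivity along the construction.\<close>

definition nonsplit_set :: "'m set \<Rightarrow> 'm set \<Rightarrow> bool" where
  "nonsplit_set c r' \<longleftrightarrow> (\<forall>F g. finite F \<and> r' \<subseteq> F \<and> F \<subseteq> M' \<and> g ` F \<subseteq> M' \<and> elem F g \<and>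
      (\<forall>x\<in>r'. g x = x) \<longrightarrow> elem (F \<union> c) (\<lambda>z. if z \<in> c then z else g z))"

lemma nonsplit_setD:
  assumes "nonsplit_set c r'" "finite F" "r' \<subseteq> F" "F \<subseteq> M'" "g ` F \<subseteq> M'" "elem F g" "\<forall>x\<in>r'. g x = x"
  shows "elem (F \<union> c) (\<lambda>z. if z \<in> c then z else g z)"
  using assms(1)[unfolded nonsplit_set_def, rule_format, of F g] assms(2-) by simp

lemma nonsplit_closed:
  assumes K: "closed_set K" and c: "finite c" "c \<subseteq> K"
  shows "\<exists>r'\<subseteq>K \<inter> M'. finite r' \<and> c \<inter> M' \<subseteq> r' \<and> nonsplit_set c r'"
proof -
  let ?ex = "\<lambda>c. \<exists>r'\<subseteq>K \<inter> M'. finite r' \<and> c \<inter> M' \<subseteq> r' \<and> nonsplit_set c r'"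
  have KN: "K \<subseteq> N" using K by (simp add: closed_set_def)
  have "nonsplit_set {} {}" unfolding nonsplit_set_def by simp
  then have empty: "?ex {}" by (intro exI[of _ "{}"]) simp
  have max: "\<exists>w\<in>c. c \<subseteq> insert w (pred w)" if "finite c" "c \<subseteq> K" "c \<noteq> {}" for c
  proof -
    have "c \<subseteq> N" using that(2) KN by simp
    from finite_total_max[OF that(1,3) this total_R trans_R] obtain w
      where "w \<in> c" "\<forall>u\<in>c. u = w \<or> (u, w) \<in> R" by blast
    with \<open>c \<subseteq> N\<close> show ?thesis by (intro bexI[of _ w]) (auto simp: pred_def)
  qed
  have main: "\<forall>c. finite c \<longrightarrow> c \<subseteq> K \<longrightarrow> w \<in> c \<longrightarrow> c \<subseteq> insert w (pred w) \<longrightarrow> ?ex c" for w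
    using wf_R
  proof (induction w rule: wf_induct_rule)
    case (less w)
    show ?case
    proof (intro allI impI)
      fix c assume c: "finite c" "c \<subseteq> K" "w \<in> c" "c \<subseteq> insert w (pred w)"
      have w: "w \<in> K" "w \<in> N" using c KN by auto
      \<comment> \<open>\<open>w\<close> is the last point of \<open>c\<close>. It is traded for
        those points of \<open>r w\<close> that precede it, so that \<open>c1\<close> lies before
        \<open>w\<close> and induction applies; the rest of \<open>r w\<close> lies in
        \<open>M'\<close>.\<close>
      define c1 where "c1 = (c - {w}) \<union> (r w \<inter> pred w)"
      have rw: "r w \<subseteq> K" using K w by (auto simp: closed_set_def)
      have c1: "finite c1" "c1 \<subseteq> K" "c1 \<subseteq> pred w"
        using c rw r_finite[OF w(2)] by (auto simp: c1_def)
      have "?ex c1"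
      proof (cases "c1 = {}")
        case True
        then show ?thesis using empty by simp
      next
        case False
        then obtain w1 where w1: "w1 \<in> c1" "c1 \<subseteq> insert w1 (pred w1)" using max c1 by blast
        then have "(w1, w) \<in> R" using c1(3) by (auto simp: pred_def)
        from less.IH[OF this, rule_format, of c1] w1 c1 show ?thesis by simp
      qed
      then obtain r1 where r1: "r1 \<subseteq> K \<inter> M'" "finite r1" "c1 \<inter> M' \<subseteq> r1" "nonsplit_set c1 r1"
        by auto
      \<comment> \<open>If \<open>g\<close> fixes \<open>r1\<close>, it extends by the identity on
        \<open>c1\<close>. If it also fixes \<open>r w \<inter> M'\<close>, then the extended map
        fixes all of \<open>r w\<close>, and nonsplitting of the type of \<open>w\<close> adds
        \<open>w\<close> as a fixed point.\<close>
      define r' where "r' = r1 \<union> (r w \<inter> M') \<union> ({w} \<inter> M')"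
      have "nonsplit_set c r'"
        unfolding nonsplit_set_def
      proof (intro allI impI, elim conjE)
        fix F g assume F: "finite F" "r' \<subseteq> F" "F \<subseteq> M'" "g ` F \<subseteq> M'" "elem F g" "\<forall>x\<in>r'. g x = x"
        define g1 where "g1 z = (if z \<in> c1 then z else g z)" for z
        have "r1 \<subseteq> F" "\<forall>x\<in>r1. g x = x" using F(2,6) by (auto simp: r'_def)
        then have g1: "elem (F \<union> c1) g1"
          unfolding g1_def using nonsplit_setD[OF r1(4), of F g] F by simp
        have g1_r: "g1 x = x" if "x \<in> r w" for x
          using that r_sub[OF w(2)] F(6) by (auto simp: g1_def c1_def r'_def pred_def)
        have "elem (insert w (F \<union> c1)) (g1(w := w))"
        proof (rule nonsplitD[OF r_nonsplit[OF w(2)]])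
          show "r w \<subseteq> F \<union> c1"
            using r_sub[OF w(2)] F(2) by (auto simp: c1_def r'_def pred_def)
          show "F \<union> c1 \<subseteq> M' \<union> {y \<in> N. (y, w) \<in> R}"
            using F(3) c1(3) by (auto simp: pred_def)
          show "g1 ` (F \<union> c1) \<subseteq> M' \<union> {y \<in> N. (y, w) \<in> R}"
            using F(4) c1(3) by (auto simp: pred_def g1_def)
        qed (use g1 g1_r F(1) c1(1) in auto)
        then have "elem (F \<union> c) (g1(w := w))"
          by (rule elem_mono) (auto simp: c1_def)
        then show "elem (F \<union> c) (\<lambda>z. if z \<in> c then z else g z)"
        proof (rule elem_cong)
          fix z assume z: "z \<in> F \<union> c"
          show "(g1(w := w)) z = (if z \<in> c then z else g z)"
          proof (cases "z \<in> c1 - c")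
            case True
            then have "z \<in> F" "z \<in> r w" "z \<noteq> w" using z c(3) by (auto simp: c1_def)
            then have "z \<in> r'" using F(3) by (auto simp: r'_def)
            then show ?thesis using True F(6) \<open>z \<noteq> w\<close> by (simp add: g1_def)
          next
            case False
            then show ?thesis using z c(3) by (auto simp: g1_def c1_def)
          qed
        qed
      qed
      moreover have "r' \<subseteq> K \<inter> M'" using r1(1) rw w(1) by (auto simp: r'_def)
      moreover have "finite r'" using r1(2) r_finite[OF w(2)] by (simp add: r'_def)
      moreover have "c \<inter> M' \<subseteq> r'" using r1(3) by (auto simp: r'_def c1_def)
      ultimately show "?ex c" by (intro exI[of _ r'] conjI)
    qed
  qed
  show ?thesis
  proof (cases "c = {}")
    case True
    then show ?thesis using empty by simp
  next
    case False
    then obtain w where "w \<in> c" "c \<subseteq> insert w (pred w)" using max c by blast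
    then show ?thesis using main[rule_format, of c w] c by simp
  qed
qed

lemma closed_iso_submodel:
  assumes K: "closed_set K" and F: "finite F" "F \<subseteq> M'" and x: "x \<in> M'"
  shows "isolated (K \<inter> M' \<union> F) x"
proof (cases "x \<in> K \<inter> M' \<union> F")
  case True
  moreover have "x \<in> U" using x M'_N N_U by auto
  ultimately show ?thesis by (rule isolated_mem)
next
  case x_notin: False
  have KA: "A \<subseteq> K" "K \<subseteq> N" using K by (auto simp: closed_set_def)
  have FN: "F \<subseteq> N" "x \<in> N" using F x M'_N by auto
  \<comment> \<open>\<open>Y\<close> isolates the type of \<open>x\<close> over the larger set
    \<open>K \<union> F\<close>. Its parameters \<open>c\<close> from \<open>K\<close> may lie
    outside \<open>M'\<close>, and the task is to replace them.\<close>
  obtain Y where Y: "Y \<in> dset (K \<union> F)" "x \<in> Y" "\<And>Z. Z \<in> dset (K \<union> F) \<Longrightarrow> x \<in> Z \<Longrightarrow> Y \<subseteq> Z"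
    using supp_closed_iso_finite[OF closed_imp_supp_closed[OF K] F(1) FN] by (rule isolatedE) (rule that)
  obtain G where G: "G \<subseteq> K \<union> F" "finite G" "Y \<in> dset G" using dset_finite[OF Y(1)] by blast
  define c where "c = G \<inter> K"
  have c: "finite c" "c \<subseteq> K" using G by (auto simp: c_def)
  obtain r' where r': "r' \<subseteq> K \<inter> M'" "finite r'" "c \<inter> M' \<subseteq> r'"
    and good: "nonsplit_set c r'"
    using nonsplit_closed[OF K c] by auto
  have FrN: "finite (F \<union> r')" "F \<union> r' \<subseteq> N" using F r' M'_N by auto
  \<comment> \<open>With \<open>r'\<close> among the parameters, a map that sends \<open>x\<close>
    to another point of \<open>V\<close> and fixes the rest also fixes the set over which
    \<open>c\<close> does not split.\<close>
  let ?E = "A \<union> (F \<union> r')"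
  obtain V where V: "V \<in> dset ?E" "x \<in> V" "\<And>Z. Z \<in> dset ?E \<Longrightarrow> x \<in> Z \<Longrightarrow> V \<subseteq> Z"
    using supp_closed_iso_finite[OF supp_closed_A FrN FN(2)] by (rule isolatedE) (rule that)
  have E_sub: "?E \<subseteq> K \<inter> M' \<union> F" using KA A_M' r'(1) by auto
  show ?thesis unfolding isolated_def
  proof (intro bexI conjI ballI impI)
    show "V \<in> dset (K \<inter> M' \<union> F)" by (rule dset_mono[OF V(1) E_sub])
    show "x \<in> V" by fact
    fix Z assume Z: "Z \<in> dset (K \<inter> M' \<union> F)" "x \<in> Z"
    show "V \<subseteq> Z"
    proof (rule ccontr)
      assume "\<not> V \<subseteq> Z"
      then obtain y where "y \<in> V - Z" by auto
      moreover have "V - Z \<in> dset M'"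
        by (rule dset_mono[OF dset_Diff[OF dset_mono[OF V(1) E_sub] Z(1)]]) (use F in auto)
      \<comment> \<open>Nonsplitting compares tuples of \<open>M'\<close> only, so the
        counterexample has to be found in \<open>M'\<close>; this is possible because
        \<open>V - Z\<close> is definable over \<open>M'\<close>.\<close>
      ultimately obtain e where e: "e \<in> M'" "e \<in> V" "e \<notin> Z" using tv_closedD[OF tv_M', of "V - Z" y] by auto
      let ?F = "insert x (F \<union> r')" and ?g = "id(x := e)"
      have "elem (insert x ?E) ?g"
        by (rule elem_extend_id[OF _ V(1,2) _ V(3) e(2)])
          (use FrN(2) A_N N_U x_notin E_sub in auto)
      then have g: "elem ?F ?g" by (rule elem_mono) auto
      have "elem (?F \<union> c) (\<lambda>z. if z \<in> c then z else ?g z)"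
        by (rule nonsplit_setD[OF good _ _ _ _ g]) (use F r'(1,2) x e(1) x_notin in auto)
      then have "elem (insert x G) (\<lambda>z. if z \<in> c then z else ?g z)"
        by (rule elem_mono) (use G(1) in \<open>auto simp: c_def\<close>)
      then have "elem (insert x G) ?g"
        by (rule elem_cong) (use x x_notin c(2) in auto)
      then have "?g x \<in> Y"
        by (rule dset_elem_mem[OF _ G(3) Y(2)]) (use x_notin G(1) x in auto)
      moreover have "Z \<in> dset (K \<union> F)" by (rule dset_mono[OF Z(1)]) auto
      ultimately show False using Y(3)[of Z] Z(2) e(3) by auto
    qed
  qed
qed

text \<open>The closure of a point collects all iterated supports, which may leave
  \<open>M'\<close>, and keeps the part in \<open>M'\<close>. Each step adds finitely many points,
  so countably many arise.\<close>

lemma countable_closure: "\<exists>cl. closure_system L S M' A cl"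
proof -
  define T where "T = {(x, y). x \<in> N \<and> y \<in> s x \<union> r x}"
  define cl where "cl x = T\<^sup>* `` {x} \<inter> M'" for x
  have T_N: "y \<in> N" if "(x, y) \<in> T" for x y
    using that s_sub[of x] r_sub[of x] A_N M'_N by (auto simp: T_def)
  have Tn: "countable ((T ^^ n) `` {x})" for n x
  proof (induction n)
    case (Suc n)
    have "countable (T `` {y})" for y
    proof (rule countable_finite, cases "y \<in> N")
      case True
      have "T `` {y} \<subseteq> s y \<union> r y" by (auto simp: T_def)
      then show "finite (T `` {y})"
        using s_finite[OF True] r_finite[OF True] by (meson finite_UnI finite_subset)
    qed (simp add: T_def)
    moreover have "(T ^^ Suc n) `` {x} = (\<Union>y\<in>(T ^^ n) `` {x}. T `` {y})" by auto
    ultimately show ?case using Suc by simp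
  qed simp
  have "T\<^sup>* `` {x} = (\<Union>n. (T ^^ n) `` {x})" for x
    by (auto simp: rtrancl_is_UN_relpow)
  then have "countable (T\<^sup>* `` {x})" for x using Tn by simp
  then have cl_countable: "countable (cl x)" for x
    by (auto simp: cl_def intro: countable_subset)
  have cl_A: "cl x \<subseteq> A" if "x \<in> A" for x
  proof -
    have "y = x" if "(x, y) \<in> T\<^sup>*" for y
      using that
    proof (induction rule: rtrancl_induct)
      case (step y z)
      then show ?case using s_A r_A \<open>x \<in> A\<close> by (simp add: T_def)
    qed simp
    then show ?thesis using that by (auto simp: cl_def)
  qed
  have cl_iso: "isolated (D \<union> F) x"
    if D: "A \<subseteq> D" "D \<subseteq> M'" "\<And>y. y \<in> D \<Longrightarrow> cl y \<subseteq> D" and F: "finite F" "F \<subseteq> M'" "x \<in> M'" for D F x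
  proof -
    \<comment> \<open>The full closure of \<open>D\<close> in \<open>N\<close> is a closed set, and
      its trace on \<open>M'\<close> is \<open>D\<close> again because \<open>D\<close> contains the
      traced closures of its points.\<close>
    define K where "K = T\<^sup>* `` D"
    have "K \<subseteq> N"
    proof
      fix y assume "y \<in> K"
      then obtain x where "x \<in> D" "(x, y) \<in> T\<^sup>*" by (auto simp: K_def)
      from this(2) show "y \<in> N" by (cases rule: rtrancl.cases) (use T_N \<open>x \<in> D\<close> D(2) M'_N in auto)
    qed
    moreover have "s y \<union> r y \<subseteq> K" if "y \<in> K" for y
    proof
      fix z assume "z \<in> s y \<union> r y"
      then have "(y, z) \<in> T" using that \<open>K \<subseteq> N\<close> by (auto simp: T_def)
      with that show "z \<in> K" by (auto simp: K_def intro: rtrancl_into_rtrancl)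
    qed
    moreover have "D \<subseteq> K" by (auto simp: K_def)
    ultimately have "closed_set K" using D(1) by (auto simp: closed_set_def)
    moreover have "K \<inter> M' = D"
      using D(2,3) \<open>D \<subseteq> K\<close> unfolding K_def cl_def by blast
    ultimately show ?thesis using closed_iso_submodel[of K F x] F by simp
  qed
  have "closure_system L S M' A cl"
  proof
    show "cl x \<subseteq> A" if "x \<in> A" for x by (rule cl_A[OF that])
    fix D F x
    assume "A \<subseteq> D" "D \<subseteq> M'" "\<And>y. y \<in> D \<Longrightarrow> cl y \<subseteq> D" "finite F" "F \<subseteq> M'" "x \<in> M'"
    then show "isolated (D \<union> F) x" by (rule cl_iso)
  qed (use tv_M' A_M' cl_countable in \<open>auto simp: cl_def\<close>)
  then show ?thesis by blast
qed

end

section \<open>Prime models are finitely homogeneous\<close>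

context fo_structure
begin

text \<open>A maximal construction inside \<open>M\<close> is an elementary submodel: a nonempty set
  definable over \<open>N\<close> contains an atom over \<open>N\<close>, the atom has a point in
  \<open>M\<close>, and this point is isolated over \<open>N\<close>, hence already picked.\<close>

lemma constructible_submodel:
  assumes tt: "totally_transcendental L S" and M: "tv_closed M" and "A \<subseteq> M"
  shows "\<exists>N R. A \<subseteq> N \<and> N \<subseteq> M \<and> tv_closed N \<and> wf R \<and> trans R \<and> total_on N R \<and>
    (\<forall>x\<in>N. isolated (A \<union> {y \<in> N. (y, x) \<in> R}) x)"
proof -
  have MU: "M \<subseteq> U" by (rule tv_closed_subset[OF M])
  obtain N R where N: "N \<subseteq> M" "wf R" "trans R" "total_on N R"
    and N_iso: "\<forall>x\<in>N. isolated (A \<union> {y \<in> N. (y, x) \<in> R}) x"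
    and N_max: "\<forall>x\<in>M. isolated (A \<union> N) x \<longrightarrow> x \<in> N"
    using greedy_enumeration[of M "\<lambda>X x. isolated (A \<union> X) x"] by (elim exE conjE) (rule that)
  have "A \<subseteq> N"
  proof
    fix a assume "a \<in> A"
    then have "a \<in> M" "a \<in> U" using \<open>A \<subseteq> M\<close> MU by auto
    then show "a \<in> N" using N_max isolated_mem[of a "A \<union> N"] \<open>a \<in> A\<close> by simp
  qed
  then have AN: "A \<union> N = N" by auto
  have "tv_closed N" unfolding tv_closed_def
  proof (intro conjI ballI impI)
    show NU: "N \<subseteq> U" using N(1) MU by simp
    fix Y assume Y: "Y \<in> dset N" "Y \<noteq> {}"
    obtain Z where Z: "Z \<in> dset N" "Z \<subseteq> Y" "Z \<noteq> {}"
      and atom: "\<forall>W\<in>dset N. W \<inter> Z \<noteq> {} \<longrightarrow> Z \<subseteq> W"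
      using atom_exists[OF tt NU Y] by (elim bexE conjE) (rule that)
    obtain y where "y \<in> Z" using Z(3) by auto
    then obtain z where z: "z \<in> M" "z \<in> Z"
      using tv_closedD[OF M dset_mono[OF Z(1) N(1)]] by auto
    have "isolated N z" unfolding isolated_def
      by (rule bexI[OF _ Z(1)]) (use z(2) atom in auto)
    then have "z \<in> N" using N_max z(1) AN by simp
    then show "Y \<inter> N \<noteq> {}" using z(2) Z(2) by auto
  qed
  then show ?thesis using \<open>A \<subseteq> N\<close> N N_iso by (intro exI[of _ N] exI[of _ R] conjI)
qed

lemma tv_closed_image:
  assumes M: "tv_closed M" and f: "elem M f"
  shows "tv_closed (f ` M)"
  unfolding tv_closed_def
proof (intro conjI ballI impI)
  show "f ` M \<subseteq> U" using elem_image[OF f] by auto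
  fix Y assume Y: "Y \<in> dset (f ` M)" "Y \<noteq> {}"
  obtain \<Psi> where \<Psi>: "Fm (insert None (Some ` f ` M)) \<Psi>" "Y = {y \<in> U. \<Psi> (case_option y id)}"
    using Y(1) by (rule dsetE)
  let ?i = "inv_into M f"
  have inv: "?i (f z) = z" if "z \<in> M" for z
    using elem_inj[OF f] that by simp
  define \<Psi>' where "\<Psi>' = (\<lambda>v. \<Psi> (\<lambda>o'. v (map_option ?i o')))"
  have F: "Fm (insert None (Some ` M)) \<Psi>'"
    unfolding \<Psi>'_def by (rule Fm_subst[OF \<Psi>(1)]) (use inv in auto)
  have eq: "\<Psi>' (case_option u f) = \<Psi> (case_option u id)" for u
    unfolding \<Psi>'_def by (rule Fm_cong[OF \<Psi>(1)]) (use inv in auto)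
  have "\<exists>y\<in>U. \<Psi>' (case_option y f)" unfolding eq using Y(2) \<Psi>(2) by auto
  then have "\<exists>y\<in>U. \<Psi>' (case_option y id)"
    using elem_iff[OF f Fm_ex_option[OF F]] by simp
  then obtain y where "y \<in> {y \<in> U. \<Psi>' (case_option y id)}" by auto
  moreover have "{y \<in> U. \<Psi>' (case_option y id)} \<in> dset M"
    using F unfolding dset_def by blast
  ultimately obtain z where z: "z \<in> M" "\<Psi>' (case_option z id)"
    using tv_closedD[OF M] by fastforce
  then have "insert z M = M" by auto
  then have "\<Psi>' (case_option (f z) f)" using dset_elem_iff[OF _ F, of z f] f z(2) by simp
  then have "f z \<in> Y" using eq elem_image[OF f z(1)] \<Psi>(2) by simp
  then show "Y \<inter> f ` M \<noteq> {}" using z(1) by auto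
qed

lemma isolated_finite_support:
  assumes "isolated E x"
  shows "\<exists>F\<subseteq>E. finite F \<and> (\<exists>Y\<in>dset F. x \<in> Y \<and> (\<forall>Z\<in>dset E. x \<in> Z \<longrightarrow> Y \<subseteq> Z))"
proof -
  obtain Y where Y: "Y \<in> dset E" "x \<in> Y" "\<And>Z. Z \<in> dset E \<Longrightarrow> x \<in> Z \<Longrightarrow> Y \<subseteq> Z"
    using assms by (rule isolatedE) (rule that)
  obtain F where F: "F \<subseteq> E" "finite F" "Y \<in> dset F" using dset_finite[OF Y(1)] by blast
  show ?thesis
    by (intro exI[of _ F] conjI bexI[of _ Y] ballI impI) (use F Y in simp_all)
qed

text \<open>\<open>N\<close> is built inside \<open>M\<close>, and \<open>prime\<close> maps
  \<open>M\<close> elementarily onto a submodel \<open>M'\<close> of \<open>N\<close>. Closures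
  exist for \<open>M'\<close> and are pulled back along this map, which fixes
  \<open>A\<close>.\<close>

lemma prime_closure:
  assumes tt: "totally_transcendental L S" and hom: homogeneous
    and M: "tv_closed M" and AM: "A \<subseteq> M"
    and prime: "\<forall>N. tv_closed N \<longrightarrow> A \<subseteq> N \<longrightarrow> (\<exists>f. f ` M \<subseteq> N \<and> elem M f \<and> (\<forall>a\<in>A. f a = a))"
  shows "\<exists>cl. closure_system L S M A cl"
proof -
  have MU: "M \<subseteq> U" by (rule tv_closed_subset[OF M])
  obtain N R where N: "A \<subseteq> N" "N \<subseteq> M" "tv_closed N" and R: "wf R" "trans R" "total_on N R"
    and N_iso: "\<forall>x\<in>N. isolated (A \<union> {y \<in> N. (y, x) \<in> R}) x"
    using constructible_submodel[OF tt M AM] by (elim exE conjE) (rule that)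
  have NU: "N \<subseteq> U" using N(2) MU by simp
  obtain f where f: "f ` M \<subseteq> N" "elem M f" "\<forall>a\<in>A. f a = a"
    using prime[rule_format, OF N(3,1)] by blast
  define M' where "M' = f ` M"
  \<comment> \<open>At points of \<open>A\<close> the singleton is prescribed, here and for
    \<open>r\<close> below, so that closures of points of \<open>A\<close> stay in
    \<open>A\<close>.\<close>
  have "\<forall>x. \<exists>F. x \<in> N \<longrightarrow> finite F \<and> F \<subseteq> A \<union> {y \<in> N. (y, x) \<in> R} \<and> (x \<in> A \<longrightarrow> F = {x}) \<and>
      (\<exists>Y\<in>dset F. x \<in> Y \<and> (\<forall>Z\<in>dset (A \<union> {y \<in> N. (y, x) \<in> R}). x \<in> Z \<longrightarrow> Y \<subseteq> Z))"
  proof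
    fix x
    show "\<exists>F. x \<in> N \<longrightarrow> finite F \<and> F \<subseteq> A \<union> {y \<in> N. (y, x) \<in> R} \<and> (x \<in> A \<longrightarrow> F = {x}) \<and>
      (\<exists>Y\<in>dset F. x \<in> Y \<and> (\<forall>Z\<in>dset (A \<union> {y \<in> N. (y, x) \<in> R}). x \<in> Z \<longrightarrow> Y \<subseteq> Z))"
    proof (cases "x \<in> A \<and> x \<in> N")
      case True
      then have "{x} \<in> dset {x}" using NU dset_singleton by auto
      with True show ?thesis by (intro exI[of _ "{x}"]) auto
    next
      case False
      show ?thesis
      proof (cases "x \<in> N")
        case True
        with False isolated_finite_support[OF N_iso[rule_format, OF True]] show ?thesis by auto
      qed simp
    qed
  qed
  from choice[OF this] obtain s where s0: "\<forall>x. x \<in> N \<longrightarrow> finite (s x) \<and>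
      s x \<subseteq> A \<union> {y \<in> N. (y, x) \<in> R} \<and> (x \<in> A \<longrightarrow> s x = {x}) \<and>
      (\<exists>Y\<in>dset (s x). x \<in> Y \<and> (\<forall>Z\<in>dset (A \<union> {y \<in> N. (y, x) \<in> R}). x \<in> Z \<longrightarrow> Y \<subseteq> Z))" ..
  have s: "\<And>x. x \<in> N \<Longrightarrow> finite (s x)" "\<And>x. x \<in> N \<Longrightarrow> s x \<subseteq> A \<union> {y \<in> N. (y, x) \<in> R}"
      "\<And>x. x \<in> N \<Longrightarrow> x \<in> A \<Longrightarrow> s x = {x}"
      "\<And>x. x \<in> N \<Longrightarrow> \<exists>Y\<in>dset (s x). x \<in> Y \<and>
          (\<forall>Z\<in>dset (A \<union> {y \<in> N. (y, x) \<in> R}). x \<in> Z \<longrightarrow> Y \<subseteq> Z)"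
    using s0 by simp_all
  have M'N: "M' \<subseteq> N" using f(1) by (simp add: M'_def)
  have AM': "A \<subseteq> M'" using f(3) AM unfolding M'_def by force
  have "\<forall>x. \<exists>F. x \<in> N \<longrightarrow> finite F \<and> F \<subseteq> M' \<union> {y \<in> N. (y, x) \<in> R} \<and> (x \<in> A \<longrightarrow> F = {x}) \<and>
      nonsplit (M' \<union> {y \<in> N. (y, x) \<in> R}) F x"
  proof
    fix x
    show "\<exists>F. x \<in> N \<longrightarrow> finite F \<and> F \<subseteq> M' \<union> {y \<in> N. (y, x) \<in> R} \<and> (x \<in> A \<longrightarrow> F = {x}) \<and>
      nonsplit (M' \<union> {y \<in> N. (y, x) \<in> R}) F x"
    proof (cases "x \<in> A")
      case True
      then have "x \<in> M'" using AM' by auto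
      then show ?thesis
        using nonsplit_singleton[of x "M' \<union> {y \<in> N. (y, x) \<in> R}"] by (intro exI[of _ "{x}"]) simp
    next
      case False
      show ?thesis
      proof (cases "x \<in> N")
        case True
        then have "M' \<union> {y \<in> N. (y, x) \<in> R} \<subseteq> U" "x \<in> U" using M'N NU by auto
        from nonsplit_exists[OF tt hom this] False show ?thesis by auto
      qed simp
    qed
  qed
  from choice[OF this] obtain r where
    r: "\<And>x. x \<in> N \<Longrightarrow> finite (r x)" "\<And>x. x \<in> N \<Longrightarrow> r x \<subseteq> M' \<union> {y \<in> N. (y, x) \<in> R}"
      "\<And>x. x \<in> N \<Longrightarrow> x \<in> A \<Longrightarrow> r x = {x}"
      "\<And>x. x \<in> N \<Longrightarrow> nonsplit (M' \<union> {y \<in> N. (y, x) \<in> R}) (r x) x"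
    by auto
  interpret construction L S A N M' R s r
  proof
    show "tv_closed M'" unfolding M'_def by (rule tv_closed_image[OF M f(2)])
    fix x
    show "x \<in> A \<Longrightarrow> s x = {x}" "x \<in> A \<Longrightarrow> r x = {x}" using s(3) r(3) N(1) by auto
  qed (use AM' M'N NU R s r in simp_all)
  obtain cl' where "closure_system L S M' A cl'" using countable_closure by blast
  then interpret C: closure_system L S M' A cl' .
  have inj: "inj_on f M" by (rule elem_inj[OF f(2)])
  define cl where "cl x = {y \<in> M. f y \<in> cl' (f x)}" for x
  have cl_countable: "countable (cl x)" if "x \<in> M" for x
  proof -
    have "f ` cl x \<subseteq> cl' (f x)" by (auto simp: cl_def)
    then have "countable (f ` cl x)"
      by (rule countable_subset) (use that C.cl_countable in \<open>simp add: M'_def\<close>)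
    moreover have "inj_on f (cl x)" by (rule inj_on_subset[OF inj]) (auto simp: cl_def)
    ultimately show ?thesis by (rule countable_image_inj_on)
  qed
  have cl_trans: "cl y \<subseteq> cl x" if "x \<in> M" "y \<in> cl x" for x y
  proof -
    have "f x \<in> M'" "f y \<in> cl' (f x)" using that by (auto simp: cl_def M'_def)
    then have "cl' (f y) \<subseteq> cl' (f x)" by (rule C.cl_trans)
    then show ?thesis by (auto simp: cl_def)
  qed
  have cl_A: "cl x \<subseteq> A" if "x \<in> A" for x
  proof
    fix y assume "y \<in> cl x"
    then have y: "y \<in> M" "f y \<in> A" using C.cl_A[OF that] f(3) that by (auto simp: cl_def)
    then have "f (f y) = f y" "f y \<in> M" using f(3) AM by auto
    then have "f y = y" using y(1) inj by (simp add: inj_on_eq_iff)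
    then show "y \<in> A" using y(2) by simp
  qed
  have cl_iso: "isolated (D \<union> F) x"
    if D: "A \<subseteq> D" "D \<subseteq> M" "\<And>y. y \<in> D \<Longrightarrow> cl y \<subseteq> D" and F: "finite F" "F \<subseteq> M" "x \<in> M" for D F x
  proof -
    have "A \<subseteq> f ` D" using D(1) f(3) by force
    moreover have "f ` D \<subseteq> M'" using D(2) by (auto simp: M'_def)
    moreover have "cl' y \<subseteq> f ` D" if "y \<in> f ` D" for y
    proof
      fix z assume z: "z \<in> cl' y"
      from that obtain d where d: "d \<in> D" "y = f d" by auto
      then have "z \<in> M'" using z C.cl_M[of y] D(2) unfolding M'_def by auto
      then obtain u where u: "u \<in> M" "z = f u" by (auto simp: M'_def)
      then have "u \<in> cl d" using z d by (simp add: cl_def)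
      then show "z \<in> f ` D" using D(3)[OF d(1)] u by auto
    qed
    ultimately have "isolated (f ` D \<union> f ` F) (f x)"
      by (intro C.cl_iso) (use F in \<open>auto simp: M'_def\<close>)
    then have isolated: "isolated (f ` (D \<union> F)) (f x)" by (simp add: image_Un)
    let ?i = "inv_into M f"
    have "elem (f ` M) ?i" by (rule elem_inv[OF f(2) MU])
    then have "elem (insert (f x) (f ` (D \<union> F))) ?i" by (rule elem_mono) (use D F in auto)
    from isolated_transfer[OF this _ isolated] have "isolated (?i ` f ` (D \<union> F)) (?i (f x))"
      using D(2) F elem_image[OF f(2)] by auto
    moreover have "?i ` f ` (D \<union> F) = D \<union> F" "?i (f x) = x"
      using inj D(2) F by (simp_all add: inv_into_image_cancel)
    ultimately show ?thesis by simp
  qed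
  have cl_self: "x \<in> cl x" if "x \<in> M" for x
    using that C.cl_self by (simp add: cl_def M'_def)
  have "closure_system L S M A cl"
  proof
    show "cl y \<subseteq> cl x" if "x \<in> M" "y \<in> cl x" for x y by (rule cl_trans[OF that])
    show "cl x \<subseteq> A" if "x \<in> A" for x by (rule cl_A[OF that])
    fix D F x
    assume "A \<subseteq> D" "D \<subseteq> M" "\<And>y. y \<in> D \<Longrightarrow> cl y \<subseteq> D" "finite F" "F \<subseteq> M" "x \<in> M"
    then show "isolated (D \<union> F) x" by (rule cl_iso)
  qed (use M AM cl_countable cl_self in \<open>auto simp: cl_def\<close>)
  then show ?thesis by blast
qed

text \<open>Partial elementary maps as relations. Naming the variables by the pairs themselves makes
  the notion symmetric, and single-valuedness a consequence.\<close>

definition elem_rel :: "('m \<times> 'm) set \<Rightarrow> bool" where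
  "elem_rel G \<longleftrightarrow> G \<subseteq> U \<times> U \<and> (\<forall>\<Phi>. Fm G \<Phi> \<longrightarrow> \<Phi> fst = \<Phi> snd)"

lemma elem_relD: "elem_rel G \<Longrightarrow> Fm G \<Phi> \<Longrightarrow> \<Phi> fst = \<Phi> snd"
  by (simp add: elem_rel_def)

lemma elem_rel_converse:
  assumes "elem_rel G"
  shows "elem_rel (G\<inverse>)"
  unfolding elem_rel_def
proof (intro conjI allI impI)
  show "G\<inverse> \<subseteq> U \<times> U" using assms by (auto simp: elem_rel_def)
  fix \<Phi> assume "Fm (G\<inverse>) \<Phi>"
  then have "Fm G (\<lambda>g. \<Phi> (\<lambda>p. g (prod.swap p)))" by (rule Fm_subst) auto
  from elem_relD[OF assms this] show "\<Phi> fst = \<Phi> snd"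
    by (simp add: prod.swap_def)
qed

lemma elem_rel_graph:
  assumes "elem E g" "E \<subseteq> U"
  shows "elem_rel ((\<lambda>z. (z, g z)) ` E)"
  unfolding elem_rel_def
proof (intro conjI allI impI)
  show "(\<lambda>z. (z, g z)) ` E \<subseteq> U \<times> U" using assms(2) elem_image[OF assms(1)] by auto
  fix \<Phi> assume \<Phi>: "Fm ((\<lambda>z. (z, g z)) ` E) \<Phi>"
  have "Fm E (\<lambda>k. \<Phi> (\<lambda>p. k (fst p)))" by (rule Fm_subst[OF \<Phi>]) auto
  from elem_iff[OF assms(1) this] have "\<Phi> (\<lambda>p. g (fst p)) = \<Phi> fst" by simp
  moreover have "\<Phi> (\<lambda>p. g (fst p)) = \<Phi> snd" by (rule Fm_cong[OF \<Phi>]) auto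
  ultimately show "\<Phi> fst = \<Phi> snd" by simp
qed

lemma elem_rel_map:
  assumes "elem_rel G"
  shows "\<exists>g. elem (fst ` G) g \<and> G = (\<lambda>z. (z, g z)) ` fst ` G"
proof -
  define g where "g x = (SOME y. (x, y) \<in> G)" for x
  have g: "g x = y" if "(x, y) \<in> G" for x y
  proof -
    have "(x, g x) \<in> G" unfolding g_def using that by (rule someI)
    then have "Fm G (\<lambda>k. k (x, g x) = k (x, y))" using that by (intro Fm_eq)
    from elem_relD[OF assms this] show ?thesis by simp
  qed
  have G: "G = (\<lambda>z. (z, g z)) ` fst ` G"
    using g by (force simp: image_iff)
  have "elem (fst ` G) g" unfolding elem_def
  proof (intro conjI allI impI)
    show "g ` fst ` G \<subseteq> U" using g assms by (auto simp: elem_rel_def)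
    fix \<Phi> assume \<Phi>: "Fm (fst ` G) \<Phi>" "\<Phi> id"
    have "Fm G (\<lambda>k. \<Phi> (\<lambda>z. k (z, g z)))" by (rule Fm_subst[OF \<Phi>(1)]) (use G in auto)
    from elem_relD[OF assms this] \<Phi>(2) show "\<Phi> g" by (simp add: id_def)
  qed
  with G show ?thesis by blast
qed

text \<open>The isolating formula over the domain stays consistent when transported by the map, so
  it has a solution in \<open>M\<close> by the Tarski-Vaught criterion, and any solution extends the
  map.\<close>

lemma elem_rel_step:
  assumes M: "tv_closed M" and G: "elem_rel G" "G \<subseteq> M \<times> M" and x: "x \<in> M" "isolated (fst ` G) x"
  shows "\<exists>y\<in>M. elem_rel (insert (x, y) G)"
proof (cases "x \<in> fst ` G")
  case True
  then obtain y where y: "(x, y) \<in> G" by auto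
  then have "y \<in> M" "insert (x, y) G = G" using G(2) by auto
  with G(1) show ?thesis by (intro bexI[of _ y]) simp_all
next
  case False
  have MU: "M \<subseteq> U" by (rule tv_closed_subset[OF M])
  obtain g where g: "elem (fst ` G) g" and G_g: "G = (\<lambda>z. (z, g z)) ` fst ` G"
    using elem_rel_map[OF G(1)] by blast
  have g_M: "g ` fst ` G \<subseteq> M"
  proof
    fix y assume "y \<in> g ` fst ` G"
    then obtain z where "z \<in> fst ` G" "y = g z" by auto
    then have "(z, y) \<in> G" using G_g by auto
    then show "y \<in> M" using G(2) by auto
  qed
  obtain Y where Y: "Y \<in> dset (fst ` G)" "x \<in> Y" "\<And>Z. Z \<in> dset (fst ` G) \<Longrightarrow> x \<in> Z \<Longrightarrow> Y \<subseteq> Z"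
    using x(2) by (rule isolatedE) (rule that)
  obtain \<Psi> where \<Psi>: "Fm (insert None (Some ` fst ` G)) \<Psi>" "Y = {y \<in> U. \<Psi> (case_option y id)}"
    using Y(1) by (rule dsetE)
  have "\<exists>y\<in>U. \<Psi> (case_option y id)" using Y(2) \<Psi>(2) by auto
  then have "\<exists>y\<in>U. \<Psi> (case_option y g)"
    using elem_iff[OF g Fm_ex_option[OF \<Psi>(1)]] by simp
  then obtain u where "u \<in> {y \<in> U. \<Psi> (case_option y g)}" by auto
  moreover have "{y \<in> U. \<Psi> (case_option y g)} \<in> dset M"
    by (rule dset_mono[OF dsetI[OF \<Psi>(1)] g_M])
  ultimately obtain y where y: "y \<in> M" "y \<in> U" "\<Psi> (case_option y g)"
    using tv_closedD[OF M] by fastforce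
  have "elem (insert x (fst ` G)) (g(x := y))"
    by (rule elem_extend[OF g \<Psi>(1)]) (use Y \<Psi>(2) False y in auto)
  moreover have "insert x (fst ` G) \<subseteq> U" using x(1) G(2) MU by auto
  ultimately have "elem_rel ((\<lambda>z. (z, (g(x := y)) z)) ` insert x (fst ` G))" by (rule elem_rel_graph)
  moreover have "(\<lambda>z. (z, (g(x := y)) z)) ` fst ` G = (\<lambda>z. (z, g z)) ` fst ` G"
    by (rule image_cong) (use False in auto)
  then have "(\<lambda>z. (z, (g(x := y)) z)) ` insert x (fst ` G) = insert (x, y) G"
    using G_g by simp
  ultimately have "elem_rel (insert (x, y) G)" by simp
  then show ?thesis using y(1) by (intro bexI[of _ y])
qed

lemma elem_rel_Union:
  assumes "\<C> \<noteq> {}" "subset.chain UNIV \<C>" "\<And>G. G \<in> \<C> \<Longrightarrow> elem_rel G"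
  shows "elem_rel (\<Union>\<C>)"
  unfolding elem_rel_def
proof (intro conjI allI impI)
  show "\<Union>\<C> \<subseteq> U \<times> U" using assms(3) by (auto simp: elem_rel_def)
  fix \<Phi> assume "Fm (\<Union>\<C>) \<Phi>"
  from Fm_finite[OF this] obtain F where F: "F \<subseteq> \<Union>\<C>" "finite F" "Fm F \<Phi>" by auto
  obtain G where G: "G \<in> \<C>" "F \<subseteq> G"
    using finite_subset_Union_chain[OF F(2,1) assms(1,2)] .
  from elem_relD[OF assms(3)[OF G(1)] Fm_mono[OF F(3) G(2)]] show "\<Phi> fst = \<Phi> snd" .
qed

end

text \<open>Back and forth in the style of Ressayre: a partial elementary map whose domain and range are
  closed under \<open>cl\<close>, up to a finite set, extends by countably many points to another such map.\<close>

context closure_system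
begin

definition cl_closed :: "'m set \<Rightarrow> bool" where
  "cl_closed D \<longleftrightarrow> A \<subseteq> D \<and> D \<subseteq> M \<and> (\<forall>y\<in>D. cl y \<subseteq> D)"

text \<open>The finite defects \<open>F\<close> and \<open>F'\<close> are arguments and not
  existentially quantified: a chain of maps with the same defects has a union with these
  defects.\<close>

definition base :: "'m set \<Rightarrow> 'm set \<Rightarrow> ('m \<times> 'm) set \<Rightarrow> bool" where
  "base F F' G \<longleftrightarrow> finite F \<and> finite F' \<and> G \<subseteq> M \<times> M \<and> elem_rel G \<and>
     (\<exists>D. cl_closed D \<and> fst ` G = D \<union> F) \<and> (\<exists>D. cl_closed D \<and> snd ` G = D \<union> F')"

lemma base_converse:
  assumes "base F F' G"
  shows "base F' F (G\<inverse>)"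
proof -
  have "fst ` (G\<inverse>) = snd ` G" "snd ` (G\<inverse>) = fst ` G" by force+
  then show ?thesis using assms elem_rel_converse[of G] by (auto simp: base_def)
qed

text \<open>The domain of a finite extension of \<open>G\<close> is a closed set plus finitely many
  points, so \<open>cl_iso\<close> applies although the extension itself is not closed.\<close>

lemma base_step:
  assumes G: "base F F' G" and H: "G \<subseteq> H" "finite (H - G)" "H \<subseteq> M \<times> M" "elem_rel H" and x: "x \<in> M"
  shows "\<exists>y\<in>M. elem_rel (insert (x, y) H)"
proof (rule elem_rel_step[OF tv_M H(4,3) x])
  obtain D where D: "cl_closed D" "fst ` G = D \<union> F" "finite F" using G by (auto simp: base_def)
  have "fst ` H = fst ` G \<union> fst ` (H - G)" using H(1) by (metis image_Un Un_Diff_cancel sup.absorb2)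
  then have eq: "fst ` H = D \<union> (F \<union> fst ` (H - G))" using D(2) by auto
  have "fst ` H \<subseteq> M" using H(3) by auto
  then have "F \<union> fst ` (H - G) \<subseteq> M" using eq by auto
  then show "isolated (fst ` H) x"
    unfolding eq using D(1,3) H(2) x by (intro cl_iso) (auto simp: cl_closed_def)
qed

lemma base_forth:
  assumes G: "base F F' G" and H: "G \<subseteq> H" "finite (H - G)" "H \<subseteq> M \<times> M" "elem_rel H"
    and X: "finite X" "X \<subseteq> M"
  shows "\<exists>K. H \<subseteq> K \<and> finite (K - G) \<and> K \<subseteq> M \<times> M \<and> elem_rel K \<and> X \<subseteq> fst ` K"
  using X
proof (induction X rule: finite_induct)
  case empty
  then show ?case using H by (intro exI[of _ H]) simp
next
  case (insert x X)
  then obtain K where K: "H \<subseteq> K" "finite (K - G)" "K \<subseteq> M \<times> M" "elem_rel K" "X \<subseteq> fst ` K" by auto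
  then have "G \<subseteq> K" using H(1) by simp
  from base_step[OF G this K(2-4), of x] obtain y where y: "y \<in> M" "elem_rel (insert (x, y) K)"
    using insert.prems by auto
  have "finite (insert (x, y) K - G)" using K(2) by (simp add: insert_Diff_if)
  then show ?case using K y insert.prems by (intro exI[of _ "insert (x, y) K"]) auto
qed

text \<open>The back direction is the forth direction for the converse relation.\<close>

lemma base_back_forth:
  assumes G: "base F F' G" and H: "G \<subseteq> H" "finite (H - G)" "H \<subseteq> M \<times> M" "elem_rel H"
    and X: "finite X" "X \<subseteq> M" and Y: "finite Y" "Y \<subseteq> M"
  shows "\<exists>K. H \<subseteq> K \<and> finite (K - G) \<and> K \<subseteq> M \<times> M \<and> elem_rel K \<and> X \<subseteq> fst ` K \<and> Y \<subseteq> snd ` K"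
proof -
  obtain K where K: "H \<subseteq> K" "finite (K - G)" "K \<subseteq> M \<times> M" "elem_rel K" "X \<subseteq> fst ` K"
    using base_forth[OF G H X] by auto
  have "K\<inverse> - G\<inverse> = (K - G)\<inverse>" by auto
  then have "finite (K\<inverse> - G\<inverse>)" using K(2) by simp
  moreover have "G\<inverse> \<subseteq> K\<inverse>" "K\<inverse> \<subseteq> M \<times> M" using H(1) K(1,3) by auto
  ultimately obtain J where J: "K\<inverse> \<subseteq> J" "finite (J - G\<inverse>)" "J \<subseteq> M \<times> M" "elem_rel J" "Y \<subseteq> fst ` J"
    using base_forth[OF base_converse[OF G] _ _ _ elem_rel_converse[OF K(4)] Y] by auto
  have "K \<subseteq> J\<inverse>" using J(1) by auto
  moreover have "J\<inverse> - G = (J - G\<inverse>)\<inverse>" by auto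
  then have "finite (J\<inverse> - G)" using J(2) by simp
  moreover have "J\<inverse> \<subseteq> M \<times> M" using J(3) by auto
  moreover have "snd ` (J\<inverse>) = fst ` J" by force
  moreover have "X \<subseteq> fst ` (J\<inverse>)" using K(5) \<open>K \<subseteq> J\<inverse>\<close> by blast
  ultimately show ?thesis using K(1) J(5) elem_rel_converse[OF J(4)]
    by (intro exI[of _ "J\<inverse>"]) auto
qed

text \<open>Applied with \<open>fst\<close> and \<open>snd\<close> as \<open>p\<close>. It suffices
  to adjoin to \<open>D\<close> the closures of the new points: transitivity of closures makes the
  result closed, and the defect \<open>F\<close> stays the same.\<close>

lemma closed_limit:
  assumes D: "cl_closed D" "p ` G = D \<union> F" and GH: "G \<subseteq> H" "p ` H \<subseteq> M"
    and cl: "\<And>z. z \<in> p ` (H - G) \<Longrightarrow> cl z \<subseteq> p ` H"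
  shows "\<exists>D. cl_closed D \<and> p ` H = D \<union> F"
proof (intro exI conjI)
  let ?D = "D \<union> (\<Union>z\<in>p ` (H - G). cl z)"
  have H: "p ` H = p ` G \<union> p ` (H - G)" using GH(1) by blast
  then have sub: "p ` (H - G) \<subseteq> M" using GH(2) by simp
  show "cl_closed ?D"
    unfolding cl_closed_def
  proof (intro conjI ballI)
    show "A \<subseteq> ?D" "?D \<subseteq> M" using D(1) sub cl_M by (auto simp: cl_closed_def)
    fix y assume "y \<in> ?D"
    then show "cl y \<subseteq> ?D"
    proof
      assume "y \<in> D"
      then show ?thesis using D(1) by (auto simp: cl_closed_def)
    next
      assume "y \<in> (\<Union>z\<in>p ` (H - G). cl z)"
      then obtain z where "z \<in> p ` (H - G)" "y \<in> cl z" by auto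
      moreover from this have "cl y \<subseteq> cl z" using cl_trans sub by blast
      ultimately show ?thesis by auto
    qed
  qed
  have "p ` (H - G) \<subseteq> (\<Union>z\<in>p ` (H - G). cl z)" using sub cl_self by auto
  moreover have "(\<Union>z\<in>p ` (H - G). cl z) \<subseteq> p ` H" using cl by auto
  moreover have "D \<union> F \<subseteq> p ` H" using H D(2) by auto
  ultimately show "p ` H = ?D \<union> F" using H D(2) by auto
qed

lemma base_extend:
  assumes G: "base F F' G" and x: "x \<in> M"
  shows "\<exists>H. G \<subseteq> H \<and> base F F' H \<and> x \<in> fst ` H"
proof -
  define e where "e z j = from_nat_into (cl z) j" for z and j :: nat
  have e_M: "e z j \<in> M" if "z \<in> M" for z j
    using from_nat_into[of "cl z" j] cl_self[OF that] cl_M[OF that] by (auto simp: e_def)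
  have e_surj: "\<exists>j. e z j = u" if "z \<in> M" "u \<in> cl z" for z u
    using from_nat_into_surj[OF cl_countable[OF that(1)] that(2)] by (simp add: e_def)
  \<comment> \<open>Bookkeeping: stage \<open>n\<close> requests the first \<open>n + 1\<close>
    listed elements of the closures of all points added so far, on either side, which are finitely
    many. Element \<open>j\<close> of the closure of a point present at stage \<open>m\<close> is
    therefore reached right after stage \<open>max m j\<close>.\<close>
  define X where "X p n H = (\<lambda>(z, j). e z j) ` (p ` (H - G) \<times> {..n})"
    for p :: "'m \<times> 'm \<Rightarrow> 'm" and n :: nat and H :: "('m \<times> 'm) set"
  define P where "P n H \<longleftrightarrow> G \<subseteq> H \<and> finite (H - G) \<and> H \<subseteq> M \<times> M \<and> elem_rel H" for n :: nat and H
  define Q where "Q n H K \<longleftrightarrow> H \<subseteq> K \<and> insert x (X fst n H) \<subseteq> fst ` K \<and> X snd n H \<subseteq> snd ` K"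
    for n H K
  have "\<exists>f. \<forall>n. P n (f n) \<and> Q n (f n) (f (Suc n))"
  proof (rule dependent_nat_choice)
    show "\<exists>H. P 0 H" using G by (intro exI[of _ G]) (simp add: P_def base_def)
    fix H n assume H: "P n H"
    have "p ` (H - G) \<subseteq> M" if "p = fst \<or> p = snd" for p using H that by (auto simp: P_def)
    then have "finite (X p n H)" "X p n H \<subseteq> M" if "p = fst \<or> p = snd" for p
      using H that e_M by (auto simp: X_def P_def)
    then have "finite (insert x (X fst n H))" "insert x (X fst n H) \<subseteq> M"
      "finite (X snd n H)" "X snd n H \<subseteq> M" using x by auto
    from base_back_forth[OF G _ _ _ _ this, of H] H obtain K where
      "H \<subseteq> K" "finite (K - G)" "K \<subseteq> M \<times> M" "elem_rel K" "insert x (X fst n H) \<subseteq> fst ` K"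
      "X snd n H \<subseteq> snd ` K"
      by (auto simp: P_def)
    then show "\<exists>K. P (Suc n) K \<and> Q n H K" using H by (intro exI[of _ K]) (auto simp: P_def Q_def)
  qed
  then obtain f where f: "\<And>n. P n (f n)" "\<And>n. Q n (f n) (f (Suc n))" by blast
  have mono: "f m \<subseteq> f n" if "m \<le> n" for m n
    by (rule lift_Suc_mono_le[of f, OF _ that]) (use f(2) in \<open>simp add: Q_def\<close>)
  define H where "H = (\<Union>n. f n)"
  have GH: "G \<subseteq> H" and HM: "H \<subseteq> M \<times> M" using f(1) by (auto simp: H_def P_def)
  have "elem_rel H"
  proof -
    have "subset.chain UNIV (range f)"
      unfolding subset_chain_def using mono by (metis UNIV_I image_iff nle_le subset_UNIV)
    then show ?thesis unfolding H_def by (rule elem_rel_Union[rotated]) (use f(1) in \<open>auto simp: P_def\<close>)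
  qed
  have cl_H: "cl z \<subseteq> p ` H" if p: "p = fst \<or> p = snd" and z: "z \<in> p ` (H - G)" for p z
  proof
    fix u assume u: "u \<in> cl z"
    obtain m where m: "z \<in> p ` (f m - G)" using z by (auto simp: H_def)
    have "z \<in> M" using z HM p by auto
    then obtain j where j: "e z j = u" using e_surj u by blast
    let ?n = "max m j"
    have "f m \<subseteq> f ?n" by (rule mono) simp
    then have "z \<in> p ` (f ?n - G)" using m by auto
    then have "u \<in> X p ?n (f ?n)" unfolding X_def using j by force
    moreover have "X p ?n (f ?n) \<subseteq> p ` f (Suc ?n)" using f(2)[of ?n] p by (auto simp: Q_def)
    moreover have "f (Suc ?n) \<subseteq> H" by (auto simp: H_def)
    ultimately show "u \<in> p ` H" by blast
  qed
  have "base F F' H"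
    unfolding base_def
  proof (intro conjI)
    show "finite F" "finite F'" using G by (simp_all add: base_def)
    obtain D where D: "cl_closed D" "fst ` G = D \<union> F" using G by (auto simp: base_def)
    show "\<exists>D. cl_closed D \<and> fst ` H = D \<union> F"
      by (rule closed_limit[OF D GH]) (use HM cl_H in auto)
    obtain D where D: "cl_closed D" "snd ` G = D \<union> F'" using G by (auto simp: base_def)
    show "\<exists>D. cl_closed D \<and> snd ` H = D \<union> F'"
      by (rule closed_limit[OF D GH]) (use HM cl_H in auto)
  qed (use HM \<open>elem_rel H\<close> in auto)
  moreover have "x \<in> fst ` H" using f(2)[of 0] by (auto simp: Q_def H_def)
  ultimately show ?thesis using GH by blast
qed

lemma base_Union:
  assumes ne: "\<C> \<noteq> {}" and chain: "subset.chain UNIV \<C>" and base: "\<And>G. G \<in> \<C> \<Longrightarrow> base F F' G"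
  shows "base F F' (\<Union>\<C>)"
proof -
  have lim: "\<exists>D. cl_closed D \<and> p ` \<Union>\<C> = D \<union> E"
    if "\<And>G. G \<in> \<C> \<Longrightarrow> \<exists>D. cl_closed D \<and> p ` G = D \<union> E" for p :: "'m \<times> 'm \<Rightarrow> 'm" and E
  proof -
    have "\<forall>G\<in>\<C>. \<exists>D. cl_closed D \<and> p ` G = D \<union> E" using that by simp
    from bchoice[OF this] obtain d where d: "\<And>G. G \<in> \<C> \<Longrightarrow> cl_closed (d G) \<and> p ` G = d G \<union> E"
      by auto
    have "p ` \<Union>\<C> = (\<Union>G\<in>\<C>. p ` G)" by blast
    also have "\<dots> = (\<Union>G\<in>\<C>. d G) \<union> E" using d ne by auto
    finally have "p ` \<Union>\<C> = (\<Union>G\<in>\<C>. d G) \<union> E" .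
    moreover have "cl_closed (\<Union>G\<in>\<C>. d G)"
      using d ne unfolding cl_closed_def by (intro conjI) blast+
    ultimately show ?thesis by blast
  qed
  have "elem_rel (\<Union>\<C>)"
    by (rule elem_rel_Union[OF ne chain]) (use base in \<open>simp add: base_def\<close>)
  moreover have "finite F" "finite F'" "\<Union>\<C> \<subseteq> M \<times> M" using base ne by (auto simp: base_def)
  moreover have "\<exists>D. cl_closed D \<and> fst ` \<Union>\<C> = D \<union> F"
    by (rule lim) (use base in \<open>simp add: base_def\<close>)
  moreover have "\<exists>D. cl_closed D \<and> snd ` \<Union>\<C> = D \<union> F'"
    by (rule lim) (use base in \<open>simp add: base_def\<close>)
  ultimately show ?thesis by (simp add: base_def)
qed

lemma extend_to_automorphism:
  assumes F: "finite F" "F \<subseteq> M" and g: "elem (A \<union> F) g" "\<And>a. a \<in> A \<Longrightarrow> g a = a" "g ` F \<subseteq> M"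
  shows "\<exists>h. bij_betw h M M \<and> elem M h \<and> (\<forall>x\<in>A \<union> F. h x = g x)"
proof -
  have MU: "M \<subseteq> U" by (rule tv_closed_subset[OF tv_M])
  have "cl_closed A" using A_M cl_A by (simp add: cl_closed_def)
  define G0 where "G0 = (\<lambda>z. (z, g z)) ` (A \<union> F)"
  have g_A: "g ` A = A" using g(2) by force
  have "base F (g ` F) G0"
    unfolding base_def
  proof (intro conjI)
    show "finite F" "finite (g ` F)" using F(1) by auto
    show "G0 \<subseteq> M \<times> M" using F(2) g(2,3) A_M by (auto simp: G0_def)
    show "elem_rel G0"
      unfolding G0_def by (rule elem_rel_graph[OF g(1)]) (use F(2) A_M MU in auto)
    have "fst ` G0 = A \<union> F" "snd ` G0 = g ` (A \<union> F)" by (simp_all add: G0_def image_image)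
    then have "fst ` G0 = A \<union> F" "snd ` G0 = A \<union> g ` F" using g_A by (simp_all add: image_Un)
    then show "\<exists>D. cl_closed D \<and> fst ` G0 = D \<union> F" "\<exists>D. cl_closed D \<and> snd ` G0 = D \<union> g ` F"
      using \<open>cl_closed A\<close> by auto
  qed
  \<comment> \<open>Zorn's lemma stands for a transfinite iteration of \<open>base_extend\<close>. A
    maximal map cannot be extended, nor can its converse, so it is total and onto.\<close>
  define \<A> where "\<A> = {G. G0 \<subseteq> G \<and> base F (g ` F) G}"
  have "\<exists>H\<in>\<A>. \<forall>X\<in>\<A>. H \<subseteq> X \<longrightarrow> X = H"
  proof (rule subset_Zorn_nonempty)
    show "\<A> \<noteq> {}" using \<open>base F (g ` F) G0\<close> by (auto simp: \<A>_def)
    fix \<C> assume \<C>: "\<C> \<noteq> {}" "subset.chain \<A> \<C>"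
    then have "\<C> \<subseteq> \<A>" "subset.chain UNIV \<C>" by (simp_all add: subset_chain_def)
    then show "\<Union>\<C> \<in> \<A>" using \<C>(1) base_Union[of \<C> F "g ` F"] by (auto simp: \<A>_def)
  qed
  then obtain H where H: "G0 \<subseteq> H" "base F (g ` F) H"
    and H_max: "\<And>X. H \<subseteq> X \<Longrightarrow> base F (g ` F) X \<Longrightarrow> X = H"
    by (auto simp: \<A>_def)
  have HM: "H \<subseteq> M \<times> M" "elem_rel H" using H(2) by (simp_all add: base_def)
  have "M \<subseteq> fst ` H"
  proof
    fix x assume "x \<in> M"
    from base_extend[OF H(2) this] H_max show "x \<in> fst ` H" by auto
  qed
  then have dom: "fst ` H = M" using HM(1) by auto
  have "M \<subseteq> snd ` H"
  proof
    fix y assume "y \<in> M"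
    from base_extend[OF base_converse[OF H(2)] this] obtain K where
      K: "H\<inverse> \<subseteq> K" "base (g ` F) F K" "y \<in> fst ` K" by auto
    have "H \<subseteq> K\<inverse>" using K(1) by auto
    then have "K\<inverse> = H" by (rule H_max[OF _ base_converse[OF K(2)]])
    then show "y \<in> snd ` H" using K(3) by force
  qed
  then have ran: "snd ` H = M" using HM(1) by auto
  obtain h where h: "elem M h" "H = (\<lambda>z. (z, h z)) ` M"
    using elem_rel_map[OF HM(2)] unfolding dom by auto
  have "h ` M = M" using ran unfolding h(2) by (simp add: image_image)
  then have "bij_betw h M M" using elem_inj[OF h(1)] by (simp add: bij_betw_def)
  moreover have "\<forall>x\<in>A \<union> F. h x = g x" using H(1) unfolding h(2) G0_def by auto
  ultimately show ?thesis using h(1) by blast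
qed

end

section \<open>Homogeneity of prime models in a monster model\<close>

context fo_structure
begin

lemma infinite_formulas: "infinite {\<phi>. wf_fm L \<phi>}"
proof -
  have "inj (\<lambda>n. All n Bot :: ('f, 'r) fm)" by (rule injI) simp
  then have "infinite (range (\<lambda>n. All n Bot :: ('f, 'r) fm))" by (rule range_inj_infinite)
  moreover have "range (\<lambda>n. All n Bot) \<subseteq> {\<phi>. wf_fm L \<phi>}" by auto
  ultimately show ?thesis using infinite_super by blast
qed

lemma monster_homogeneous:
  assumes "monster_model L T \<kappa> S"
  shows homogeneous
  unfolding homogeneous_def
proof (intro allI impI, elim conjE)
  fix F g assume F: "finite F" "F \<subseteq> U" "elem F g"
  have "|F| <o |{\<phi>. wf_fm L \<phi>}|" using F(1) infinite_formulas
    by (intro finite_ordLess_infinite) (simp_all add: card_of_well_order_on Field_card_of)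
  moreover have "|{\<phi>. wf_fm L \<phi>}| <o \<kappa>" "strongly_homogeneous L \<kappa> S"
    using assms by (simp_all add: monster_model_def)
  ultimately have "|F| <o \<kappa>" using ordLess_transitive by blast
  then show "\<exists>h. automorphism h \<and> (\<forall>x\<in>F. h x = g x)"
    using \<open>strongly_homogeneous L \<kappa> S\<close> F
    unfolding strongly_homogeneous_def elementary_map_iff_elem automorphism_def by blast
qed

lemma tv_closed_univ: "tv_closed U"
  unfolding tv_closed_def using dset_subset by blast

text \<open>Primeness is applied to submodels of the monster and the inclusion of \<open>A\<close>
  into them; this provides the embedding of \<open>M\<close> into its constructible
  submodel.\<close>

theorem prime_homogeneous:
  assumes T: "complete_theory L T" "monster_model L T \<kappa> S" and tt: "totally_transcendental L S"
    and prime: "prime_over L T S A M"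
    and F: "finite F" "F \<subseteq> M" and g: "elem (A \<union> F) g" "\<And>a. a \<in> A \<Longrightarrow> g a = a" "g ` F \<subseteq> M"
  shows "\<exists>h. bij_betw h M M \<and> elem M h \<and> (\<forall>x\<in>A \<union> F. h x = g x)"
proof -
  have M: "tv_closed M" and AM: "A \<subseteq> M"
    using prime tv_closed_if_elementary by (simp_all add: prime_over_def)
  have S: "is_structure L S" "\<forall>\<phi>\<in>T. holds S [] \<phi>" and TL: "T \<subseteq> formulas L 0"
    using T by (simp_all add: monster_model_def model_of_def complete_theory_def)
  have "\<exists>f. f ` M \<subseteq> N \<and> elem M f \<and> (\<forall>a\<in>A. f a = a)" if N: "tv_closed N" "A \<subseteq> N" for N
  proof -
    have "holds (S\<lparr>univ := N\<rparr>) [] \<phi>" if "\<phi> \<in> T" for \<phi>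
    proof -
      have "wf_fm L \<phi>" "fv_fm \<phi> = {}" using that TL by (auto simp: formulas_def)
      then show ?thesis using tv_closed_sat[OF N(1)] S(2) that by (simp add: holds_def)
    qed
    then have model: "model_of L T (S\<lparr>univ := N\<rparr>)"
      using tv_closed_structure[OF N(1) S(1)] by (simp add: model_of_def)
    have AU: "A \<subseteq> U" using AM tv_closed_subset[OF M] by simp
    have "elementary_map L (S\<lparr>univ := U\<rparr>) A (S\<lparr>univ := N\<rparr>) id"
      using tv_closed_elementary_map[OF tv_closed_univ N(1) AU] N(2) elem_id[OF AU] by simp
    then have "elementary_map L S A (S\<lparr>univ := N\<rparr>) id" by simp
    with model prime obtain f where "elementary_map L (S\<lparr>univ := M\<rparr>) M (S\<lparr>univ := N\<rparr>) f"
      "\<forall>a\<in>A. f a = id a"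
      unfolding prime_over_def by blast
    then show ?thesis using tv_closed_elementary_map[OF M N(1) order_refl] by auto
  qed
  then have "\<forall>N. tv_closed N \<longrightarrow> A \<subseteq> N \<longrightarrow> (\<exists>f. f ` M \<subseteq> N \<and> elem M f \<and> (\<forall>a\<in>A. f a = a))"
    by simp
  from prime_closure[OF tt monster_homogeneous[OF T(2)] M AM this]
  obtain cl where "closure_system L S M A cl" by blast
  then interpret closure_system L S M A cl .
  show ?thesis by (rule extend_to_automorphism[OF F g])
qed

end

section \<open>Automorphism groups of normal sets\<close>

text \<open>Homogeneity of \<open>M\<close> over \<open>A\<close> for finite sets, stated as
  \<open>extend\<close>, is the form in which primeness reaches the arguments about automorphism
  groups and cocycles.\<close>

locale homogeneous_submodel = fo_structure L S
  for L :: "('f, 'r) language" and S :: "('f, 'r, 'm) struct" +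
  fixes A M :: "'m set"
  assumes A_sub_M: "A \<subseteq> M" and M_sub_U: "M \<subseteq> U"
    and extend: "\<And>F g. finite F \<Longrightarrow> F \<subseteq> M \<Longrightarrow> elem (A \<union> F) g \<Longrightarrow> (\<And>a. a \<in> A \<Longrightarrow> g a = a) \<Longrightarrow> g ` F \<subseteq> M
      \<Longrightarrow> \<exists>h. bij_betw h M M \<and> elem M h \<and> (\<forall>x\<in>A \<union> F. h x = g x)"
begin

abbreviation Aut :: "'m set \<Rightarrow> ('m \<Rightarrow> 'm) set" where
  "Aut B \<equiv> carrier (AutGroup L S A B)"

abbreviation normal :: "'m set \<Rightarrow> bool" where
  "normal B \<equiv> normal_set L S A M B"

lemma Aut_iff: "\<sigma> \<in> Aut B \<longleftrightarrow>
    \<sigma> \<in> extensional B \<and> bij_betw \<sigma> B B \<and> elem B \<sigma> \<and> (\<forall>a\<in>A. \<sigma> a = a)"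
  by (auto simp: AutGroup_def Bij_def elementary_map_iff_elem)

lemma Aut_mult: "\<sigma> \<in> Aut B \<Longrightarrow> \<tau> \<in> Aut B \<Longrightarrow> \<sigma> \<otimes>\<^bsub>AutGroup L S A B\<^esub> \<tau> = compose B \<sigma> \<tau>"
  by (simp add: AutGroup_def BijGroup_def)

lemma normal_sub: "normal B \<Longrightarrow> A \<subseteq> B" "normal B \<Longrightarrow> B \<subseteq> M"
  by (simp_all add: normal_set_def)

lemma normal_univ: "normal M"
  using A_sub_M by (simp add: normal_set_def)

text \<open>An elementary map fixing \<open>A\<close> preserves types over \<open>A\<close>, and
  normality is applied from \<open>b\<close> to \<open>g b\<close> and back.\<close>

lemma normal_image_iff:
  assumes B: "normal B" and g: "elem (insert b A) g" "\<And>a. a \<in> A \<Longrightarrow> g a = a" and b: "b \<in> M" "g b \<in> M"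
  shows "g b \<in> B \<longleftrightarrow> b \<in> B"
proof -
  have "holds S ([g b] @ as) \<phi> = holds S ([b] @ as) \<phi>" if "(\<phi>, as) \<in> formulas_over L A 1" for \<phi> as
  proof -
    have as: "set as \<subseteq> A" "\<phi> \<in> formulas L (length (b # as))"
      using that by (simp_all add: formulas_over_def)
    then have "set (b # as) \<subseteq> insert b A" by auto
    from elem_iff[OF g(1) Fm_mono[OF Fm_holds[OF as(2)] this]]
    have "holds S (map g (b # as)) \<phi> = holds S (b # as) \<phi>" by simp
    moreover have "map g as = as" using as(1) g(2) by (simp add: map_idI subset_iff)
    ultimately show ?thesis by simp
  qed
  then have "tp L S A [g b] = tp L S A [b]" by (auto simp: tp_def)
  then show ?thesis using B b unfolding normal_set_def by metis
qed

lemma Aut_image: "\<sigma> \<in> Aut B \<Longrightarrow> b \<in> B \<Longrightarrow> \<sigma> b \<in> B"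
  by (auto simp: Aut_iff bij_betw_def)

lemma Aut_mult_closed:
  assumes AB: "A \<subseteq> B" and st: "\<sigma> \<in> Aut B" "\<tau> \<in> Aut B"
  shows "\<sigma> \<otimes>\<^bsub>AutGroup L S A B\<^esub> \<tau> \<in> Aut B"
proof -
  have B: "bij_betw \<sigma> B B" "bij_betw \<tau> B B" "elem B \<sigma>" "elem B \<tau>" using st by (simp_all add: Aut_iff)
  have "\<tau> ` B = B" using B(2) by (simp add: bij_betw_def)
  then have "elem B (\<lambda>x. \<sigma> (\<tau> x))" using elem_comp[OF B(4), of \<sigma>] B(3) by simp
  then have "elem B (compose B \<sigma> \<tau>)" by (rule elem_cong) (simp add: compose_def)
  moreover have "bij_betw (compose B \<sigma> \<tau>) B B" using B(2,1) by (rule bij_betw_compose)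
  moreover have "compose B \<sigma> \<tau> a = a" if "a \<in> A" for a
    using st that AB by (auto simp: Aut_iff compose_def)
  ultimately show ?thesis unfolding Aut_mult[OF st] by (simp add: Aut_iff)
qed

lemma restrict_Aut:
  assumes B: "normal B" and C: "normal C" "B \<subseteq> C" and \<sigma>: "\<sigma> \<in> Aut C"
  shows "restrict \<sigma> B \<in> Aut B"
proof -
  have \<sigma>': "bij_betw \<sigma> C C" "elem C \<sigma>" "\<And>a. a \<in> A \<Longrightarrow> \<sigma> a = a" using \<sigma> by (auto simp: Aut_iff)
  \<comment> \<open>The equivalence is stronger than invariance of \<open>B\<close>: the preimage
    under \<sigma> of a point of \<open>B\<close> also lies in \<open>B\<close>, which makes the
    restriction onto.\<close>
  have mem: "\<sigma> b \<in> B \<longleftrightarrow> b \<in> B" if "b \<in> C" for b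
  proof (rule normal_image_iff[OF B _ \<sigma>'(3)])
    show "elem (insert b A) \<sigma>" by (rule elem_mono[OF \<sigma>'(2)]) (use that normal_sub(1)[OF C(1)] in auto)
    show "b \<in> M" "\<sigma> b \<in> M" using that Aut_image[OF \<sigma> that] normal_sub(2)[OF C(1)] by auto
  qed
  have "\<sigma> ` B = B"
  proof
    show "\<sigma> ` B \<subseteq> B" using mem C(2) by auto
    show "B \<subseteq> \<sigma> ` B"
    proof
      fix b assume b: "b \<in> B"
      then obtain c where "c \<in> C" "b = \<sigma> c" using \<sigma>'(1) C(2) by (auto simp: bij_betw_def)
      then show "b \<in> \<sigma> ` B" using mem b by auto
    qed
  qed
  moreover have "inj_on \<sigma> B" using \<sigma>'(1) C(2) by (auto simp: bij_betw_def intro: inj_on_subset)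
  ultimately have "bij_betw (restrict \<sigma> B) B B" by (simp add: bij_betw_def)
  moreover have "elem B (restrict \<sigma> B)"
    by (rule elem_cong[OF elem_mono[OF \<sigma>'(2) C(2)]]) simp
  moreover have "\<forall>a\<in>A. restrict \<sigma> B a = a" using normal_sub(1)[OF B] \<sigma>'(3) by auto
  ultimately show ?thesis by (simp add: Aut_iff)
qed

lemma restrict_Aut_mult:
  assumes "normal B" "normal C" "B \<subseteq> C" "\<sigma> \<in> Aut C" "\<tau> \<in> Aut C"
  shows "restrict (\<sigma> \<otimes>\<^bsub>AutGroup L S A C\<^esub> \<tau>) B
    = restrict \<sigma> B \<otimes>\<^bsub>AutGroup L S A B\<^esub> restrict \<tau> B"
proof -
  have r: "restrict \<sigma> B \<in> Aut B" "restrict \<tau> B \<in> Aut B" using assms restrict_Aut by auto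
  have "\<tau> b \<in> B" if "b \<in> B" for b using Aut_image[OF r(2) that] that by simp
  then show ?thesis unfolding Aut_mult[OF assms(4,5)] Aut_mult[OF r]
    using assms(3) by (auto simp: compose_def fun_eq_iff)
qed

text \<open>The finite part of \<sigma> on \<open>F\<close> extends to an automorphism of
  \<open>M\<close> over \<open>A\<close>, and normality lets the latter be restricted to
  \<open>C\<close>. In other words, restriction from \<open>C\<close> to \<open>B\<close> has dense
  image for pointwise convergence.\<close>

lemma Aut_lift:
  assumes B: "normal B" and C: "normal C" "B \<subseteq> C" and \<sigma>: "\<sigma> \<in> Aut B" and F: "finite F" "F \<subseteq> B"
  shows "\<exists>\<sigma>'\<in>Aut C. \<forall>x\<in>F. \<sigma>' x = \<sigma> x"
proof -
  have \<sigma>': "elem B \<sigma>" "\<And>a. a \<in> A \<Longrightarrow> \<sigma> a = a" using \<sigma> by (auto simp: Aut_iff)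
  have "\<exists>h. bij_betw h M M \<and> elem M h \<and> (\<forall>x\<in>A \<union> F. h x = \<sigma> x)"
  proof (rule extend[OF F(1)])
    show "F \<subseteq> M" using F(2) normal_sub(2)[OF B] by simp
    show "elem (A \<union> F) \<sigma>" by (rule elem_mono[OF \<sigma>'(1)]) (use F(2) normal_sub(1)[OF B] in simp)
    show "\<sigma> ` F \<subseteq> M" using F(2) Aut_image[OF \<sigma>] normal_sub(2)[OF B] by auto
  qed (use \<sigma>' in auto)
  then obtain h where h: "bij_betw h M M" "elem M h" "\<forall>x\<in>A \<union> F. h x = \<sigma> x" by auto
  have "restrict h M \<in> Aut M"
    using h \<sigma>'(2) A_sub_M elem_cong[OF h(2), of "restrict h M"]
    by (auto simp: Aut_iff bij_betw_def inj_on_def)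
  then have "restrict (restrict h M) C \<in> Aut C"
    by (rule restrict_Aut[OF C(1) normal_univ normal_sub(2)[OF C(1)]])
  moreover have "\<forall>x\<in>F. restrict (restrict h M) C x = \<sigma> x"
    using h(3) F(2) C normal_sub(2)[OF C(1)] by auto
  ultimately show ?thesis by blast
qed

end

section \<open>Gluing automorphisms along a directed union\<close>

lemma directed_finite_subset:
  assumes "directed_on I (incl_order Bs)" "finite F" "F \<subseteq> (\<Union>i\<in>I. Bs i)"
  shows "\<exists>k\<in>I. F \<subseteq> Bs k"
  using assms(2,3)
proof (induction F rule: finite_induct)
  case empty
  then show ?case using assms(1) by (auto simp: directed_on_def)
next
  case (insert x F)
  then obtain i j where "i \<in> I" "F \<subseteq> Bs i" "j \<in> I" "x \<in> Bs j" by auto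
  moreover from this obtain k where "k \<in> I" "Bs i \<subseteq> Bs k" "Bs j \<subseteq> Bs k"
    using assms(1) unfolding directed_on_def incl_order_def by blast
  ultimately show ?case by (intro bexI[of _ k]) auto
qed

locale normal_system = homogeneous_submodel L S A M
  for L :: "('f, 'r) language" and S :: "('f, 'r, 'm) struct" and A M +
  fixes I :: "'i set" and Bs :: "'i \<Rightarrow> 'm set" and B :: "'m set"
  assumes normal_B: "normal B" and normal_Bs: "\<And>i. i \<in> I \<Longrightarrow> normal (Bs i)"
    and directed: "directed_on I (incl_order Bs)" and union: "(\<Union>i\<in>I. Bs i) = B"
begin

lemma Bs_sub: "i \<in> I \<Longrightarrow> Bs i \<subseteq> B"
  using union by auto

lemma finite_sub_Bs: "finite F \<Longrightarrow> F \<subseteq> B \<Longrightarrow> \<exists>k\<in>I. F \<subseteq> Bs k"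
  using directed_finite_subset[OF directed] union by simp

lemma upper: "i \<in> I \<Longrightarrow> j \<in> I \<Longrightarrow> \<exists>k\<in>I. Bs i \<subseteq> Bs k \<and> Bs j \<subseteq> Bs k"
  using directed unfolding directed_on_def incl_order_def by blast

abbreviation "Lim \<equiv> carrier (Aut_limit L S A I Bs)"

lemma Lim_iff: "x \<in> Lim \<longleftrightarrow> x \<in> (\<Pi>\<^sub>E i\<in>I. Aut (Bs i)) \<and>
    (\<forall>i\<in>I. \<forall>j\<in>I. Bs i \<subseteq> Bs j \<longrightarrow> restrict (x j) (Bs i) = x i)"
  by (simp add: Aut_limit_def inverse_limit_def incl_order_def)

definition glue :: "('i \<Rightarrow> 'm \<Rightarrow> 'm) \<Rightarrow> 'm \<Rightarrow> 'm" where
  "glue x = (\<lambda>b\<in>B. x (SOME i. i \<in> I \<and> b \<in> Bs i) b)"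

lemma glue_eq:
  assumes x: "x \<in> Lim" and i: "i \<in> I" "b \<in> Bs i"
  shows "glue x b = x i b"
proof -
  define j where "j = (SOME i. i \<in> I \<and> b \<in> Bs i)"
  have j: "j \<in> I \<and> b \<in> Bs j" unfolding j_def by (rule someI[of _ i]) (use i in simp)
  obtain k where k: "k \<in> I" "Bs i \<subseteq> Bs k" "Bs j \<subseteq> Bs k" using upper i(1) j by blast
  have "restrict (x k) (Bs i) = x i" "restrict (x k) (Bs j) = x j"
    using x k i(1) j by (simp_all add: Lim_iff)
  then have "x i b = x k b" "x j b = x k b" using i(2) j by (metis restrict_apply')+
  moreover have "b \<in> B" using Bs_sub i by auto
  ultimately show ?thesis by (simp add: glue_def j_def)
qed

lemma glue_restrict: "x \<in> Lim \<Longrightarrow> i \<in> I \<Longrightarrow> restrict (glue x) (Bs i) = x i"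
proof (rule extensionalityI)
  assume x: "x \<in> Lim" and i: "i \<in> I"
  then have "x i \<in> Aut (Bs i)" by (auto simp: Lim_iff)
  then show "x i \<in> extensional (Bs i)" by (simp add: Aut_iff)
  show "restrict (glue x) (Bs i) b = x i b" if "b \<in> Bs i" for b
    using glue_eq[OF x i that] that by simp
qed simp

text \<open>Injectivity and elementarity involve finitely many points at a time. These lie in a
  common \<open>Bs k\<close>, where \<open>glue x\<close> is the automorphism
  \<open>x k\<close>.\<close>

lemma glue_Aut:
  assumes x: "x \<in> Lim"
  shows "glue x \<in> Aut B"
proof -
  have xi: "x i \<in> Aut (Bs i)" if "i \<in> I" for i using x that by (auto simp: Lim_iff)
  have "inj_on (glue x) B"
  proof (rule inj_onI)
    fix b c assume bc: "b \<in> B" "c \<in> B" "glue x b = glue x c"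
    then obtain k where k: "k \<in> I" "b \<in> Bs k" "c \<in> Bs k" using finite_sub_Bs[of "{b, c}"] by auto
    then have "x k b = x k c" using bc(3) glue_eq[OF x k(1)] by simp
    moreover have "inj_on (x k) (Bs k)" using xi[OF k(1)] by (simp add: Aut_iff bij_betw_def)
    ultimately show "b = c" using k by (simp add: inj_on_eq_iff)
  qed
  moreover have "glue x ` B = B"
  proof (intro equalityI subsetI)
    fix c assume "c \<in> glue x ` B"
    then obtain b i where "i \<in> I" "b \<in> Bs i" "c = glue x b" using union by auto
    then show "c \<in> B" using glue_eq[OF x] Aut_image[OF xi] Bs_sub by fastforce
  next
    fix c assume "c \<in> B"
    then obtain i where i: "i \<in> I" "c \<in> Bs i" using union by auto
    then obtain b where b: "b \<in> Bs i" "c = x i b"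
      using xi[OF i(1)] by (auto simp: Aut_iff bij_betw_def)
    then have "c = glue x b" using glue_eq[OF x i(1)] by simp
    then show "c \<in> glue x ` B" using b(1) i(1) Bs_sub by blast
  qed
  moreover have "elem B (glue x)"
  proof (rule elem_finite)
    fix F assume "finite F" "F \<subseteq> B"
    then obtain k where k: "k \<in> I" "F \<subseteq> Bs k" using finite_sub_Bs by blast
    have "elem (Bs k) (x k)" using xi[OF k(1)] by (simp add: Aut_iff)
    then have "elem F (x k)" using k(2) by (rule elem_mono)
    then show "elem F (glue x)" by (rule elem_cong) (use glue_eq[OF x k(1)] k(2) in auto)
  qed
  moreover have "\<forall>a\<in>A. glue x a = a"
  proof
    fix a assume a: "a \<in> A"
    obtain k where k: "k \<in> I" using directed by (auto simp: directed_on_def)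
    then have "a \<in> Bs k" using normal_sub(1)[OF normal_Bs] a by blast
    then show "glue x a = a" using glue_eq[OF x k] xi[OF k] a by (simp add: Aut_iff)
  qed
  ultimately show ?thesis by (simp add: Aut_iff glue_def bij_betw_def)
qed

lemma glue_iso: "glue \<in> Group.iso (Aut_limit L S A I Bs) (AutGroup L S A B)"
  unfolding Group.iso_def
proof (intro CollectI conjI)
  show "glue \<in> hom (Aut_limit L S A I Bs) (AutGroup L S A B)"
  proof (rule homI)
    fix x y assume x: "x \<in> Lim" and y: "y \<in> Lim"
    have xy: "(x \<otimes>\<^bsub>Aut_limit L S A I Bs\<^esub> y) i = compose (Bs i) (x i) (y i)" if "i \<in> I" for i
    proof -
      have "x i \<in> Aut (Bs i)" "y i \<in> Aut (Bs i)" using x y that by (auto simp: Lim_iff)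
      then show ?thesis using that Aut_mult[of "x i" "Bs i" "y i"]
        by (simp add: Aut_limit_def inverse_limit_def)
    qed
    have "glue (x \<otimes>\<^bsub>Aut_limit L S A I Bs\<^esub> y) = compose B (glue x) (glue y)"
    proof
      fix b
      show "glue (x \<otimes>\<^bsub>Aut_limit L S A I Bs\<^esub> y) b = compose B (glue x) (glue y) b"
      proof (cases "b \<in> B")
        case True
        define i where "i = (SOME i. i \<in> I \<and> b \<in> Bs i)"
        have "\<exists>i. i \<in> I \<and> b \<in> Bs i" using True union by auto
        then have i: "i \<in> I" "b \<in> Bs i" unfolding i_def by (metis (mono_tags, lifting) someI_ex)+
        have yi: "y i \<in> Aut (Bs i)" using y i(1) by (auto simp: Lim_iff)
        have "glue (x \<otimes>\<^bsub>Aut_limit L S A I Bs\<^esub> y) b = (x \<otimes>\<^bsub>Aut_limit L S A I Bs\<^esub> y) i b"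
          using True by (simp add: glue_def i_def)
        also have "\<dots> = x i (y i b)" using xy[OF i(1)] i(2) by (simp add: compose_def)
        also have "\<dots> = glue x (glue y b)"
          using glue_eq[OF y i] glue_eq[OF x i(1) Aut_image[OF yi i(2)]] by simp
        finally show ?thesis using True by (simp add: compose_def)
      qed (simp add: glue_def compose_def)
    qed
    then show "glue (x \<otimes>\<^bsub>Aut_limit L S A I Bs\<^esub> y) = glue x \<otimes>\<^bsub>AutGroup L S A B\<^esub> glue y"
      using Aut_mult[OF glue_Aut[OF x] glue_Aut[OF y]] by simp
  qed (rule glue_Aut)
  show "bij_betw glue Lim (Aut B)"
    unfolding bij_betw_def
  proof
    show "inj_on glue Lim"
    proof (rule inj_onI)
      fix x y assume xy: "x \<in> Lim" "y \<in> Lim" "glue x = glue y"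
      have "x i = y i" if "i \<in> I" for i
        using glue_restrict[OF xy(1) that] glue_restrict[OF xy(2) that] xy(3) by simp
      moreover have "x \<in> extensional I" "y \<in> extensional I"
        using xy by (auto simp: Lim_iff PiE_def)
      ultimately show "x = y" by (intro extensionalityI[of x I y])
    qed
    show "glue ` Lim = Aut B"
    proof (intro equalityI subsetI)
      fix \<sigma> assume \<sigma>: "\<sigma> \<in> Aut B"
      define x where "x = (\<lambda>i\<in>I. restrict \<sigma> (Bs i))"
      have x: "x \<in> Lim"
        unfolding Lim_iff
        using restrict_Aut[OF normal_Bs normal_B Bs_sub \<sigma>]
        by (auto simp: x_def Int_absorb1 intro!: PiE_I)
      have "glue x = \<sigma>"
      proof (rule extensionalityI)
        show "glue x \<in> extensional B" "\<sigma> \<in> extensional B" using \<sigma> by (simp_all add: glue_def Aut_iff)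
        fix b assume "b \<in> B"
        then obtain i where "i \<in> I" "b \<in> Bs i" using union by auto
        then show "glue x b = \<sigma> b" using glue_eq[OF x] by (simp add: x_def)
      qed
      then show "\<sigma> \<in> glue ` Lim" using x by blast
    qed (use glue_Aut in auto)
  qed
qed

end

section \<open>Definable closure\<close>

context fo_structure
begin

text \<open>Each entry of the solution is defined over \<open>B\<close> by a projection: some tuple
  satisfies \<Phi> and has the given element as its \<open>i\<close>-th entry.\<close>

lemma unique_dcl:
  fixes z :: "'m list" and \<Phi> :: "(nat + 'm \<Rightarrow> 'm) \<Rightarrow> bool"
  assumes \<Phi>: "Fm (Inl ` {..<n} \<union> Inr ` B) \<Phi>" and z: "z \<in> tuples U n" "\<Phi> (case_sum ((!) z) id)"
    and unique: "\<And>z'. z' \<in> tuples U n \<Longrightarrow> \<Phi> (case_sum ((!) z') id) \<Longrightarrow> z' = z"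
  shows "set z \<subseteq> dcl L S B"
proof
  fix c assume "c \<in> set z"
  then obtain i where i: "i < n" "c = z ! i" using z(1) by (auto simp: in_set_conv_nth tuples_def)
  \<comment> \<open>\<Phi> uses the variable names below \<open>n\<close>, so \<open>Inl n\<close>
    is free to name the entry that is being defined.\<close>
  let ?V = "Inl ` {..<n} :: (nat + 'm) set" and ?x = "Inl n :: nat + 'm"
  let ?W = "\<lambda>h g v. if v \<in> ?V then h v else (g v :: 'm)"
  let ?g = "case_sum (\<lambda>_. c) id :: nat + 'm \<Rightarrow> 'm"
  have "Fm (?V \<union> insert ?x (Inr ` B)) (\<lambda>g. \<Phi> g \<and> g (Inl i) = g ?x)"
    by (rule Fm_conj[OF Fm_mono[OF \<Phi>] Fm_eq]) (use i in auto)
  from Fm_ex_finite[OF _ this]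
  have "Fm (insert ?x (Inr ` B)) (\<lambda>g. \<exists>h. h ` ?V \<subseteq> U \<and> \<Phi> (?W h g) \<and> ?W h g (Inl i) = ?W h g ?x)"
    by simp
  from dset_name[OF this, of ?g]
  have D: "{y \<in> U. \<exists>h. h ` ?V \<subseteq> U \<and> \<Phi> (?W h (?g(?x := y))) \<and>
      ?W h (?g(?x := y)) (Inl i) = ?W h (?g(?x := y)) ?x} \<in> dset B" (is "?Y \<in> _")
    by (simp add: image_image)
  have W: "\<Phi> (?W h (?g(?x := y))) = \<Phi> (case_sum ((!) z') id)"
    if "\<And>j. j < n \<Longrightarrow> h (Inl j) = z' ! j" for h y z'
    by (rule Fm_cong[OF \<Phi>]) (use that in auto)
  have "?Y = {c}"
  proof (intro equalityI subsetI)
    fix y assume "y \<in> ?Y"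
    then obtain h where h: "h ` ?V \<subseteq> U" "\<Phi> (?W h (?g(?x := y)))"
      and "?W h (?g(?x := y)) (Inl i) = ?W h (?g(?x := y)) ?x"
      by (elim CollectE conjE exE) (rule that)
    from this(3) have hi: "h (Inl i) = y" using i(1) by (auto split: if_splits)
    define z' where "z' = map (\<lambda>j. h (Inl j)) [0..<n]"
    have "z' \<in> tuples U n" using h(1) by (auto simp: z'_def tuples_def)
    moreover have "\<Phi> (case_sum ((!) z') id)" using h(2) W[of h z' y] by (simp add: z'_def)
    ultimately have "z' = z" by (rule unique)
    moreover have "z' ! i = y" using i(1) hi by (simp add: z'_def)
    ultimately show "y \<in> {c}" using i(2) by simp
  next
    fix y assume "y \<in> {c}"
    then have y: "y = c" by simp
    have zU: "z ! j \<in> U" if "j < n" for j using z(1) that by (auto simp: tuples_def)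
    let ?h = "case_sum ((!) z) id :: nat + 'm \<Rightarrow> 'm"
    have "?h ` ?V \<subseteq> U" using zU by auto
    moreover have "\<Phi> (?W ?h (?g(?x := y)))" using W[of ?h z y] z(2) by simp
    moreover have "?W ?h (?g(?x := y)) (Inl i) = ?W ?h (?g(?x := y)) ?x" using i y by auto
    moreover have "y \<in> U" using y i zU by simp
    ultimately show "y \<in> ?Y" by blast
  qed
  then have "definable_over L S B 1 {[c]}" using dset_imp_definable[OF D] by simp
  then show "c \<in> dcl L S B" by (simp add: dcl_def)
qed

lemma Fm_definable:
  fixes \<Phi> :: "(nat + 'm \<Rightarrow> 'm) \<Rightarrow> bool"
  assumes "Fm (Inl ` {..<n} \<union> Inr ` E) \<Phi>"
  shows "definable_over L S E n {z \<in> tuples U n. \<Phi> (case_sum ((!) z) id)}"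
proof -
  let ?xs = "map Inl [0..<n] :: (nat + 'm) list"
  have "Fm (set ?xs \<union> Inr ` E) \<Phi>" using assms by (simp add: lessThan_atLeast0)
  from Fm_imp_holds[OF this] obtain us \<phi> where us: "set us \<subseteq> Inr ` E"
    "\<phi> \<in> formulas L (length ?xs + length us)" "\<Phi> = (\<lambda>g. holds S (map g (?xs @ us)) \<phi>)"
    by (elim exE conjE) (rule that)
  define as where "as = map (case_sum (\<lambda>_. undefined) id) us"
  have "(\<phi>, as) \<in> formulas_over L E n" using us(1,2) by (auto simp: formulas_over_def as_def)
  moreover have "map (case_sum ((!) z) id) (?xs @ us) = z @ as" if "z \<in> tuples U n" for z
  proof -
    have "map (case_sum ((!) z) id) us = as" using us(1) by (auto simp: as_def)
    moreover have "map (case_sum ((!) z) id) ?xs = z"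
      using that by (auto simp: tuples_def map_nth o_def)
    ultimately show ?thesis by (simp only: map_append)
  qed
  then have "{z \<in> tuples U n. \<Phi> (case_sum ((!) z) id)} = {z \<in> tuples U n. holds S (z @ as) \<phi>}"
    unfolding us(3) by auto
  ultimately show ?thesis unfolding definable_over_def by blast
qed

text \<open>\<open>Inl i\<close> names the \<open>i\<close>-th variable and \<open>Inr b\<close> the parameter \<open>b\<close>.\<close>

lemma definable_preimage_Fm:
  fixes ns :: "(nat + 'm) list"
  assumes X: "definable_over L S A k X" and AB: "A \<subseteq> B" "B \<subseteq> U"
    and ns: "length ns = k" "set ns \<subseteq> Inl ` {..<n} \<union> Inr ` B"
  shows "\<exists>\<Phi>. Fm (Inl ` {..<n} \<union> Inr ` B) \<Phi> \<and>
    (\<forall>z\<in>tuples U n. \<Phi> (case_sum ((!) z) id) \<longleftrightarrow> map (case_sum ((!) z) id) ns \<in> X)"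
proof -
  obtain \<phi> as where as: "set as \<subseteq> A" "\<phi> \<in> formulas L (k + length as)"
    and X_eq: "X = {xs \<in> tuples U k. holds S (xs @ as) \<phi>}"
    using X unfolding definable_over_def formulas_over_def by blast
  let ?us = "ns @ map Inr as"
  let ?P = "\<lambda>v :: nat + 'm \<Rightarrow> 'm. holds S (map v ?us) \<phi>"
  have "Fm (set ?us) ?P" by (rule Fm_holds) (use as(2) ns(1) in simp)
  then have P: "Fm (Inl ` {..<n} \<union> Inr ` B) ?P"
    by (rule Fm_mono) (use ns(2) as(1) AB(1) in auto)
  have mem: "?P (case_sum ((!) z') id) \<longleftrightarrow> map (case_sum ((!) z') id) ns \<in> X"
    if "z' \<in> tuples U n" for z'
  proof -
    have "z' ! j \<in> U" if "j < n" for j using \<open>z' \<in> tuples U n\<close> that by (auto simp: tuples_def)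
    then have "map (case_sum ((!) z') id) ns \<in> tuples U k"
      using ns AB(2) by (force simp: tuples_def)
    moreover have "map (case_sum ((!) z') id) ?us = map (case_sum ((!) z') id) ns @ as" by (simp add: o_def)
    ultimately show ?thesis unfolding X_eq by simp
  qed
  then show ?thesis using P by (intro exI[of _ ?P]) simp
qed

text \<open>\<open>ns\<close> is a pattern with slots for unknowns and for parameters. In this form
  the values of definable operations become unique solutions, and \<open>dcl\<close>-closedness
  keeps them in \<open>B\<close>.\<close>

lemma definable_unique_dcl:
  fixes ns :: "(nat + 'm) list"
  assumes X: "definable_over L S A k X" and AB: "A \<subseteq> B" "B \<subseteq> U"
    and ns: "length ns = k" "set ns \<subseteq> Inl ` {..<n} \<union> Inr ` B"
    and z: "z \<in> tuples U n" "map (case_sum ((!) z) id) ns \<in> X"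
    and unique: "\<And>z'. z' \<in> tuples U n \<Longrightarrow> map (case_sum ((!) z') id) ns \<in> X \<Longrightarrow> z' = z"
  shows "set z \<subseteq> dcl L S B"
proof -
  obtain \<Phi> where \<Phi>: "Fm (Inl ` {..<n} \<union> Inr ` B) \<Phi>"
    "\<forall>z\<in>tuples U n. \<Phi> (case_sum ((!) z) id) \<longleftrightarrow> map (case_sum ((!) z) id) ns \<in> X"
    using definable_preimage_Fm[OF X AB ns] by (elim exE conjE) (rule that)
  show ?thesis
  proof (rule unique_dcl[OF \<Phi>(1) z(1)])
    show "\<Phi> (case_sum ((!) z) id)" using \<Phi>(2) z by simp
    fix z' assume z': "z' \<in> tuples U n" "\<Phi> (case_sum ((!) z') id)"
    then have "map (case_sum ((!) z') id) ns \<in> X" using \<Phi>(2) by simp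
    with z'(1) show "z' = z" by (rule unique)
  qed
qed

lemma map_case_sum_Inl: "z \<in> tuples U n \<Longrightarrow> map (case_sum ((!) z) id) (map Inl [0..<n]) = z"
  by (auto simp: tuples_def map_nth o_def)

lemma map_case_sum_Inr: "map (case_sum f id) (map Inr xs) = xs"
  by (simp add: o_def)

lemma definable_sub: "definable_over L S E k X \<Longrightarrow> X \<subseteq> tuples U k"
  unfolding definable_over_def by blast

lemma definable_image:
  assumes X: "definable_over L S A k X" and xs: "xs \<in> X" "set xs \<subseteq> B" and AB: "A \<subseteq> B"
    and \<sigma>: "elem B \<sigma>" "\<And>a. a \<in> A \<Longrightarrow> \<sigma> a = a"
  shows "map \<sigma> xs \<in> X"
proof -
  obtain \<phi> as where as: "set as \<subseteq> A" "\<phi> \<in> formulas L (k + length as)"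
    and X_eq: "X = {xs \<in> tuples U k. holds S (xs @ as) \<phi>}"
    using X unfolding definable_over_def formulas_over_def by blast
  have len: "length xs = k" using xs(1) X_eq by (simp add: tuples_def)
  have "Fm B (\<lambda>g. holds S (map g (xs @ as)) \<phi>)"
    by (rule Fm_mono[OF Fm_holds]) (use as xs AB len in auto)
  from elem_iff[OF \<sigma>(1) this] have "holds S (map \<sigma> (xs @ as)) \<phi>" using xs(1) X_eq by simp
  moreover have "map \<sigma> as = as" using as(1) \<sigma>(2) by (simp add: map_idI subset_iff)
  moreover have "map \<sigma> xs \<in> tuples U k" using xs(2) elem_image[OF \<sigma>(1)] len by (auto simp: tuples_def)
  ultimately show ?thesis by (simp add: X_eq)
qed

lemma dcl_closed_Union:
  assumes dir: "directed_on I (incl_order Bs)" and B: "(\<Union>i\<in>I. Bs i) = B" "B \<subseteq> U"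
    and dcl: "\<And>i. i \<in> I \<Longrightarrow> dcl_closed L S (Bs i)"
  shows "dcl_closed L S B"
  unfolding dcl_closed_def
proof
  show "dcl L S B \<subseteq> B"
  proof
    fix c assume "c \<in> dcl L S B"
    then obtain \<phi> as where as: "set as \<subseteq> B" "\<phi> \<in> formulas L (1 + length as)"
      "{[c]} = {xs \<in> tuples U 1. holds S (xs @ as) \<phi>}"
      unfolding dcl_def definable_over_def formulas_over_def by blast
    obtain k where k: "k \<in> I" "set as \<subseteq> Bs k"
      using directed_finite_subset[OF dir, of "set as"] as(1) B(1) by auto
    have "c \<in> dcl L S (Bs k)"
      unfolding dcl_def definable_over_def formulas_over_def using k(2) as(2,3) by blast
    then show "c \<in> B" using dcl[OF k(1)] k(1) B(1) by (auto simp: dcl_closed_def)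
  qed
  show "B \<subseteq> dcl L S B"
  proof
    fix c assume "c \<in> B"
    then show "c \<in> dcl L S B"
      using dset_imp_definable[OF dset_singleton[of c B]] B(2) by (auto simp: dcl_def)
  qed
qed

end

section \<open>Definable cocycles\<close>

locale definable_group_setting = homogeneous_submodel L S A M
  for L :: "('f, 'r) language" and S :: "('f, 'r, 'm) struct" and A M +
  fixes n :: nat and G :: "'m list monoid" (structure)
  assumes definable_G: "definable_group L S A n G"
begin

sublocale G: group G
  using definable_G by (simp add: definable_group_def)

abbreviation "mult_graph \<equiv> {x @ y @ (x \<otimes> y) | x y. x \<in> carrier G \<and> y \<in> carrier G}"

lemma definable_carrier: "definable_over L S A n (carrier G)"
  and definable_mult: "definable_over L S A (3 * n) mult_graph"
  using definable_G by (simp_all add: definable_group_def)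

lemma carrier_tuples: "x \<in> carrier G \<Longrightarrow> x \<in> tuples U n"
  using definable_sub[OF definable_carrier] by auto

lemma carrier_length: "x \<in> carrier G \<Longrightarrow> length x = n"
  using carrier_tuples by (auto simp: tuples_def)

lemma mult_graph_iff:
  assumes "length x = n" "length y = n"
  shows "x @ y @ z \<in> mult_graph \<longleftrightarrow> x \<in> carrier G \<and> y \<in> carrier G \<and> z = x \<otimes> y"
proof
  assume "x @ y @ z \<in> mult_graph"
  then obtain x' y' where xy: "x @ y @ z = x' @ y' @ (x' \<otimes> y')" "x' \<in> carrier G" "y' \<in> carrier G"
    by blast
  then have "x = x'" "y = y'" using assms carrier_length[of x'] carrier_length[of y'] by simp_all
  then show "x \<in> carrier G \<and> y \<in> carrier G \<and> z = x \<otimes> y" using xy by simp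
qed blast

definition dnormal :: "'m set \<Rightarrow> bool" where
  "dnormal B \<longleftrightarrow> normal B \<and> dcl_closed L S B"

lemma dnormalD: "dnormal B \<Longrightarrow> normal B" "dnormal B \<Longrightarrow> A \<subseteq> B" "dnormal B \<Longrightarrow> B \<subseteq> U"
  "dnormal B \<Longrightarrow> dcl L S B = B"
  using M_sub_U by (auto simp: dnormal_def dcl_closed_def normal_set_def)

lemma points_iff: "x \<in> points G B \<longleftrightarrow> x \<in> carrier G \<and> set x \<subseteq> B"
  by (simp add: points_def)

lemma points_mult:
  assumes B: "dnormal B" and x: "x \<in> points G B" and y: "y \<in> points G B"
  shows "x \<otimes> y \<in> points G B"
proof -
  let ?ns = "map Inr x @ map Inr y @ map Inl [0..<n] :: (nat + 'm) list"
  have xy: "x \<in> carrier G" "y \<in> carrier G" "set x \<subseteq> B" "set y \<subseteq> B" using x y by (auto simp: points_iff)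
  note len = carrier_length[OF xy(1)] carrier_length[OF xy(2)]
  have ns: "map (case_sum ((!) z) id) ?ns = x @ y @ z" if "z \<in> tuples U n" for z
    unfolding map_append map_case_sum_Inl[OF that] map_case_sum_Inr ..
  have "set (x \<otimes> y) \<subseteq> dcl L S B"
  proof (rule definable_unique_dcl[OF definable_mult dnormalD(2,3)[OF B]])
    show "length ?ns = 3 * n" "set ?ns \<subseteq> Inl ` {..<n} \<union> Inr ` B" using len xy by auto
    show z: "x \<otimes> y \<in> tuples U n" by (rule carrier_tuples) (use xy in simp)
    show "map (case_sum ((!) (x \<otimes> y)) id) ?ns \<in> mult_graph"
      unfolding ns[OF z] mult_graph_iff[OF len] using xy by simp
    fix z assume "z \<in> tuples U n" "map (case_sum ((!) z) id) ?ns \<in> mult_graph"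
    then show "z = x \<otimes> y" by (simp only: ns mult_graph_iff[OF len])
  qed
  then show ?thesis using xy dnormalD(4)[OF B] by (simp add: points_iff)
qed

text \<open>The identity is the only idempotent of the group, so it is the unique \<open>z\<close>
  with \<open>z @ z @ z\<close> in the multiplication graph.\<close>

lemma points_one:
  assumes B: "dnormal B"
  shows "\<one> \<in> points G B"
proof -
  let ?zs = "map Inl [0..<n] :: (nat + 'm) list"
  have ns: "map (case_sum ((!) z) id) (?zs @ ?zs @ ?zs) = z @ z @ z" if "z \<in> tuples U n" for z
    unfolding map_append map_case_sum_Inl[OF that] ..
  have "set \<one> \<subseteq> dcl L S B"
  proof (rule definable_unique_dcl[OF definable_mult dnormalD(2,3)[OF B]])
    show "length (?zs @ ?zs @ ?zs) = 3 * n" "set (?zs @ ?zs @ ?zs) \<subseteq> Inl ` {..<n} \<union> Inr ` B" by auto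
    show z: "\<one> \<in> tuples U n" by (rule carrier_tuples) simp
    have len: "length \<one> = n" by (rule carrier_length) simp
    show "map (case_sum ((!) \<one>) id) (?zs @ ?zs @ ?zs) \<in> mult_graph"
      unfolding ns[OF z] mult_graph_iff[OF len len] by simp
    fix z assume z: "z \<in> tuples U n" "map (case_sum ((!) z) id) (?zs @ ?zs @ ?zs) \<in> mult_graph"
    then have "length z = n" by (simp add: tuples_def)
    then have "z \<in> carrier G" "z = z \<otimes> z" using z by (simp_all only: ns mult_graph_iff)
    then show "z = \<one>" using G.l_cancel_one' by metis
  qed
  then show ?thesis using dnormalD(4)[OF B] by (simp add: points_iff)
qed

lemma points_inv:
  assumes B: "dnormal B" and x: "x \<in> points G B"
  shows "inv x \<in> points G B"
proof -
  let ?ns = "map Inr x @ map Inl [0..<n] @ map Inr \<one> :: (nat + 'm) list"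
  have xG: "x \<in> carrier G" "set x \<subseteq> B" using x by (auto simp: points_iff)
  have one: "set \<one> \<subseteq> B" "length \<one> = n"
    using points_one[OF B] carrier_length by (auto simp: points_iff)
  note len = carrier_length[OF xG(1)]
  have ns: "map (case_sum ((!) z) id) ?ns = x @ z @ \<one>" if "z \<in> tuples U n" for z
    unfolding map_append map_case_sum_Inl[OF that] map_case_sum_Inr ..
  have "set (inv x) \<subseteq> dcl L S B"
  proof (rule definable_unique_dcl[OF definable_mult dnormalD(2,3)[OF B]])
    show "length ?ns = 3 * n" "set ?ns \<subseteq> Inl ` {..<n} \<union> Inr ` B" using len xG one by auto
    show z: "inv x \<in> tuples U n" by (rule carrier_tuples) (use xG in simp)
    have len': "length (inv x) = n" by (rule carrier_length) (use xG in simp)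
    show "map (case_sum ((!) (inv x)) id) ?ns \<in> mult_graph"
      unfolding ns[OF z] mult_graph_iff[OF len len'] using xG by simp
    fix z assume z: "z \<in> tuples U n" "map (case_sum ((!) z) id) ?ns \<in> mult_graph"
    then have "length z = n" by (simp add: tuples_def)
    then have "z \<in> carrier G" "\<one> = x \<otimes> z" using z len by (simp_all only: ns mult_graph_iff)
    then show "z = inv x" using G.inv_equality[of z x] xG(1) G.inv_comm by metis
  qed
  then show ?thesis using xG dnormalD(4)[OF B] by (simp add: points_iff)
qed

lemma points_mono: "B \<subseteq> C \<Longrightarrow> points G B \<subseteq> points G C"
  unfolding points_def by blast

context
  fixes B \<sigma> assumes B: "dnormal B" and \<sigma>: "\<sigma> \<in> Aut B"
begin

lemma Aut_points:
  assumes x: "x \<in> points G B"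
  shows "map \<sigma> x \<in> points G B"
proof -
  have "map \<sigma> x \<in> carrier G"
    by (rule definable_image[OF definable_carrier _ _ dnormalD(2)[OF B]])
      (use x \<sigma> in \<open>auto simp: points_iff Aut_iff\<close>)
  then show ?thesis using x Aut_image[OF \<sigma>] by (auto simp: points_iff)
qed

lemma Aut_points_mult:
  assumes x: "x \<in> points G B" and y: "y \<in> points G B"
  shows "map \<sigma> (x \<otimes> y) = map \<sigma> x \<otimes> map \<sigma> y"
proof -
  have xy: "x \<in> carrier G" "y \<in> carrier G" "set x \<subseteq> B" "set y \<subseteq> B" using x y by (auto simp: points_iff)
  have "x @ y @ (x \<otimes> y) \<in> mult_graph" using xy by blast
  then have "map \<sigma> (x @ y @ (x \<otimes> y)) \<in> mult_graph"
    by (rule definable_image[OF definable_mult _ _ dnormalD(2)[OF B]])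
      (use xy points_mult[OF B x y] \<sigma> in \<open>auto simp: points_iff Aut_iff\<close>)
  moreover have "length (map \<sigma> x) = n" "length (map \<sigma> y) = n" using xy carrier_length by auto
  ultimately show ?thesis by (simp only: map_append mult_graph_iff)
qed

lemma Aut_points_one: "map \<sigma> \<one> = \<one>"
proof -
  have "map \<sigma> \<one> = map \<sigma> \<one> \<otimes> map \<sigma> \<one>"
    using Aut_points_mult[OF points_one[OF B] points_one[OF B]] by simp
  moreover have "map \<sigma> \<one> \<in> carrier G"
    using Aut_points[OF points_one[OF B]] by (simp add: points_iff)
  ultimately show ?thesis using G.l_cancel_one' by metis
qed

lemma Aut_points_inv:
  assumes x: "x \<in> points G B"
  shows "map \<sigma> (inv x) = inv (map \<sigma> x)"
proof -
  have ix: "inv x \<in> points G B" by (rule points_inv[OF B x])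
  have "map \<sigma> (inv x) \<otimes> map \<sigma> x = \<one>"
    using Aut_points_mult[OF ix x] Aut_points_one x by (simp add: points_iff)
  then show ?thesis
    using G.inv_equality Aut_points[OF x] Aut_points[OF ix] by (simp add: points_iff)
qed

end

section \<open>Cocycles, their classes and restriction\<close>

abbreviation "Z B \<equiv> definable_cocycles L S A n G B"
abbreviation "coh B \<equiv> cohomologous L S A n G B"

lemma Z_points: "\<phi> \<in> Z B \<Longrightarrow> \<sigma> \<in> Aut B \<Longrightarrow> \<phi> \<sigma> \<in> points G B"
  by (auto simp: definable_cocycles_def)

lemma Z_ext: "\<phi> \<in> Z B \<Longrightarrow> \<phi> \<in> extensional (Aut B)"
  by (auto simp: definable_cocycles_def PiE_def)

text \<open>A definable cocycle is locally constant: its value at \<sigma> depends only on \<sigma>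
  at the entries of \<open>b\<close>.\<close>

lemma Z_determined:
  assumes "\<phi> \<in> Z B"
  shows "\<exists>F\<subseteq>B. finite F \<and> (\<forall>\<sigma>\<in>Aut B. \<forall>\<tau>\<in>Aut B. (\<forall>x\<in>F. \<sigma> x = \<tau> x) \<longrightarrow> \<phi> \<sigma> = \<phi> \<tau>)"
proof -
  obtain b D h where b: "set b \<subseteq> B" "\<forall>\<sigma>\<in>Aut B. b @ map \<sigma> b \<in> D \<and> \<phi> \<sigma> = h (b @ map \<sigma> b)"
    using assms unfolding definable_cocycles_def by auto
  have *: "\<phi> \<sigma> = \<phi> \<tau>" if "\<sigma> \<in> Aut B" "\<tau> \<in> Aut B" "\<forall>x\<in>set b. \<sigma> x = \<tau> x" for \<sigma> \<tau>
  proof -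
    have "map \<sigma> b = map \<tau> b" using that(3) by simp
    then show ?thesis using b(2) that(1,2) by metis
  qed
  show ?thesis
  proof (intro exI conjI ballI impI)
    show "set b \<subseteq> B" "finite (set b)" using b(1) by simp_all
  qed (rule *)
qed

lemma cohI:
  assumes "\<phi> \<in> Z B" "\<psi> \<in> Z B" "g \<in> points G B"
    and "\<And>\<sigma>. \<sigma> \<in> Aut B \<Longrightarrow> \<phi> \<sigma> = inv g \<otimes> \<psi> \<sigma> \<otimes> map \<sigma> g"
  shows "(\<phi>, \<psi>) \<in> coh B"
  unfolding cohomologous_def
proof (intro CollectI case_prodI conjI bexI ballI)
  fix \<sigma> assume "\<sigma> \<in> Aut B"
  then show "\<phi> \<sigma> = inv g \<otimes> \<psi> \<sigma> \<otimes> map \<sigma> g" by (rule assms(4))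
qed (rule assms)+

lemma cohE:
  assumes "(\<phi>, \<psi>) \<in> coh B"
  obtains g where "\<phi> \<in> Z B" "\<psi> \<in> Z B" "g \<in> points G B"
    "\<forall>\<sigma>\<in>Aut B. \<phi> \<sigma> = inv g \<otimes> \<psi> \<sigma> \<otimes> map \<sigma> g"
  using assms unfolding cohomologous_def by blast

text \<open>The three witnesses are the identity, \<open>inv g\<close> and
  \<open>h \<otimes> g\<close>; that they are points over \<open>B\<close> comes from
  \<open>dcl\<close>-closedness.\<close>

lemma coh_equiv:
  assumes B: "dnormal B"
  shows "equiv (Z B) (coh B)"
proof (rule equivI)
  show "coh B \<subseteq> Z B \<times> Z B" by (auto simp: cohomologous_def)
  show "refl_on (Z B) (coh B)"
  proof (rule refl_onI)
    fix \<phi> assume \<phi>: "\<phi> \<in> Z B"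
    have *: "\<phi> \<sigma> = inv \<one> \<otimes> \<phi> \<sigma> \<otimes> map \<sigma> \<one>" if "\<sigma> \<in> Aut B" for \<sigma>
      using Aut_points_one[OF B that] Z_points[OF \<phi> that] by (simp add: points_iff)
    show "(\<phi>, \<phi>) \<in> coh B" by (rule cohI[OF \<phi> \<phi> points_one[OF B] *])
  qed
  show "sym (coh B)"
  proof (rule symI)
    fix \<phi> \<psi> assume "(\<phi>, \<psi>) \<in> coh B"
    then obtain g where *: "\<phi> \<in> Z B" "\<psi> \<in> Z B" and g: "g \<in> points G B"
      and eq: "\<forall>\<sigma>\<in>Aut B. \<phi> \<sigma> = inv g \<otimes> \<psi> \<sigma> \<otimes> map \<sigma> g"
      by (rule cohE)
    have **: "\<psi> \<sigma> = inv (inv g) \<otimes> \<phi> \<sigma> \<otimes> map \<sigma> (inv g)" if \<sigma>: "\<sigma> \<in> Aut B" for \<sigma>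
    proof -
      have c: "g \<in> carrier G" "map \<sigma> g \<in> carrier G" "\<psi> \<sigma> \<in> carrier G"
        using g Aut_points[OF B \<sigma> g] Z_points[OF *(2) \<sigma>] by (simp_all add: points_iff)
      have "g \<otimes> (inv g \<otimes> \<psi> \<sigma>) = \<psi> \<sigma>" using c by (simp add: G.m_assoc[symmetric])
      then show ?thesis using c eq[rule_format, OF \<sigma>] Aut_points_inv[OF B \<sigma> g]
        by (simp add: G.m_assoc)
    qed
    show "(\<psi>, \<phi>) \<in> coh B" by (rule cohI[OF *(2,1) points_inv[OF B g] **])
  qed
  show "trans (coh B)"
  proof (rule transI)
    fix \<phi> \<psi> \<chi> assume coh: "(\<phi>, \<psi>) \<in> coh B" "(\<psi>, \<chi>) \<in> coh B"
    from coh(1) obtain g where *: "\<phi> \<in> Z B" "\<psi> \<in> Z B" and g: "g \<in> points G B"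
      and eq: "\<forall>\<sigma>\<in>Aut B. \<phi> \<sigma> = inv g \<otimes> \<psi> \<sigma> \<otimes> map \<sigma> g"
      by (rule cohE)
    from coh(2) obtain h where **: "\<psi> \<in> Z B" "\<chi> \<in> Z B" and h: "h \<in> points G B"
      and eq': "\<forall>\<sigma>\<in>Aut B. \<psi> \<sigma> = inv h \<otimes> \<chi> \<sigma> \<otimes> map \<sigma> h"
      by (rule cohE)
    have ***: "\<phi> \<sigma> = inv (h \<otimes> g) \<otimes> \<chi> \<sigma> \<otimes> map \<sigma> (h \<otimes> g)" if \<sigma>: "\<sigma> \<in> Aut B" for \<sigma>
    proof -
      have c: "g \<in> carrier G" "map \<sigma> g \<in> carrier G" "h \<in> carrier G" "map \<sigma> h \<in> carrier G" "\<chi> \<sigma> \<in> carrier G"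
        using g h Aut_points[OF B \<sigma> g] Aut_points[OF B \<sigma> h] Z_points[OF **(2) \<sigma>]
        by (simp_all add: points_iff)
      show ?thesis using c eq[rule_format, OF \<sigma>] eq'[rule_format, OF \<sigma>] Aut_points_mult[OF B \<sigma> h g]
        by (simp add: G.m_assoc G.inv_mult_group)
    qed
    show "(\<phi>, \<chi>) \<in> coh B" by (rule cohI[OF *(1) **(2) points_mult[OF B h g] ***])
  qed
qed

text \<open>Here \<open>b\<close> is the empty tuple and \<open>h\<close> is constant, so the point
  is that the identity is definable over \<open>A\<close>: again it is the only idempotent.\<close>

lemma Z_trivial:
  assumes B: "dnormal B"
  shows "(\<lambda>\<sigma>\<in>Aut B. \<one>) \<in> Z B"
proof -
  let ?zs = "map Inl [0..<n] :: (nat + 'm) list" and ?ns = "map Inl ([0..<n] @ [0..<n] @ [0..<n]) :: (nat + 'm) list"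
  have AU: "A \<subseteq> U" using A_sub_M M_sub_U by simp
  have one: "\<one> \<in> tuples U n" by (rule carrier_tuples) simp
  have "length ?ns = 3 * n" "set ?ns \<subseteq> Inl ` {..<n} \<union> Inr ` A" by auto
  from definable_preimage_Fm[OF definable_mult order_refl AU this] obtain \<Phi> where
    \<Phi>: "Fm (Inl ` {..<n} \<union> Inr ` A) \<Phi>"
    "\<forall>z\<in>tuples U n. \<Phi> (case_sum ((!) z) id) \<longleftrightarrow> map (case_sum ((!) z) id) ?ns \<in> mult_graph"
    by (elim exE conjE) (rule that)
  have "\<Phi> (case_sum ((!) z) id) \<longleftrightarrow> z = \<one>" if z: "z \<in> tuples U n" for z
  proof -
    have "map (case_sum ((!) z) id) ?ns = z @ z @ z"
      unfolding map_append map_case_sum_Inl[OF z] ..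
    then have "\<Phi> (case_sum ((!) z) id) \<longleftrightarrow> z @ z @ z \<in> mult_graph" using \<Phi>(2) z by simp
    also have "\<dots> \<longleftrightarrow> z \<in> carrier G \<and> z = z \<otimes> z"
      using z mult_graph_iff[of z z z] by (simp add: tuples_def)
    also have "\<dots> \<longleftrightarrow> z = \<one>" using G.l_cancel_one'[of z z] by auto
    finally show ?thesis .
  qed
  then have "{z \<in> tuples U n. \<Phi> (case_sum ((!) z) id)} = {\<one>}" using one by auto
  with Fm_definable[OF \<Phi>(1)] have "definable_over L S A n {\<one>}" by simp
  then have "definable_function L S A (2 * length []) n {[]} (\<lambda>_. \<one>)"
    using one by (auto simp: definable_function_def tuples_def)
  then have "\<exists>b D h. set b \<subseteq> B \<and> definable_function L S A (2 * length b) n D h \<and>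
      (\<forall>\<sigma>\<in>Aut B. b @ map \<sigma> b \<in> D \<and> (\<lambda>\<sigma>\<in>Aut B. \<one>) \<sigma> = h (b @ map \<sigma> b))"
    by (intro exI[of _ "[]"] exI[of _ "{[]}"] exI[of _ "\<lambda>_. \<one>"]) simp
  then show ?thesis
    using points_one[OF B] Aut_points_one[OF B] Aut_mult_closed[OF dnormalD(2)[OF B]]
    by (simp add: definable_cocycles_def)
qed

text \<open>Inflation on cocycles; \<open>H1_trans\<close> is its effect on classes.\<close>

definition res :: "'m set \<Rightarrow> 'm set \<Rightarrow> (('m \<Rightarrow> 'm) \<Rightarrow> 'm list) \<Rightarrow> ('m \<Rightarrow> 'm) \<Rightarrow> 'm list" where
  "res B C \<phi> = (\<lambda>\<sigma>\<in>Aut C. \<phi> (restrict \<sigma> B))"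

lemma res_Z:
  assumes B: "dnormal B" and C: "dnormal C" and BC: "B \<subseteq> C" and \<phi>: "\<phi> \<in> Z B"
  shows "res B C \<phi> \<in> Z C"
proof -
  note r = restrict_Aut[OF dnormalD(1)[OF B] dnormalD(1)[OF C] BC]
  have map: "map (restrict \<sigma> B) xs = map \<sigma> xs" if "set xs \<subseteq> B" for \<sigma> :: "'m \<Rightarrow> 'm" and xs
    using that by (auto simp: subset_iff)
  obtain b D h where b: "set b \<subseteq> B" "definable_function L S A (2 * length b) n D h"
    "\<forall>\<sigma>\<in>Aut B. b @ map \<sigma> b \<in> D \<and> \<phi> \<sigma> = h (b @ map \<sigma> b)"
    and coc: "\<forall>\<sigma>\<in>Aut B. \<forall>\<tau>\<in>Aut B. \<phi> (\<sigma> \<otimes>\<^bsub>AutGroup L S A B\<^esub> \<tau>) = \<phi> \<sigma> \<otimes> map \<sigma> (\<phi> \<tau>)"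
    using \<phi> unfolding definable_cocycles_def by auto
  show ?thesis
    unfolding definable_cocycles_def
  proof (intro CollectI conjI ballI)
    show "res B C \<phi> \<in> Aut C \<rightarrow>\<^sub>E points G C"
      using Z_points[OF \<phi> r] points_mono[OF BC] by (auto simp: res_def)
    show "\<exists>b D h. set b \<subseteq> C \<and> definable_function L S A (2 * length b) n D h \<and>
        (\<forall>\<sigma>\<in>Aut C. b @ map \<sigma> b \<in> D \<and> res B C \<phi> \<sigma> = h (b @ map \<sigma> b))"
    proof (intro exI conjI ballI)
      show "set b \<subseteq> C" using b(1) BC by simp
      show "definable_function L S A (2 * length b) n D h" by fact
      fix \<sigma> assume \<sigma>: "\<sigma> \<in> Aut C"
      have "b @ map \<sigma> b \<in> D \<and> \<phi> (restrict \<sigma> B) = h (b @ map \<sigma> b)"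
        using b(3)[rule_format, OF r[OF \<sigma>]] unfolding map[OF b(1)] .
      then show "b @ map \<sigma> b \<in> D" "res B C \<phi> \<sigma> = h (b @ map \<sigma> b)"
        using \<sigma> by (simp_all add: res_def)
    qed
    fix \<sigma> \<tau> assume \<sigma>: "\<sigma> \<in> Aut C" and \<tau>: "\<tau> \<in> Aut C"
    have \<sigma>\<tau>: "\<sigma> \<otimes>\<^bsub>AutGroup L S A C\<^esub> \<tau> \<in> Aut C" using \<sigma> \<tau> by (rule Aut_mult_closed[OF dnormalD(2)[OF C]])
    have "res B C \<phi> (\<sigma> \<otimes>\<^bsub>AutGroup L S A C\<^esub> \<tau>)
        = \<phi> (restrict \<sigma> B \<otimes>\<^bsub>AutGroup L S A B\<^esub> restrict \<tau> B)"
      using \<sigma>\<tau> restrict_Aut_mult[OF dnormalD(1)[OF B] dnormalD(1)[OF C] BC \<sigma> \<tau>] by (simp add: res_def)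
    also have "\<dots> = \<phi> (restrict \<sigma> B) \<otimes> map (restrict \<sigma> B) (\<phi> (restrict \<tau> B))"
      using coc r[OF \<sigma>] r[OF \<tau>] by simp
    also have "\<dots> = res B C \<phi> \<sigma> \<otimes> map \<sigma> (res B C \<phi> \<tau>)"
    proof -
      have "set (\<phi> (restrict \<tau> B)) \<subseteq> B" using Z_points[OF \<phi> r[OF \<tau>]] by (simp add: points_iff)
      from map[OF this] show ?thesis using \<sigma> \<tau> by (simp add: res_def del: map_eq_conv)
    qed
    finally show "res B C \<phi> (\<sigma> \<otimes>\<^bsub>AutGroup L S A C\<^esub> \<tau>)
        = res B C \<phi> \<sigma> \<otimes> map \<sigma> (res B C \<phi> \<tau>)" .
  qed
qed

lemma res_coh:
  assumes B: "dnormal B" and C: "dnormal C" and BC: "B \<subseteq> C" and c: "(\<phi>, \<psi>) \<in> coh B"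
  shows "(res B C \<phi>, res B C \<psi>) \<in> coh C"
proof -
  obtain g where Z: "\<phi> \<in> Z B" "\<psi> \<in> Z B" and g: "g \<in> points G B"
    and eq: "\<forall>\<sigma>\<in>Aut B. \<phi> \<sigma> = inv g \<otimes> \<psi> \<sigma> \<otimes> map \<sigma> g"
    using c by (rule cohE)
  show ?thesis
  proof (rule cohI)
    show "res B C \<phi> \<in> Z C" "res B C \<psi> \<in> Z C" using res_Z[OF B C BC] Z by auto
    show "g \<in> points G C" using g points_mono[OF BC] by blast
    fix \<sigma> assume \<sigma>: "\<sigma> \<in> Aut C"
    have r: "restrict \<sigma> B \<in> Aut B" by (rule restrict_Aut[OF dnormalD(1)[OF B] dnormalD(1)[OF C] BC \<sigma>])
    have "map (restrict \<sigma> B) g = map \<sigma> g" using g by (auto simp: points_iff)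
    then show "res B C \<phi> \<sigma> = inv g \<otimes> res B C \<psi> \<sigma> \<otimes> map \<sigma> g"
      using eq[rule_format, OF r] \<sigma> by (simp add: res_def del: map_eq_conv)
  qed
qed

lemma res_res:
  assumes C: "dnormal C" and D: "dnormal D" and BC: "B \<subseteq> C" "C \<subseteq> D"
  shows "res C D (res B C \<phi>) = res B D \<phi>"
  using restrict_Aut[OF dnormalD(1)[OF C] dnormalD(1)[OF D] BC(2)] BC
  by (auto simp: res_def Int_absorb1 intro!: restrict_ext)

abbreviation "H1 B \<equiv> H1_def L S A n G B"
abbreviation "tr B C \<equiv> H1_trans L S A n G B C"

lemma H1E:
  assumes "x \<in> H1 B"
  obtains \<phi> where "\<phi> \<in> Z B" "x = coh B `` {\<phi>}"
  using assms unfolding H1_def_def by (rule quotientE)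

lemma H1I: "\<phi> \<in> Z B \<Longrightarrow> coh B `` {\<phi>} \<in> H1 B"
  unfolding H1_def_def by (rule quotientI)

text \<open>\<open>H1_trans\<close> takes the union of the classes of all inflated members; since
  inflation respects cohomology these classes coincide, and one representative suffices.\<close>

lemma tr_class:
  assumes B: "dnormal B" and C: "dnormal C" and BC: "B \<subseteq> C" and \<phi>: "\<phi> \<in> Z B"
  shows "tr B C (coh B `` {\<phi>}) = coh C `` {res B C \<phi>}"
proof -
  have eqB: "equiv (Z B) (coh B)" and eqC: "equiv (Z C) (coh C)" using B C coh_equiv by auto
  have "tr B C (coh B `` {\<phi>}) = (\<Union>\<psi>\<in>coh B `` {\<phi>}. coh C `` {res B C \<psi>})"
    unfolding H1_trans_def res_def by blast
  also have "\<dots> = (\<Union>\<psi>\<in>coh B `` {\<phi>}. coh C `` {res B C \<phi>})"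
  proof (rule SUP_cong[OF refl])
    fix \<psi> assume "\<psi> \<in> coh B `` {\<phi>}"
    then have "(\<phi>, \<psi>) \<in> coh B" by simp
    from res_coh[OF B C BC this] show "coh C `` {res B C \<psi>} = coh C `` {res B C \<phi>}"
      using equiv_class_eq[OF eqC] by metis
  qed
  also have "\<dots> = coh C `` {res B C \<phi>}" using equiv_class_self[OF eqB \<phi>] by auto
  finally show ?thesis .
qed

lemma tr_H1:
  assumes "dnormal B" "dnormal C" "B \<subseteq> C" "x \<in> H1 B"
  shows "tr B C x \<in> H1 C"
proof -
  obtain \<phi> where "\<phi> \<in> Z B" "x = coh B `` {\<phi>}" using assms(4) by (rule H1E)
  then show ?thesis using tr_class[OF assms(1-3)] H1I[OF res_Z[OF assms(1-3)]] by simp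
qed

lemma tr_tr:
  assumes B: "dnormal B" and C: "dnormal C" and D: "dnormal D" and sub: "B \<subseteq> C" "C \<subseteq> D"
    and x: "x \<in> H1 B"
  shows "tr C D (tr B C x) = tr B D x"
proof -
  obtain \<phi> where \<phi>: "\<phi> \<in> Z B" "x = coh B `` {\<phi>}" using x by (rule H1E)
  have "B \<subseteq> D" using sub by simp
  then show ?thesis
    unfolding \<phi>(2) tr_class[OF B C sub(1) \<phi>(1)] tr_class[OF C D sub(2) res_Z[OF B C sub(1) \<phi>(1)]]
    using tr_class[OF B D _ \<phi>(1)] res_res[OF C D sub] by simp
qed

abbreviation "pt B \<equiv> H1_base L S A n G B"

lemma pt_H1: "dnormal B \<Longrightarrow> pt B \<in> H1 B"
  unfolding H1_base_def by (rule H1I[OF Z_trivial])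

lemma tr_pt:
  assumes "dnormal B" "dnormal C" "B \<subseteq> C"
  shows "tr B C (pt B) = pt C"
proof -
  have "res B C (\<lambda>\<sigma>\<in>Aut B. \<one>) = (\<lambda>\<sigma>\<in>Aut C. \<one>)"
    using restrict_Aut[OF dnormalD(1)[OF assms(1)] dnormalD(1)[OF assms(2)] assms(3)]
    by (auto simp: res_def intro!: restrict_ext)
  then show ?thesis unfolding H1_base_def using tr_class[OF assms Z_trivial[OF assms(1)]] by simp
qed

text \<open>Only finitely many values of an automorphism enter into each instance of the cocycle identity
  or of a cohomology relation, so these identities may be checked on lifted automorphisms.\<close>

lemma coh_descend:
  assumes B: "dnormal B" and C: "dnormal C" and BC: "B \<subseteq> C" and \<phi>: "\<phi> \<in> Z B" and \<psi>: "\<psi> \<in> Z B"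
    and g: "g \<in> points G B"
    and eq: "\<forall>\<sigma>\<in>Aut C. res B C \<phi> \<sigma> = inv g \<otimes> res B C \<psi> \<sigma> \<otimes> map \<sigma> g"
  shows "(\<phi>, \<psi>) \<in> coh B"
proof (rule cohI[OF \<phi> \<psi> g])
  fix \<sigma> assume \<sigma>: "\<sigma> \<in> Aut B"
  obtain F1 where F1: "F1 \<subseteq> B" "finite F1"
    "\<forall>\<sigma>\<in>Aut B. \<forall>\<tau>\<in>Aut B. (\<forall>x\<in>F1. \<sigma> x = \<tau> x) \<longrightarrow> \<phi> \<sigma> = \<phi> \<tau>"
    using Z_determined[OF \<phi>] by auto
  obtain F2 where F2: "F2 \<subseteq> B" "finite F2"
    "\<forall>\<sigma>\<in>Aut B. \<forall>\<tau>\<in>Aut B. (\<forall>x\<in>F2. \<sigma> x = \<tau> x) \<longrightarrow> \<psi> \<sigma> = \<psi> \<tau>"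
    using Z_determined[OF \<psi>] by auto
  have "finite (F1 \<union> F2 \<union> set g)" "F1 \<union> F2 \<union> set g \<subseteq> B" using F1 F2 g by (auto simp: points_iff)
  from Aut_lift[OF dnormalD(1)[OF B] dnormalD(1)[OF C] BC \<sigma> this]
  obtain \<tau> where \<tau>: "\<tau> \<in> Aut C" "\<forall>x\<in>F1 \<union> F2 \<union> set g. \<tau> x = \<sigma> x" by auto
  have r: "restrict \<tau> B \<in> Aut B" by (rule restrict_Aut[OF dnormalD(1)[OF B] dnormalD(1)[OF C] BC \<tau>(1)])
  have "\<phi> (restrict \<tau> B) = \<phi> \<sigma>" by (rule F1(3)[rule_format, OF r \<sigma>]) (use F1(1) \<tau>(2) in auto)
  moreover have "\<psi> (restrict \<tau> B) = \<psi> \<sigma>" by (rule F2(3)[rule_format, OF r \<sigma>]) (use F2(1) \<tau>(2) in auto)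
  moreover have "map \<tau> g = map \<sigma> g" using \<tau>(2) by simp
  ultimately show "\<phi> \<sigma> = inv g \<otimes> \<psi> \<sigma> \<otimes> map \<sigma> g"
    using eq[rule_format, OF \<tau>(1)] \<tau>(1) by (simp add: res_def del: map_eq_conv)
qed

lemma cocycle_descend:
  assumes B: "dnormal B" and C: "dnormal C" and BC: "B \<subseteq> C" and \<phi>: "\<phi> \<in> Z C"
    and b: "set b \<subseteq> B" and h: "definable_function L S A (2 * length b) n D h"
    and \<phi>_h: "\<forall>\<sigma>\<in>Aut C. b @ map \<sigma> b \<in> D \<and> \<phi> \<sigma> = h (b @ map \<sigma> b)"
  shows "\<exists>\<psi>\<in>Z B. res B C \<psi> = \<phi>"
proof
  note lift = Aut_lift[OF dnormalD(1)[OF B] dnormalD(1)[OF C] BC]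
  define \<psi> where "\<psi> = (\<lambda>\<sigma>\<in>Aut B. h (b @ map \<sigma> b))"
  \<comment> \<open>That \<open>h\<close> is defined at this tuple is known for automorphisms of
    \<open>C\<close> only; a lift that agrees with \<sigma> on \<open>b\<close> produces the same
    tuple.\<close>
  have D: "b @ map \<sigma> b \<in> D" "h (b @ map \<sigma> b) \<in> carrier G" if \<sigma>: "\<sigma> \<in> Aut B" for \<sigma>
  proof -
    obtain \<tau> where \<tau>: "\<tau> \<in> Aut C" "\<forall>x\<in>set b. \<tau> x = \<sigma> x" using lift[OF \<sigma> _ b] by auto
    then have "map \<tau> b = map \<sigma> b" by simp
    then have "b @ map \<sigma> b \<in> D" "\<phi> \<tau> = h (b @ map \<sigma> b)" using \<phi>_h[rule_format, OF \<tau>(1)]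
      by (simp_all del: map_eq_conv)
    then show "b @ map \<sigma> b \<in> D" "h (b @ map \<sigma> b) \<in> carrier G"
      using Z_points[OF \<phi> \<tau>(1)] by (simp_all add: points_iff)
  qed
  have def: "definable_over L S A (2 * length b + n) {xs @ h xs | xs. xs \<in> D}"
    and DU: "D \<subseteq> tuples U (2 * length b)" and hU: "h \<in> D \<rightarrow> tuples U n"
    using h by (simp_all add: definable_function_def)
  \<comment> \<open>The value is the unique solution of a formula over \<open>B\<close>, so it does
    not leave \<open>B\<close> although \<phi> takes values over \<open>C\<close>.\<close>
  have points: "h (b @ map \<sigma> b) \<in> points G B" if \<sigma>: "\<sigma> \<in> Aut B" for \<sigma>
  proof -
    let ?d = "b @ map \<sigma> b"
    let ?ns = "map Inr ?d @ map Inl [0..<n] :: (nat + 'm) list"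
    have ns: "map (case_sum ((!) z) id) ?ns = ?d @ z" if "z \<in> tuples U n" for z
      unfolding map_append[of _ "map Inr ?d"] map_case_sum_Inl[OF that] map_case_sum_Inr ..
    have "set (h ?d) \<subseteq> dcl L S B"
    proof (rule definable_unique_dcl[OF def dnormalD(2,3)[OF B]])
      show "length ?ns = 2 * length b + n" by simp
      have "set ?d \<subseteq> B" using b Aut_image[OF \<sigma>] by auto
      then show "set ?ns \<subseteq> Inl ` {..<n} \<union> Inr ` B" by auto
      show z: "h ?d \<in> tuples U n" using hU D(1)[OF \<sigma>] by blast
      show "map (case_sum ((!) (h ?d)) id) ?ns \<in> {xs @ h xs | xs. xs \<in> D}"
        unfolding ns[OF z] using D(1)[OF \<sigma>] by blast
      fix z assume z: "z \<in> tuples U n" "map (case_sum ((!) z) id) ?ns \<in> {xs @ h xs | xs. xs \<in> D}"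
      then obtain xs where xs: "xs \<in> D" "?d @ z = xs @ h xs" unfolding ns[OF z(1)] by auto
      have "length xs = length ?d" using xs(1) DU by (auto simp: tuples_def)
      with xs(2) show "z = h ?d" by (metis append_eq_append_conv)
    qed
    then show ?thesis using D(2)[OF \<sigma>] dnormalD(4)[OF B] by (simp add: points_iff)
  qed
  show "\<psi> \<in> Z B"
    unfolding definable_cocycles_def
  proof (intro CollectI conjI ballI)
    show "\<psi> \<in> Aut B \<rightarrow>\<^sub>E points G B" using points by (simp add: \<psi>_def)
    show "\<exists>b D h. set b \<subseteq> B \<and> definable_function L S A (2 * length b) n D h \<and>
        (\<forall>\<sigma>\<in>Aut B. b @ map \<sigma> b \<in> D \<and> \<psi> \<sigma> = h (b @ map \<sigma> b))"
    proof (intro exI conjI ballI)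
      show "set b \<subseteq> B" "definable_function L S A (2 * length b) n D h" by fact+
      fix \<sigma> assume \<sigma>: "\<sigma> \<in> Aut B"
      show "b @ map \<sigma> b \<in> D" by (rule D(1)[OF \<sigma>])
      show "\<psi> \<sigma> = h (b @ map \<sigma> b)" using \<sigma> by (simp add: \<psi>_def)
    qed
    fix \<sigma> \<tau> assume \<sigma>: "\<sigma> \<in> Aut B" and \<tau>: "\<tau> \<in> Aut B"
    note \<sigma>\<tau> = Aut_mult_closed[OF dnormalD(2)[OF B] \<sigma> \<tau>]
    let ?v = "h (b @ map \<tau> b)"
    have v: "set ?v \<subseteq> B" "set (map \<tau> b) \<subseteq> B"
      using points[OF \<tau>] b Aut_image[OF \<tau>] by (auto simp: points_iff)
    obtain \<tau>' where \<tau>': "\<tau>' \<in> Aut C" "\<forall>x\<in>set b. \<tau>' x = \<tau> x" using lift[OF \<tau> _ b] by auto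
    \<comment> \<open>\<sigma>' has to imitate \<sigma> in three places: on \<open>b\<close> for the
      value at \<sigma>, on \<open>map \<tau> b\<close> for the value at the product, and on the
      entries of \<open>?v\<close> for the action on the value at \<tau>.\<close>
    have "finite (set b \<union> set (map \<tau> b) \<union> set ?v)" "set b \<union> set (map \<tau> b) \<union> set ?v \<subseteq> B"
      using b v by auto
    from lift[OF \<sigma> this] obtain \<sigma>' where \<sigma>': "\<sigma>' \<in> Aut C"
      "\<forall>x\<in>set b \<union> set (map \<tau> b) \<union> set ?v. \<sigma>' x = \<sigma> x" by auto
    have bC: "set b \<subseteq> C" using b BC by simp
    have \<tau>'b: "map \<tau>' b = map \<tau> b" and \<sigma>'b: "map \<sigma>' b = map \<sigma> b" and \<sigma>'v: "map \<sigma>' ?v = map \<sigma> ?v"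
      using \<tau>'(2) \<sigma>'(2) by simp_all
    have comp: "map (\<sigma>' \<otimes>\<^bsub>AutGroup L S A C\<^esub> \<tau>') b = map (\<sigma> \<otimes>\<^bsub>AutGroup L S A B\<^esub> \<tau>) b"
      unfolding Aut_mult[OF \<sigma> \<tau>] Aut_mult[OF \<sigma>'(1) \<tau>'(1)]
      using b bC \<tau>'(2) \<sigma>'(2) by (auto simp: compose_def)
    have "\<psi> (\<sigma> \<otimes>\<^bsub>AutGroup L S A B\<^esub> \<tau>) = \<phi> (\<sigma>' \<otimes>\<^bsub>AutGroup L S A C\<^esub> \<tau>')"
      using \<phi>_h[rule_format, OF Aut_mult_closed[OF dnormalD(2)[OF C] \<sigma>'(1) \<tau>'(1)]] \<sigma>\<tau> comp
      by (simp add: \<psi>_def)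
    also have "\<dots> = \<phi> \<sigma>' \<otimes> map \<sigma>' (\<phi> \<tau>')"
      using \<phi> \<sigma>'(1) \<tau>'(1) unfolding definable_cocycles_def by blast
    also have "\<phi> \<tau>' = ?v" using \<phi>_h[rule_format, OF \<tau>'(1)] \<tau>'b by simp
    also have "\<phi> \<sigma>' = \<psi> \<sigma>" using \<phi>_h[rule_format, OF \<sigma>'(1)] \<sigma>'b \<sigma> by (simp add: \<psi>_def)
    also have "map \<sigma>' ?v = map \<sigma> (\<psi> \<tau>)" using \<sigma>'v \<tau> by (simp add: \<psi>_def)
    finally show "\<psi> (\<sigma> \<otimes>\<^bsub>AutGroup L S A B\<^esub> \<tau>) = \<psi> \<sigma> \<otimes> map \<sigma> (\<psi> \<tau>)" .
  qed
  show "res B C \<psi> = \<phi>"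
  proof (rule extensionalityI[of _ "Aut C"])
    show "res B C \<psi> \<in> extensional (Aut C)" "\<phi> \<in> extensional (Aut C)"
      using Z_ext[OF \<phi>] by (simp_all add: res_def)
    fix \<sigma> assume \<sigma>: "\<sigma> \<in> Aut C"
    have r: "restrict \<sigma> B \<in> Aut B" by (rule restrict_Aut[OF dnormalD(1)[OF B] dnormalD(1)[OF C] BC \<sigma>])
    have "map (restrict \<sigma> B) b = map \<sigma> b" using b by auto
    then show "res B C \<psi> \<sigma> = \<phi> \<sigma>"
      using \<phi>_h[rule_format, OF \<sigma>] \<sigma> r by (simp add: res_def \<psi>_def del: map_eq_conv)
  qed
qed

end

section \<open>Direct limits of pointed sets\<close>

text \<open>The maps \<open>T i\<close> form a compatible cone that is jointly onto \<open>Y\<close>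
  and injective up to passing to a later index; such a cone induces a bijection from the
  limit.\<close>

lemma direct_limit_bij:
  assumes dir: "directed_on I leq" and trans: "\<And>i j k. leq i j \<Longrightarrow> leq j k \<Longrightarrow> leq i k"
    and t: "\<And>i j x. i \<in> I \<Longrightarrow> j \<in> I \<Longrightarrow> leq i j \<Longrightarrow> x \<in> X i \<Longrightarrow> t i j x \<in> X j"
    and tt: "\<And>i j k x. i \<in> I \<Longrightarrow> j \<in> I \<Longrightarrow> k \<in> I \<Longrightarrow> leq i j \<Longrightarrow> leq j k \<Longrightarrow> x \<in> X i
       \<Longrightarrow> t j k (t i j x) = t i k x"
    and T: "\<And>i x. i \<in> I \<Longrightarrow> x \<in> X i \<Longrightarrow> T i x \<in> Y"
    and Tt: "\<And>i j x. i \<in> I \<Longrightarrow> j \<in> I \<Longrightarrow> leq i j \<Longrightarrow> x \<in> X i \<Longrightarrow> T j (t i j x) = T i x"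
    and inj: "\<And>i x y. i \<in> I \<Longrightarrow> x \<in> X i \<Longrightarrow> y \<in> X i \<Longrightarrow> T i x = T i y
       \<Longrightarrow> \<exists>k\<in>I. leq i k \<and> t i k x = t i k y"
    and surj: "\<And>y. y \<in> Y \<Longrightarrow> \<exists>i\<in>I. \<exists>x\<in>X i. T i x = y"
    and pt: "\<And>i. i \<in> I \<Longrightarrow> pt i \<in> X i" "\<And>i. i \<in> I \<Longrightarrow> T i (pt i) = b"
  shows "\<exists>F. bij_betw F (direct_limit I leq X t) Y \<and> F (direct_limit_base I leq X t pt) = b \<and>
    (\<forall>i\<in>I. \<forall>x\<in>X i. F (direct_limit_rel I leq X t `` {(i, x)}) = T i x)"
proof -
  let ?R = "direct_limit_rel I leq X t" and ?T = "\<lambda>p. T (fst p) (snd p)"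
  \<comment> \<open>The limit relation is the kernel of \<open>?T\<close>, which gives
    well-definedness and injectivity of the induced map at once. For the harder inclusion,
    directedness brings both points to one index, and \<open>inj\<close> identifies them at a later
    one.\<close>
  have R: "(p, q) \<in> ?R \<longleftrightarrow> p \<in> Sigma I X \<and> q \<in> Sigma I X \<and> ?T p = ?T q" for p q
  proof
    assume "(p, q) \<in> ?R"
    then obtain i x j y k where pq: "p = (i, x)" "q = (j, y)" "i \<in> I" "x \<in> X i" "j \<in> I" "y \<in> X j"
      and k: "k \<in> I" "leq i k" "leq j k" "t i k x = t j k y"
      by (auto simp: direct_limit_rel_def)
    have "T i x = T k (t i k x)" using Tt[OF pq(3) k(1,2) pq(4)] by simp
    also have "\<dots> = T j y" unfolding k(4) using Tt[OF pq(5) k(1,3) pq(6)] by simp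
    finally show "p \<in> Sigma I X \<and> q \<in> Sigma I X \<and> ?T p = ?T q" using pq by simp
  next
    assume *: "p \<in> Sigma I X \<and> q \<in> Sigma I X \<and> ?T p = ?T q"
    then obtain i x j y where pq: "p = (i, x)" "q = (j, y)" "i \<in> I" "x \<in> X i" "j \<in> I" "y \<in> X j"
      by auto
    obtain k where k: "k \<in> I" "leq i k" "leq j k"
      using dir pq(3,5) unfolding directed_on_def by blast
    have "T k (t i k x) = T k (t j k y)"
      using Tt[OF pq(3) k(1,2) pq(4)] Tt[OF pq(5) k(1,3) pq(6)] * pq by simp
    from inj[OF k(1) t[OF pq(3) k(1,2) pq(4)] t[OF pq(5) k(1,3) pq(6)] this]
    obtain l where l: "l \<in> I" "leq k l" "t k l (t i k x) = t k l (t j k y)" by auto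
    have "t i l x = t j l y"
      using l(3) tt[OF pq(3) k(1) l(1) k(2) l(2) pq(4)] tt[OF pq(5) k(1) l(1) k(3) l(2) pq(6)] by simp
    moreover have "leq i l" "leq j l" using trans k l(2) by blast+
    ultimately show "(p, q) \<in> ?R" using pq l(1) by (auto simp: direct_limit_rel_def)
  qed
  define F where "F c = the_elem (?T ` c)" for c
  have F: "F c = b'" if "c \<noteq> {}" "\<And>p. p \<in> c \<Longrightarrow> ?T p = b'" for c b'
  proof -
    have "?T ` c = {b'}" using that by auto
    then show ?thesis by (simp add: F_def)
  qed
  have F_class: "F (?R `` {p}) = ?T p" if "p \<in> Sigma I X" for p
    by (rule F) (use that R[of p] in auto)
  have "bij_betw F (direct_limit I leq X t) Y"
    unfolding bij_betw_def
  proof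
    show "inj_on F (direct_limit I leq X t)"
    proof (rule inj_onI)
      fix c d assume "c \<in> direct_limit I leq X t" "d \<in> direct_limit I leq X t" and eq: "F c = F d"
      then obtain p q where c: "p \<in> Sigma I X" "c = ?R `` {p}" and d: "q \<in> Sigma I X" "d = ?R `` {q}"
        unfolding direct_limit_def by (elim quotientE) blast
      have "?T p = ?T q" using eq F_class c d by simp
      then show "c = d" unfolding c(2) d(2) using R c(1) d(1) by auto
    qed
    show "F ` direct_limit I leq X t = Y"
    proof (intro equalityI subsetI)
      fix y assume "y \<in> F ` direct_limit I leq X t"
      then obtain p where "p \<in> Sigma I X" "y = F (?R `` {p})"
        unfolding direct_limit_def by (auto elim!: quotientE)
      then show "y \<in> Y" using F_class[of p] T by auto
    next
      fix y assume "y \<in> Y"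
      then obtain i x where ix: "i \<in> I" "x \<in> X i" "T i x = y" using surj by blast
      then have "(i, x) \<in> Sigma I X" by simp
      then have "?R `` {(i, x)} \<in> direct_limit I leq X t" "F (?R `` {(i, x)}) = y"
        using F_class[of "(i, x)"] ix by (auto simp: direct_limit_def intro: quotientI)
      then show "y \<in> F ` direct_limit I leq X t" by blast
    qed
  qed
  moreover have "F (direct_limit_base I leq X t pt) = b"
  proof (rule F)
    obtain i where "i \<in> I" using dir by (auto simp: directed_on_def)
    then have "((i, pt i), (i, pt i)) \<in> ?R" using R pt by simp
    then show "direct_limit_base I leq X t pt \<noteq> {}"
      using \<open>i \<in> I\<close> by (auto simp: direct_limit_base_def)
    fix p assume "p \<in> direct_limit_base I leq X t pt"
    then obtain i where "i \<in> I" "((i, pt i), p) \<in> ?R" by (auto simp: direct_limit_base_def)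
    then show "?T p = b" using R[of "(i, pt i)" p] pt(2) by simp
  qed
  moreover have "\<forall>i\<in>I. \<forall>x\<in>X i. F (?R `` {(i, x)}) = T i x"
    using F_class by simp
  ultimately show ?thesis by blast
qed

section \<open>The two limit isomorphisms\<close>

theorem lemma1p12:
  fixes L :: "('f, 'r) language"
    and T :: "('f, 'r) fm set"
    and \<kappa> :: "'k rel"
    and S :: "('f, 'r, 'm) struct"
    and A M B :: "'m set"
    and I :: "'i set"
    and Bs :: "'i \<Rightarrow> 'm set"
  assumes "complete_theory L T"
    and "monster_model L T \<kappa> S"
    and "totally_transcendental L S"
    and "eliminates_imaginaries L S"
    and "A \<subseteq> univ S" and "|A| <o \<kappa>"
    and "prime_over L T S A M"
    and "normal_set L S A M B"
    and "\<And>i. i \<in> I \<Longrightarrow> normal_set L S A M (Bs i) \<and> Bs i \<subseteq> B"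
    and "directed_on I (incl_order Bs)"
    and "(\<Union>i\<in>I. Bs i) = B"
  shows "(\<exists>F \<in> iso (Aut_limit L S A I Bs) (AutGroup L S A B).
            \<forall>x \<in> carrier (Aut_limit L S A I Bs). \<forall>i\<in>I. restrict (F x) (Bs i) = x i) \<and>
         (\<forall>n G. definable_group L S A n G \<longrightarrow> (\<forall>i\<in>I. dcl_closed L S (Bs i)) \<longrightarrow>
            (let X = (\<lambda>i. H1_def L S A n G (Bs i));
                 t = (\<lambda>i j. H1_trans L S A n G (Bs i) (Bs j))
             in \<exists>F. bij_betw F (direct_limit I (incl_order Bs) X t) (H1_def L S A n G B) \<and>
                    F (direct_limit_base I (incl_order Bs) X t (\<lambda>i. H1_base L S A n G (Bs i)))
                      = H1_base L S A n G B \<and>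
                    (\<forall>i\<in>I. \<forall>x\<in>X i. F (direct_limit_rel I (incl_order Bs) X t `` {(i, x)})
                      = H1_trans L S A n G (Bs i) B x)))"
proof -
  interpret fo_structure L S .
  have sub: "A \<subseteq> M" "M \<subseteq> U"
    using assms(7) by (simp_all add: prime_over_def elementary_substructure_def)
  interpret homogeneous_submodel L S A M
  proof
    fix F g
    assume "finite F" "F \<subseteq> M" "elem (A \<union> F) g" "\<And>a. a \<in> A \<Longrightarrow> g a = a" "g ` F \<subseteq> M"
    then show "\<exists>h. bij_betw h M M \<and> elem M h \<and> (\<forall>x\<in>A \<union> F. h x = g x)"
      by (rule prime_homogeneous[OF assms(1,2,3,7)])
  qed (use sub in auto)
  interpret normal_system L S A M I Bs B
    by unfold_locales (use assms(8,9,10,11) in auto)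
  show ?thesis
  proof (intro conjI allI impI)
    show "\<exists>F \<in> iso (Aut_limit L S A I Bs) (AutGroup L S A B).
        \<forall>x \<in> carrier (Aut_limit L S A I Bs). \<forall>i\<in>I. restrict (F x) (Bs i) = x i"
      using glue_iso glue_restrict by blast
  next
    fix n and G :: "'m list monoid"
    assume G: "definable_group L S A n G" and dcl: "\<forall>i\<in>I. dcl_closed L S (Bs i)"
    interpret definable_group_setting L S A M n G
      by unfold_locales (rule G)
    have Bs: "dnormal (Bs i)" if "i \<in> I" for i
      using normal_Bs[OF that] dcl that by (simp add: dnormal_def)
    have "B \<subseteq> U" using normal_sub(2)[OF normal_B] M_sub_U by simp
    then have B: "dnormal B"
      using normal_B dcl_closed_Union[OF directed union] dcl by (simp add: dnormal_def)
    have "\<exists>F. bij_betw F (direct_limit I (incl_order Bs) (\<lambda>i. H1 (Bs i)) (\<lambda>i j. tr (Bs i) (Bs j))) (H1 B) \<and>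
        F (direct_limit_base I (incl_order Bs) (\<lambda>i. H1 (Bs i)) (\<lambda>i j. tr (Bs i) (Bs j)) (\<lambda>i. pt (Bs i))) = pt B \<and>
        (\<forall>i\<in>I. \<forall>x\<in>H1 (Bs i).
          F (direct_limit_rel I (incl_order Bs) (\<lambda>i. H1 (Bs i)) (\<lambda>i j. tr (Bs i) (Bs j)) `` {(i, x)})
            = tr (Bs i) B x)"
    proof (rule direct_limit_bij[OF directed])
      show "incl_order Bs i j \<Longrightarrow> incl_order Bs j k \<Longrightarrow> incl_order Bs i k" for i j k
        by (auto simp: incl_order_def)
      show "i \<in> I \<Longrightarrow> j \<in> I \<Longrightarrow> incl_order Bs i j \<Longrightarrow> x \<in> H1 (Bs i) \<Longrightarrow> tr (Bs i) (Bs j) x \<in> H1 (Bs j)" for i j x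
        using tr_H1[OF Bs Bs] by (simp add: incl_order_def)
      show "i \<in> I \<Longrightarrow> j \<in> I \<Longrightarrow> k \<in> I \<Longrightarrow> incl_order Bs i j \<Longrightarrow> incl_order Bs j k \<Longrightarrow> x \<in> H1 (Bs i) \<Longrightarrow>
          tr (Bs j) (Bs k) (tr (Bs i) (Bs j) x) = tr (Bs i) (Bs k) x" for i j k x
        using tr_tr[OF Bs Bs Bs] by (simp add: incl_order_def)
      show "i \<in> I \<Longrightarrow> x \<in> H1 (Bs i) \<Longrightarrow> tr (Bs i) B x \<in> H1 B" for i x
        using tr_H1[OF Bs B Bs_sub] by simp
      show "i \<in> I \<Longrightarrow> j \<in> I \<Longrightarrow> incl_order Bs i j \<Longrightarrow> x \<in> H1 (Bs i) \<Longrightarrow>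
          tr (Bs j) B (tr (Bs i) (Bs j) x) = tr (Bs i) B x" for i j x
        using tr_tr[OF Bs Bs B _ Bs_sub] by (simp add: incl_order_def)
      show "i \<in> I \<Longrightarrow> pt (Bs i) \<in> H1 (Bs i)" "i \<in> I \<Longrightarrow> tr (Bs i) B (pt (Bs i)) = pt B" for i
        using pt_H1[OF Bs] tr_pt[OF Bs B Bs_sub] by simp_all
    next
      fix i x y assume i: "i \<in> I" and x: "x \<in> H1 (Bs i)" and y: "y \<in> H1 (Bs i)"
        and eq: "tr (Bs i) B x = tr (Bs i) B y"
      obtain \<phi> where \<phi>: "\<phi> \<in> Z (Bs i)" "x = coh (Bs i) `` {\<phi>}" using x by (rule H1E)
      obtain \<psi> where \<psi>: "\<psi> \<in> Z (Bs i)" "y = coh (Bs i) `` {\<psi>}" using y by (rule H1E)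
      note iB = Bs[OF i] B Bs_sub[OF i]
      have "coh B `` {res (Bs i) B \<phi>} = coh B `` {res (Bs i) B \<psi>}"
        using eq unfolding \<phi>(2) \<psi>(2) tr_class[OF iB \<phi>(1)] tr_class[OF iB \<psi>(1)] .
      then have "(res (Bs i) B \<phi>, res (Bs i) B \<psi>) \<in> coh B"
        using eq_equiv_class[OF _ coh_equiv[OF B] res_Z[OF iB \<psi>(1)]] by simp
      then obtain g where g: "g \<in> points G B" "\<forall>\<sigma>\<in>Aut B.
          res (Bs i) B \<phi> \<sigma> = inv\<^bsub>G\<^esub> g \<otimes>\<^bsub>G\<^esub> res (Bs i) B \<psi> \<sigma> \<otimes>\<^bsub>G\<^esub> map \<sigma> g"
        by (rule cohE)
      \<comment> \<open>The finitely many entries of the witness \<open>g\<close> lie in one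
        \<open>Bs j\<close>; at an index above \<open>i\<close> and \<open>j\<close> the cocycles
        are already cohomologous, by \<open>coh_descend\<close>.\<close>
      obtain j where j: "j \<in> I" "set g \<subseteq> Bs j" using finite_sub_Bs[of "set g"] g(1) by (auto simp: points_iff)
      obtain k where k: "k \<in> I" "Bs i \<subseteq> Bs k" "Bs j \<subseteq> Bs k" using upper[OF i j(1)] by auto
      note ik = Bs[OF i] Bs[OF k(1)] k(2) and kB = Bs[OF k(1)] B Bs_sub[OF k(1)]
      have rr: "res (Bs k) B (res (Bs i) (Bs k) \<chi>) = res (Bs i) B \<chi>" for \<chi>
        by (rule res_res[OF kB(1,2) k(2) kB(3)])
      have "(res (Bs i) (Bs k) \<phi>, res (Bs i) (Bs k) \<psi>) \<in> coh (Bs k)"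
      proof (rule coh_descend[OF kB res_Z[OF ik \<phi>(1)] res_Z[OF ik \<psi>(1)]])
        show "g \<in> points G (Bs k)" using g(1) j(2) k(3) by (auto simp: points_iff)
      qed (use g(2) in \<open>simp add: rr\<close>)
      then have "tr (Bs i) (Bs k) x = tr (Bs i) (Bs k) y"
        unfolding \<phi>(2) \<psi>(2) tr_class[OF ik \<phi>(1)] tr_class[OF ik \<psi>(1)]
        by (rule equiv_class_eq[OF coh_equiv[OF kB(1)]])
      then show "\<exists>k\<in>I. incl_order Bs i k \<and> tr (Bs i) (Bs k) x = tr (Bs i) (Bs k) y"
        using k(1,2) by (auto simp: incl_order_def)
    next
      fix y assume "y \<in> H1 B"
      then obtain \<phi> where \<phi>: "\<phi> \<in> Z B" "y = coh B `` {\<phi>}" by (rule H1E)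
      obtain b D h where b: "set b \<subseteq> B" "definable_function L S A (2 * length b) n D h"
        "\<forall>\<sigma>\<in>Aut B. b @ map \<sigma> b \<in> D \<and> \<phi> \<sigma> = h (b @ map \<sigma> b)"
        using \<phi>(1) unfolding definable_cocycles_def by auto
      \<comment> \<open>Any stage that contains the finite tuple \<open>b\<close> already carries a
        cocycle inflating to \<phi>.\<close>
      obtain i where i: "i \<in> I" "set b \<subseteq> Bs i" using finite_sub_Bs[of "set b"] b(1) by auto
      note iB = Bs[OF i(1)] B Bs_sub[OF i(1)]
      obtain \<psi> where \<psi>: "\<psi> \<in> Z (Bs i)" "res (Bs i) B \<psi> = \<phi>"
        using cocycle_descend[OF iB \<phi>(1) i(2) b(2,3)] by auto
      have "tr (Bs i) B (coh (Bs i) `` {\<psi>}) = y"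
        using tr_class[OF iB \<psi>(1)] \<psi>(2) \<phi>(2) by simp
      then show "\<exists>i\<in>I. \<exists>x\<in>H1 (Bs i). tr (Bs i) B x = y"
        using i(1) H1I[OF \<psi>(1)] by blast
    qed
    then show "let X = (\<lambda>i. H1 (Bs i)); t = (\<lambda>i j. tr (Bs i) (Bs j))
       in \<exists>F. bij_betw F (direct_limit I (incl_order Bs) X t) (H1 B) \<and>
              F (direct_limit_base I (incl_order Bs) X t (\<lambda>i. pt (Bs i))) = pt B \<and>
              (\<forall>i\<in>I. \<forall>x\<in>X i. F (direct_limit_rel I (incl_order Bs) X t `` {(i, x)}) = tr (Bs i) B x)"
      by (simp only: Let_def)
  qed
qed

end
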